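(* Assume propositional resizing. Then a type $D$ in a universe $\mathcal{U}$ is algebraically $\mathcal{U},\mathcal{U}$-injective if and only if $D$ is a retract of an exponential power of $\mathcal{U}$ with exponent in $\mathcal{U}$, i.e. if and only if there is a designated type $X:\mathcal{U}$ such that $D$ is a retract of the function type $X\to\mathcal{U}$. (This is a logical equivalence: constructions in both directions.)
   Context: Foundation: intensional Martin-Löf type theory with $\mathbb{0},\mathbb{1},\mathbb{N},+,\Pi,\Sigma,\mathrm{Id}$ and universes $\mathcal{U},\mathcal{V},\mathcal{W},\mathcal{T}$ (not assumed cumulative), with successor $\mathcal{U}^+$ and least upper bound $\mathcal{U}\sqcup\mathcal{V}$; if $X:\mathcal{U}$ and $A:X\to\mathcal{V}$ then $\Pi A,\Sigma A:\mathcal{U}\sqcup\mathcal{V}$. Univalence (hence function and propositional extensionality) and existence of propositional truncations are assumed. Excluded middle is neither assumed nor rejected. A proposition (subsingleton) is a type any two of whose elements are equal. A map $j:X\to Y$ is an embedding if each fiber $j^{-1}(y):=\Sigma(x:X),\,j\,x=y$ is a subsingleton; $X\hookrightarrow Y$ is the type of embeddings. $f\sim g$ means pointwise equality. "$A$ is a retract of $B$" means there are designated $s:A\to B$, $r:B\to A$ and $r\circ s\sim\mathrm{id}$. A type $D$ (in any universe) is algebraically $\mathcal{U},\mathcal{V}$-injective if it is equipped with an element of $$\Pi(X:\mathcal{U})\,\Pi(Y:\mathcal{V})\,\Pi(j:X\hookrightarrow Y)\,\Pi(f:X\to D),\ \Sigma(g:Y\to D),\ g\circ j\sim f.$$ Propositional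 resizing: for any two universes $\mathcal{U},\mathcal{V}$, every proposition in $\mathcal{U}$ has an equivalent copy in $\mathcal{V}$. *)

theory Defs
  imports Main
begin

section \<open>Universe levels\<close>

text \<open>
  An arbitrary algebra of universe levels: binary least upper bounds and a successor.  The order
  is only used to say which joins coincide; it does not induce any cumulativity of universes.
  The laws hold for level expressions over universe variables as well as for the natural numbers.
\<close>

class ulevel = semilattice_sup +
  fixes usuc :: "'a \<Rightarrow> 'a"
  assumes usuc_greater: "u < usuc u"
    and usuc_sup: "usuc (sup u v) = sup (usuc u) (usuc v)"

instantiation nat :: ulevel
begin
definition usuc_nat :: "nat \<Rightarrow> nat" where "usuc_nat = Suc"
instance by standard (auto simp: usuc_nat_def sup_nat_def)
end


section \<open>Raw terms\<close>

text \<open>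
  De Bruijn syntax with universes a la Russell.  The numbers in the comments say how many
  variables the arguments bind, the last bound variable being \<open>Var 0\<close>.  The first argument of
  every eliminator but \<open>App\<close> is its motive, the first argument of \<open>Lam\<close> is the domain, that of
  \<open>Pr\<close> is the family of the second components, and that of \<open>InL\<close> and \<open>InR\<close> is the other summand.
  Without motives, \<open>J (Lam (Var 0)) p\<close> for a loop \<open>p\<close> at a type \<open>A\<close> could be typed both as
  transport and, with a constant motive, as a term equal to the identity, contradicting
  univalence; the annotations prevent this.
  Constants of type \<open>'c\<close> stand for assumed (axiomatic) inhabitants of closed types.
\<close>

datatype ('c, 'l) tm =
    Var nat
  | Const 'c
  | Univ 'l
  | Pi "('c, 'l) tm" "('c, 'l) tm"                                      (* 0, 1 *)
  | Lam "('c, 'l) tm" "('c, 'l) tm"                                     (* 0, 1 *)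
  | App "('c, 'l) tm" "('c, 'l) tm"
  | Sg "('c, 'l) tm" "('c, 'l) tm"                                      (* 0, 1 *)
  | Pr "('c, 'l) tm" "('c, 'l) tm" "('c, 'l) tm"                        (* 1, 0, 0 *)
  | Split "('c, 'l) tm" "('c, 'l) tm" "('c, 'l) tm"                     (* 1, 2, 0 *)
  | Plus "('c, 'l) tm" "('c, 'l) tm"
  | InL "('c, 'l) tm" "('c, 'l) tm"
  | InR "('c, 'l) tm" "('c, 'l) tm"
  | Cases "('c, 'l) tm" "('c, 'l) tm" "('c, 'l) tm" "('c, 'l) tm"       (* 1, 1, 1, 0 *)
  | Emp 'l
  | Abort "('c, 'l) tm" "('c, 'l) tm"                                   (* 1, 0 *)
  | One 'l
  | Star 'l
  | OneRec "('c, 'l) tm" "('c, 'l) tm" "('c, 'l) tm"                    (* 1, 0, 0 *)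
  | Nats 'l
  | Ze 'l
  | Su "('c, 'l) tm"
  | NatRec "('c, 'l) tm" "('c, 'l) tm" "('c, 'l) tm" "('c, 'l) tm"      (* 1, 0, 2, 0 *)
  | Id "('c, 'l) tm" "('c, 'l) tm" "('c, 'l) tm"
  | Refl "('c, 'l) tm"
  | J "('c, 'l) tm" "('c, 'l) tm" "('c, 'l) tm"                         (* 3, 1, 0 *)

primrec lift_ren :: "(nat \<Rightarrow> nat) \<Rightarrow> nat \<Rightarrow> nat" where
  "lift_ren r 0 = 0"
| "lift_ren r (Suc i) = Suc (r i)"

primrec ren :: "(nat \<Rightarrow> nat) \<Rightarrow> ('c, 'l) tm \<Rightarrow> ('c, 'l) tm" where
  "ren r (Var i) = Var (r i)"
| "ren r (Const c) = Const c"
| "ren r (Univ u) = Univ u"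
| "ren r (Pi A B) = Pi (ren r A) (ren (lift_ren r) B)"
| "ren r (Lam A b) = Lam (ren r A) (ren (lift_ren r) b)"
| "ren r (App f a) = App (ren r f) (ren r a)"
| "ren r (Sg A B) = Sg (ren r A) (ren (lift_ren r) B)"
| "ren r (Pr B a b) = Pr (ren (lift_ren r) B) (ren r a) (ren r b)"
| "ren r (Split C d p) = Split (ren (lift_ren r) C) (ren (lift_ren (lift_ren r)) d) (ren r p)"
| "ren r (Plus A B) = Plus (ren r A) (ren r B)"
| "ren r (InL B a) = InL (ren r B) (ren r a)"
| "ren r (InR A b) = InR (ren r A) (ren r b)"
| "ren r (Cases C d e p) = Cases (ren (lift_ren r) C) (ren (lift_ren r) d) (ren (lift_ren r) e) (ren r p)"
| "ren r (Emp u) = Emp u"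
| "ren r (Abort C p) = Abort (ren (lift_ren r) C) (ren r p)"
| "ren r (One u) = One u"
| "ren r (Star u) = Star u"
| "ren r (OneRec C d p) = OneRec (ren (lift_ren r) C) (ren r d) (ren r p)"
| "ren r (Nats u) = Nats u"
| "ren r (Ze u) = Ze u"
| "ren r (Su n) = Su (ren r n)"
| "ren r (NatRec C d e n) = NatRec (ren (lift_ren r) C) (ren r d) (ren (lift_ren (lift_ren r)) e) (ren r n)"
| "ren r (Id A a b) = Id (ren r A) (ren r a) (ren r b)"
| "ren r (Refl a) = Refl (ren r a)"
| "ren r (J C d p) = J (ren (lift_ren (lift_ren (lift_ren r))) C) (ren (lift_ren r) d) (ren r p)"

definition wk :: "('c, 'l) tm \<Rightarrow> ('c, 'l) tm" where
  "wk = ren Suc"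

primrec scons :: "('c, 'l) tm \<Rightarrow> (nat \<Rightarrow> ('c, 'l) tm) \<Rightarrow> nat \<Rightarrow> ('c, 'l) tm"  (infixr "\<bullet>" 60) where
  "(a \<bullet> s) 0 = a"
| "(a \<bullet> s) (Suc i) = s i"

definition lift_sub :: "(nat \<Rightarrow> ('c, 'l) tm) \<Rightarrow> nat \<Rightarrow> ('c, 'l) tm" where
  "lift_sub s = Var 0 \<bullet> (\<lambda>i. wk (s i))"

primrec sub :: "(nat \<Rightarrow> ('c, 'l) tm) \<Rightarrow> ('c, 'l) tm \<Rightarrow> ('c, 'l) tm" where
  "sub s (Var i) = s i"
| "sub s (Const c) = Const c"
| "sub s (Univ u) = Univ u"
| "sub s (Pi A B) = Pi (sub s A) (sub (lift_sub s) B)"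
| "sub s (Lam A b) = Lam (sub s A) (sub (lift_sub s) b)"
| "sub s (App f a) = App (sub s f) (sub s a)"
| "sub s (Sg A B) = Sg (sub s A) (sub (lift_sub s) B)"
| "sub s (Pr B a b) = Pr (sub (lift_sub s) B) (sub s a) (sub s b)"
| "sub s (Split C d p) = Split (sub (lift_sub s) C) (sub (lift_sub (lift_sub s)) d) (sub s p)"
| "sub s (Plus A B) = Plus (sub s A) (sub s B)"
| "sub s (InL B a) = InL (sub s B) (sub s a)"
| "sub s (InR A b) = InR (sub s A) (sub s b)"
| "sub s (Cases C d e p) = Cases (sub (lift_sub s) C) (sub (lift_sub s) d) (sub (lift_sub s) e) (sub s p)"
| "sub s (Emp u) = Emp u"
| "sub s (Abort C p) = Abort (sub (lift_sub s) C) (sub s p)"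
| "sub s (One u) = One u"
| "sub s (Star u) = Star u"
| "sub s (OneRec C d p) = OneRec (sub (lift_sub s) C) (sub s d) (sub s p)"
| "sub s (Nats u) = Nats u"
| "sub s (Ze u) = Ze u"
| "sub s (Su n) = Su (sub s n)"
| "sub s (NatRec C d e n) = NatRec (sub (lift_sub s) C) (sub s d) (sub (lift_sub (lift_sub s)) e) (sub s n)"
| "sub s (Id A a b) = Id (sub s A) (sub s a) (sub s b)"
| "sub s (Refl a) = Refl (sub s a)"
| "sub s (J C d p) = J (sub (lift_sub (lift_sub (lift_sub s))) C) (sub (lift_sub s) d) (sub s p)"

abbreviation shift_by :: "nat \<Rightarrow> nat \<Rightarrow> ('c, 'l) tm" where
  "shift_by n \<equiv> \<lambda>i. Var (i + n)"


section \<open>Judgements\<close>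

text \<open>
  A signature assigns closed types to some constants; a constant can only be used if its declared
  type is derivably a type.  Contexts list the type of the most recent variable first, each entry
  living in the context formed by the entries after it.  Types are the elements of universes:
  there is no cumulativity, and every \<open>\<Pi>\<close>, \<open>\<Sigma>\<close> and \<open>+\<close> lives in the join of the levels of its
  parts.  The only uniqueness (eta) rule is the one for functions, and there is no equality
  reflection and no uniqueness of identity proofs.
\<close>

type_synonym ('c, 'l) sig = "'c \<Rightarrow> ('c, 'l) tm option"

inductive
  wf_ctx :: "('c, 'l::ulevel) sig \<Rightarrow> ('c, 'l) tm list \<Rightarrow> bool"
    ("_ \<triangleright> _ ctx" [51, 51] 50) and
  has_type :: "('c, 'l::ulevel) sig \<Rightarrow> ('c, 'l) tm list \<Rightarrow> ('c, 'l) tm \<Rightarrow> ('c, 'l) tm \<Rightarrow> bool"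
    ("_ \<triangleright> _ \<turnstile> _ \<Colon> _" [51, 51, 51, 51] 50) and
  eq_tm :: "('c, 'l::ulevel) sig \<Rightarrow> ('c, 'l) tm list \<Rightarrow> ('c, 'l) tm \<Rightarrow> ('c, 'l) tm \<Rightarrow> ('c, 'l) tm \<Rightarrow> bool"
    ("_ \<triangleright> _ \<turnstile> _ \<doteq> _ \<Colon> _" [51, 51, 51, 51, 51] 50)
  for S :: "('c, 'l::ulevel) sig"
where
  ctx_nil: "S \<triangleright> [] ctx"
| ctx_cons: "S \<triangleright> \<Gamma> ctx \<Longrightarrow> S \<triangleright> \<Gamma> \<turnstile> A \<Colon> Univ u \<Longrightarrow> S \<triangleright> A # \<Gamma> ctx"

| var: "S \<triangleright> \<Gamma> ctx \<Longrightarrow> i < length \<Gamma> \<Longrightarrow> S \<triangleright> \<Gamma> \<turnstile> Var i \<Colon> sub (shift_by (Suc i)) (\<Gamma> ! i)"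
| const: "S \<triangleright> \<Gamma> ctx \<Longrightarrow> S c = Some A \<Longrightarrow> S \<triangleright> [] \<turnstile> A \<Colon> Univ u \<Longrightarrow> S \<triangleright> \<Gamma> \<turnstile> Const c \<Colon> A"
| conv: "S \<triangleright> \<Gamma> \<turnstile> a \<Colon> A \<Longrightarrow> S \<triangleright> \<Gamma> \<turnstile> A \<doteq> B \<Colon> Univ u \<Longrightarrow> S \<triangleright> \<Gamma> \<turnstile> a \<Colon> B"
| univ: "S \<triangleright> \<Gamma> ctx \<Longrightarrow> S \<triangleright> \<Gamma> \<turnstile> Univ u \<Colon> Univ (usuc u)"

| pi_form: "S \<triangleright> \<Gamma> \<turnstile> A \<Colon> Univ u \<Longrightarrow> S \<triangleright> A # \<Gamma> \<turnstile> B \<Colon> Univ v \<Longrightarrow> S \<triangleright> \<Gamma> \<turnstile> Pi A B \<Colon> Univ (sup u v)"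
| pi_intro: "S \<triangleright> \<Gamma> \<turnstile> A \<Colon> Univ u \<Longrightarrow> S \<triangleright> A # \<Gamma> \<turnstile> b \<Colon> B \<Longrightarrow> S \<triangleright> \<Gamma> \<turnstile> Lam A b \<Colon> Pi A B"
| pi_elim: "S \<triangleright> \<Gamma> \<turnstile> f \<Colon> Pi A B \<Longrightarrow> S \<triangleright> \<Gamma> \<turnstile> a \<Colon> A \<Longrightarrow> S \<triangleright> \<Gamma> \<turnstile> App f a \<Colon> sub (a \<bullet> Var) B"

| sg_form: "S \<triangleright> \<Gamma> \<turnstile> A \<Colon> Univ u \<Longrightarrow> S \<triangleright> A # \<Gamma> \<turnstile> B \<Colon> Univ v \<Longrightarrow> S \<triangleright> \<Gamma> \<turnstile> Sg A B \<Colon> Univ (sup u v)"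
| sg_intro: "S \<triangleright> A # \<Gamma> \<turnstile> B \<Colon> Univ v \<Longrightarrow> S \<triangleright> \<Gamma> \<turnstile> a \<Colon> A \<Longrightarrow> S \<triangleright> \<Gamma> \<turnstile> b \<Colon> sub (a \<bullet> Var) B \<Longrightarrow>
    S \<triangleright> \<Gamma> \<turnstile> Pr B a b \<Colon> Sg A B"
| sg_elim: "S \<triangleright> Sg A B # \<Gamma> \<turnstile> C \<Colon> Univ w \<Longrightarrow>
    S \<triangleright> B # A # \<Gamma> \<turnstile> d \<Colon> sub (Pr (sub (Var 0 \<bullet> shift_by 3) B) (Var 1) (Var 0) \<bullet> shift_by 2) C \<Longrightarrow>
    S \<triangleright> \<Gamma> \<turnstile> p \<Colon> Sg A B \<Longrightarrow> S \<triangleright> \<Gamma> \<turnstile> Split C d p \<Colon> sub (p \<bullet> Var) C"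

| plus_form: "S \<triangleright> \<Gamma> \<turnstile> A \<Colon> Univ u \<Longrightarrow> S \<triangleright> \<Gamma> \<turnstile> B \<Colon> Univ v \<Longrightarrow> S \<triangleright> \<Gamma> \<turnstile> Plus A B \<Colon> Univ (sup u v)"
| plus_introL: "S \<triangleright> \<Gamma> \<turnstile> a \<Colon> A \<Longrightarrow> S \<triangleright> \<Gamma> \<turnstile> Plus A B \<Colon> Univ u \<Longrightarrow> S \<triangleright> \<Gamma> \<turnstile> InL B a \<Colon> Plus A B"
| plus_introR: "S \<triangleright> \<Gamma> \<turnstile> b \<Colon> B \<Longrightarrow> S \<triangleright> \<Gamma> \<turnstile> Plus A B \<Colon> Univ u \<Longrightarrow> S \<triangleright> \<Gamma> \<turnstile> InR A b \<Colon> Plus A B"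
| plus_elim: "S \<triangleright> Plus A B # \<Gamma> \<turnstile> C \<Colon> Univ w \<Longrightarrow>
    S \<triangleright> A # \<Gamma> \<turnstile> d \<Colon> sub (InL (wk B) (Var 0) \<bullet> shift_by 1) C \<Longrightarrow>
    S \<triangleright> B # \<Gamma> \<turnstile> e \<Colon> sub (InR (wk A) (Var 0) \<bullet> shift_by 1) C \<Longrightarrow>
    S \<triangleright> \<Gamma> \<turnstile> p \<Colon> Plus A B \<Longrightarrow> S \<triangleright> \<Gamma> \<turnstile> Cases C d e p \<Colon> sub (p \<bullet> Var) C"

| emp_form: "S \<triangleright> \<Gamma> ctx \<Longrightarrow> S \<triangleright> \<Gamma> \<turnstile> Emp u \<Colon> Univ u"
| emp_elim: "S \<triangleright> Emp u # \<Gamma> \<turnstile> C \<Colon> Univ w \<Longrightarrow> S \<triangleright> \<Gamma> \<turnstile> p \<Colon> Emp u \<Longrightarrow> S \<triangleright> \<Gamma> \<turnstile> Abort C p \<Colon> sub (p \<bullet> Var) C"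

| one_form: "S \<triangleright> \<Gamma> ctx \<Longrightarrow> S \<triangleright> \<Gamma> \<turnstile> One u \<Colon> Univ u"
| one_intro: "S \<triangleright> \<Gamma> ctx \<Longrightarrow> S \<triangleright> \<Gamma> \<turnstile> Star u \<Colon> One u"
| one_elim: "S \<triangleright> One u # \<Gamma> \<turnstile> C \<Colon> Univ w \<Longrightarrow> S \<triangleright> \<Gamma> \<turnstile> d \<Colon> sub (Star u \<bullet> Var) C \<Longrightarrow>
    S \<triangleright> \<Gamma> \<turnstile> p \<Colon> One u \<Longrightarrow> S \<triangleright> \<Gamma> \<turnstile> OneRec C d p \<Colon> sub (p \<bullet> Var) C"

| nat_form: "S \<triangleright> \<Gamma> ctx \<Longrightarrow> S \<triangleright> \<Gamma> \<turnstile> Nats u \<Colon> Univ u"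
| nat_intro0: "S \<triangleright> \<Gamma> ctx \<Longrightarrow> S \<triangleright> \<Gamma> \<turnstile> Ze u \<Colon> Nats u"
| nat_introS: "S \<triangleright> \<Gamma> \<turnstile> n \<Colon> Nats u \<Longrightarrow> S \<triangleright> \<Gamma> \<turnstile> Su n \<Colon> Nats u"
| nat_elim: "S \<triangleright> Nats u # \<Gamma> \<turnstile> C \<Colon> Univ w \<Longrightarrow> S \<triangleright> \<Gamma> \<turnstile> d \<Colon> sub (Ze u \<bullet> Var) C \<Longrightarrow>
    S \<triangleright> C # Nats u # \<Gamma> \<turnstile> e \<Colon> sub (Su (Var 1) \<bullet> shift_by 2) C \<Longrightarrow>
    S \<triangleright> \<Gamma> \<turnstile> n \<Colon> Nats u \<Longrightarrow> S \<triangleright> \<Gamma> \<turnstile> NatRec C d e n \<Colon> sub (n \<bullet> Var) C"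

| id_form: "S \<triangleright> \<Gamma> \<turnstile> A \<Colon> Univ u \<Longrightarrow> S \<triangleright> \<Gamma> \<turnstile> a \<Colon> A \<Longrightarrow> S \<triangleright> \<Gamma> \<turnstile> b \<Colon> A \<Longrightarrow> S \<triangleright> \<Gamma> \<turnstile> Id A a b \<Colon> Univ u"
| id_intro: "S \<triangleright> \<Gamma> \<turnstile> a \<Colon> A \<Longrightarrow> S \<triangleright> \<Gamma> \<turnstile> Refl a \<Colon> Id A a a"
| id_elim: "S \<triangleright> Id (wk (wk A)) (Var 1) (Var 0) # wk A # A # \<Gamma> \<turnstile> C \<Colon> Univ w \<Longrightarrow>
    S \<triangleright> A # \<Gamma> \<turnstile> d \<Colon> sub (Refl (Var 0) \<bullet> Var 0 \<bullet> Var 0 \<bullet> shift_by 1) C \<Longrightarrow>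
    S \<triangleright> \<Gamma> \<turnstile> a \<Colon> A \<Longrightarrow> S \<triangleright> \<Gamma> \<turnstile> b \<Colon> A \<Longrightarrow> S \<triangleright> \<Gamma> \<turnstile> p \<Colon> Id A a b \<Longrightarrow>
    S \<triangleright> \<Gamma> \<turnstile> J C d p \<Colon> sub (p \<bullet> b \<bullet> a \<bullet> Var) C"

| eq_refl: "S \<triangleright> \<Gamma> \<turnstile> a \<Colon> A \<Longrightarrow> S \<triangleright> \<Gamma> \<turnstile> a \<doteq> a \<Colon> A"
| eq_sym: "S \<triangleright> \<Gamma> \<turnstile> a \<doteq> b \<Colon> A \<Longrightarrow> S \<triangleright> \<Gamma> \<turnstile> b \<doteq> a \<Colon> A"
| eq_trans: "S \<triangleright> \<Gamma> \<turnstile> a \<doteq> b \<Colon> A \<Longrightarrow> S \<triangleright> \<Gamma> \<turnstile> b \<doteq> c \<Colon> A \<Longrightarrow> S \<triangleright> \<Gamma> \<turnstile> a \<doteq> c \<Colon> A"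
| eq_conv: "S \<triangleright> \<Gamma> \<turnstile> a \<doteq> b \<Colon> A \<Longrightarrow> S \<triangleright> \<Gamma> \<turnstile> A \<doteq> B \<Colon> Univ u \<Longrightarrow> S \<triangleright> \<Gamma> \<turnstile> a \<doteq> b \<Colon> B"

| pi_beta: "S \<triangleright> \<Gamma> \<turnstile> A \<Colon> Univ u \<Longrightarrow> S \<triangleright> A # \<Gamma> \<turnstile> b \<Colon> B \<Longrightarrow> S \<triangleright> \<Gamma> \<turnstile> a \<Colon> A \<Longrightarrow>
    S \<triangleright> \<Gamma> \<turnstile> App (Lam A b) a \<doteq> sub (a \<bullet> Var) b \<Colon> sub (a \<bullet> Var) B"
| pi_eta: "S \<triangleright> \<Gamma> \<turnstile> f \<Colon> Pi A B \<Longrightarrow> S \<triangleright> \<Gamma> \<turnstile> f \<doteq> Lam A (App (wk f) (Var 0)) \<Colon> Pi A B"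
| sg_beta: "S \<triangleright> Sg A B # \<Gamma> \<turnstile> C \<Colon> Univ w \<Longrightarrow>
    S \<triangleright> B # A # \<Gamma> \<turnstile> d \<Colon> sub (Pr (sub (Var 0 \<bullet> shift_by 3) B) (Var 1) (Var 0) \<bullet> shift_by 2) C \<Longrightarrow>
    S \<triangleright> \<Gamma> \<turnstile> a \<Colon> A \<Longrightarrow> S \<triangleright> \<Gamma> \<turnstile> b \<Colon> sub (a \<bullet> Var) B \<Longrightarrow>
    S \<triangleright> \<Gamma> \<turnstile> Split C d (Pr B a b) \<doteq> sub (b \<bullet> a \<bullet> Var) d \<Colon> sub (Pr B a b \<bullet> Var) C"
| plus_betaL: "S \<triangleright> Plus A B # \<Gamma> \<turnstile> C \<Colon> Univ w \<Longrightarrow>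
    S \<triangleright> A # \<Gamma> \<turnstile> d \<Colon> sub (InL (wk B) (Var 0) \<bullet> shift_by 1) C \<Longrightarrow>
    S \<triangleright> B # \<Gamma> \<turnstile> e \<Colon> sub (InR (wk A) (Var 0) \<bullet> shift_by 1) C \<Longrightarrow>
    S \<triangleright> \<Gamma> \<turnstile> a \<Colon> A \<Longrightarrow> S \<triangleright> \<Gamma> \<turnstile> Cases C d e (InL B a) \<doteq> sub (a \<bullet> Var) d \<Colon> sub (InL B a \<bullet> Var) C"
| plus_betaR: "S \<triangleright> Plus A B # \<Gamma> \<turnstile> C \<Colon> Univ w \<Longrightarrow>
    S \<triangleright> A # \<Gamma> \<turnstile> d \<Colon> sub (InL (wk B) (Var 0) \<bullet> shift_by 1) C \<Longrightarrow>
    S \<triangleright> B # \<Gamma> \<turnstile> e \<Colon> sub (InR (wk A) (Var 0) \<bullet> shift_by 1) C \<Longrightarrow>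
    S \<triangleright> \<Gamma> \<turnstile> b \<Colon> B \<Longrightarrow> S \<triangleright> \<Gamma> \<turnstile> Cases C d e (InR A b) \<doteq> sub (b \<bullet> Var) e \<Colon> sub (InR A b \<bullet> Var) C"
| one_beta: "S \<triangleright> One u # \<Gamma> \<turnstile> C \<Colon> Univ w \<Longrightarrow> S \<triangleright> \<Gamma> \<turnstile> d \<Colon> sub (Star u \<bullet> Var) C \<Longrightarrow>
    S \<triangleright> \<Gamma> \<turnstile> OneRec C d (Star u) \<doteq> d \<Colon> sub (Star u \<bullet> Var) C"
| nat_beta0: "S \<triangleright> Nats u # \<Gamma> \<turnstile> C \<Colon> Univ w \<Longrightarrow> S \<triangleright> \<Gamma> \<turnstile> d \<Colon> sub (Ze u \<bullet> Var) C \<Longrightarrow>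
    S \<triangleright> C # Nats u # \<Gamma> \<turnstile> e \<Colon> sub (Su (Var 1) \<bullet> shift_by 2) C \<Longrightarrow>
    S \<triangleright> \<Gamma> \<turnstile> NatRec C d e (Ze u) \<doteq> d \<Colon> sub (Ze u \<bullet> Var) C"
| nat_betaS: "S \<triangleright> Nats u # \<Gamma> \<turnstile> C \<Colon> Univ w \<Longrightarrow> S \<triangleright> \<Gamma> \<turnstile> d \<Colon> sub (Ze u \<bullet> Var) C \<Longrightarrow>
    S \<triangleright> C # Nats u # \<Gamma> \<turnstile> e \<Colon> sub (Su (Var 1) \<bullet> shift_by 2) C \<Longrightarrow>
    S \<triangleright> \<Gamma> \<turnstile> n \<Colon> Nats u \<Longrightarrow>
    S \<triangleright> \<Gamma> \<turnstile> NatRec C d e (Su n) \<doteq> sub (NatRec C d e n \<bullet> n \<bullet> Var) e \<Colon> sub (Su n \<bullet> Var) C"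
| id_beta: "S \<triangleright> Id (wk (wk A)) (Var 1) (Var 0) # wk A # A # \<Gamma> \<turnstile> C \<Colon> Univ w \<Longrightarrow>
    S \<triangleright> A # \<Gamma> \<turnstile> d \<Colon> sub (Refl (Var 0) \<bullet> Var 0 \<bullet> Var 0 \<bullet> shift_by 1) C \<Longrightarrow>
    S \<triangleright> \<Gamma> \<turnstile> a \<Colon> A \<Longrightarrow>
    S \<triangleright> \<Gamma> \<turnstile> J C d (Refl a) \<doteq> sub (a \<bullet> Var) d \<Colon> sub (Refl a \<bullet> a \<bullet> a \<bullet> Var) C"

| pi_cong: "S \<triangleright> \<Gamma> \<turnstile> A \<Colon> Univ u \<Longrightarrow> S \<triangleright> \<Gamma> \<turnstile> A \<doteq> A' \<Colon> Univ u \<Longrightarrow> S \<triangleright> A # \<Gamma> \<turnstile> B \<doteq> B' \<Colon> Univ v \<Longrightarrow>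
    S \<triangleright> \<Gamma> \<turnstile> Pi A B \<doteq> Pi A' B' \<Colon> Univ (sup u v)"
| lam_cong: "S \<triangleright> \<Gamma> \<turnstile> A \<Colon> Univ u \<Longrightarrow> S \<triangleright> \<Gamma> \<turnstile> A \<doteq> A' \<Colon> Univ u \<Longrightarrow> S \<triangleright> A # \<Gamma> \<turnstile> b \<doteq> b' \<Colon> B \<Longrightarrow>
    S \<triangleright> \<Gamma> \<turnstile> Lam A b \<doteq> Lam A' b' \<Colon> Pi A B"
| app_cong: "S \<triangleright> \<Gamma> \<turnstile> f \<doteq> f' \<Colon> Pi A B \<Longrightarrow> S \<triangleright> \<Gamma> \<turnstile> a \<doteq> a' \<Colon> A \<Longrightarrow>
    S \<triangleright> \<Gamma> \<turnstile> App f a \<doteq> App f' a' \<Colon> sub (a \<bullet> Var) B"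
| sg_cong: "S \<triangleright> \<Gamma> \<turnstile> A \<Colon> Univ u \<Longrightarrow> S \<triangleright> \<Gamma> \<turnstile> A \<doteq> A' \<Colon> Univ u \<Longrightarrow> S \<triangleright> A # \<Gamma> \<turnstile> B \<doteq> B' \<Colon> Univ v \<Longrightarrow>
    S \<triangleright> \<Gamma> \<turnstile> Sg A B \<doteq> Sg A' B' \<Colon> Univ (sup u v)"
| pr_cong: "S \<triangleright> A # \<Gamma> \<turnstile> B \<Colon> Univ v \<Longrightarrow> S \<triangleright> A # \<Gamma> \<turnstile> B \<doteq> B' \<Colon> Univ v \<Longrightarrow>
    S \<triangleright> \<Gamma> \<turnstile> a \<doteq> a' \<Colon> A \<Longrightarrow>
    S \<triangleright> \<Gamma> \<turnstile> b \<doteq> b' \<Colon> sub (a \<bullet> Var) B \<Longrightarrow> S \<triangleright> \<Gamma> \<turnstile> Pr B a b \<doteq> Pr B' a' b' \<Colon> Sg A B"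
| split_cong: "S \<triangleright> Sg A B # \<Gamma> \<turnstile> C \<Colon> Univ w \<Longrightarrow>
    S \<triangleright> Sg A B # \<Gamma> \<turnstile> C \<doteq> C' \<Colon> Univ w \<Longrightarrow>
    S \<triangleright> B # A # \<Gamma> \<turnstile> d \<doteq> d' \<Colon> sub (Pr (sub (Var 0 \<bullet> shift_by 3) B) (Var 1) (Var 0) \<bullet> shift_by 2) C \<Longrightarrow>
    S \<triangleright> \<Gamma> \<turnstile> p \<doteq> p' \<Colon> Sg A B \<Longrightarrow> S \<triangleright> \<Gamma> \<turnstile> Split C d p \<doteq> Split C' d' p' \<Colon> sub (p \<bullet> Var) C"
| plus_cong: "S \<triangleright> \<Gamma> \<turnstile> A \<doteq> A' \<Colon> Univ u \<Longrightarrow> S \<triangleright> \<Gamma> \<turnstile> B \<doteq> B' \<Colon> Univ v \<Longrightarrow>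
    S \<triangleright> \<Gamma> \<turnstile> Plus A B \<doteq> Plus A' B' \<Colon> Univ (sup u v)"
| inL_cong: "S \<triangleright> \<Gamma> \<turnstile> a \<doteq> a' \<Colon> A \<Longrightarrow> S \<triangleright> \<Gamma> \<turnstile> Plus A B \<Colon> Univ u \<Longrightarrow>
    S \<triangleright> \<Gamma> \<turnstile> B \<doteq> B' \<Colon> Univ v \<Longrightarrow> S \<triangleright> \<Gamma> \<turnstile> InL B a \<doteq> InL B' a' \<Colon> Plus A B"
| inR_cong: "S \<triangleright> \<Gamma> \<turnstile> b \<doteq> b' \<Colon> B \<Longrightarrow> S \<triangleright> \<Gamma> \<turnstile> Plus A B \<Colon> Univ u \<Longrightarrow>
    S \<triangleright> \<Gamma> \<turnstile> A \<doteq> A' \<Colon> Univ v \<Longrightarrow> S \<triangleright> \<Gamma> \<turnstile> InR A b \<doteq> InR A' b' \<Colon> Plus A B"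
| cases_cong: "S \<triangleright> Plus A B # \<Gamma> \<turnstile> C \<Colon> Univ w \<Longrightarrow>
    S \<triangleright> Plus A B # \<Gamma> \<turnstile> C \<doteq> C' \<Colon> Univ w \<Longrightarrow>
    S \<triangleright> A # \<Gamma> \<turnstile> d \<doteq> d' \<Colon> sub (InL (wk B) (Var 0) \<bullet> shift_by 1) C \<Longrightarrow>
    S \<triangleright> B # \<Gamma> \<turnstile> e \<doteq> e' \<Colon> sub (InR (wk A) (Var 0) \<bullet> shift_by 1) C \<Longrightarrow>
    S \<triangleright> \<Gamma> \<turnstile> p \<doteq> p' \<Colon> Plus A B \<Longrightarrow> S \<triangleright> \<Gamma> \<turnstile> Cases C d e p \<doteq> Cases C' d' e' p' \<Colon> sub (p \<bullet> Var) C"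
| abort_cong: "S \<triangleright> Emp u # \<Gamma> \<turnstile> C \<Colon> Univ w \<Longrightarrow>
    S \<triangleright> Emp u # \<Gamma> \<turnstile> C \<doteq> C' \<Colon> Univ w \<Longrightarrow>
    S \<triangleright> \<Gamma> \<turnstile> p \<doteq> p' \<Colon> Emp u \<Longrightarrow>
    S \<triangleright> \<Gamma> \<turnstile> Abort C p \<doteq> Abort C' p' \<Colon> sub (p \<bullet> Var) C"
| oneRec_cong: "S \<triangleright> One u # \<Gamma> \<turnstile> C \<Colon> Univ w \<Longrightarrow>
    S \<triangleright> One u # \<Gamma> \<turnstile> C \<doteq> C' \<Colon> Univ w \<Longrightarrow>
    S \<triangleright> \<Gamma> \<turnstile> d \<doteq> d' \<Colon> sub (Star u \<bullet> Var) C \<Longrightarrow>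
    S \<triangleright> \<Gamma> \<turnstile> p \<doteq> p' \<Colon> One u \<Longrightarrow> S \<triangleright> \<Gamma> \<turnstile> OneRec C d p \<doteq> OneRec C' d' p' \<Colon> sub (p \<bullet> Var) C"
| su_cong: "S \<triangleright> \<Gamma> \<turnstile> n \<doteq> n' \<Colon> Nats u \<Longrightarrow> S \<triangleright> \<Gamma> \<turnstile> Su n \<doteq> Su n' \<Colon> Nats u"
| natRec_cong: "S \<triangleright> Nats u # \<Gamma> \<turnstile> C \<Colon> Univ w \<Longrightarrow>
    S \<triangleright> Nats u # \<Gamma> \<turnstile> C \<doteq> C' \<Colon> Univ w \<Longrightarrow>
    S \<triangleright> \<Gamma> \<turnstile> d \<doteq> d' \<Colon> sub (Ze u \<bullet> Var) C \<Longrightarrow>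
    S \<triangleright> C # Nats u # \<Gamma> \<turnstile> e \<doteq> e' \<Colon> sub (Su (Var 1) \<bullet> shift_by 2) C \<Longrightarrow>
    S \<triangleright> \<Gamma> \<turnstile> n \<doteq> n' \<Colon> Nats u \<Longrightarrow> S \<triangleright> \<Gamma> \<turnstile> NatRec C d e n \<doteq> NatRec C' d' e' n' \<Colon> sub (n \<bullet> Var) C"
| id_cong: "S \<triangleright> \<Gamma> \<turnstile> A \<doteq> A' \<Colon> Univ u \<Longrightarrow> S \<triangleright> \<Gamma> \<turnstile> a \<doteq> a' \<Colon> A \<Longrightarrow> S \<triangleright> \<Gamma> \<turnstile> b \<doteq> b' \<Colon> A \<Longrightarrow>
    S \<triangleright> \<Gamma> \<turnstile> Id A a b \<doteq> Id A' a' b' \<Colon> Univ u"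
| refl_cong: "S \<triangleright> \<Gamma> \<turnstile> a \<doteq> a' \<Colon> A \<Longrightarrow> S \<triangleright> \<Gamma> \<turnstile> Refl a \<doteq> Refl a' \<Colon> Id A a a"
| J_cong: "S \<triangleright> Id (wk (wk A)) (Var 1) (Var 0) # wk A # A # \<Gamma> \<turnstile> C \<Colon> Univ w \<Longrightarrow>
    S \<triangleright> Id (wk (wk A)) (Var 1) (Var 0) # wk A # A # \<Gamma> \<turnstile> C \<doteq> C' \<Colon> Univ w \<Longrightarrow>
    S \<triangleright> A # \<Gamma> \<turnstile> d \<doteq> d' \<Colon> sub (Refl (Var 0) \<bullet> Var 0 \<bullet> Var 0 \<bullet> shift_by 1) C \<Longrightarrow>
    S \<triangleright> \<Gamma> \<turnstile> a \<Colon> A \<Longrightarrow> S \<triangleright> \<Gamma> \<turnstile> b \<Colon> A \<Longrightarrow> S \<triangleright> \<Gamma> \<turnstile> p \<doteq> p' \<Colon> Id A a b \<Longrightarrow>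
    S \<triangleright> \<Gamma> \<turnstile> J C d p \<doteq> J C' d' p' \<Colon> sub (p \<bullet> b \<bullet> a \<bullet> Var) C"


section \<open>Internal notions\<close>

text \<open>
  The following are meta-level abbreviations for types and terms of the object theory.  Arguments
  are terms over the current context and are weakened explicitly when they move under binders.
\<close>

definition Arr :: "('c, 'l) tm \<Rightarrow> ('c, 'l) tm \<Rightarrow> ('c, 'l) tm" where
  "Arr A B = Pi A (wk B)"

definition Times :: "('c, 'l) tm \<Rightarrow> ('c, 'l) tm \<Rightarrow> ('c, 'l) tm" where
  "Times A B = Sg A (wk B)"

text \<open>First projection of an element of a type of the form \<open>Sg A B\<close>.\<close>
definition Fst :: "('c, 'l) tm \<Rightarrow> ('c, 'l) tm \<Rightarrow> ('c, 'l) tm" where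
  "Fst A p = Split (wk A) (Var 1) p"

definition LogEquiv :: "('c, 'l) tm \<Rightarrow> ('c, 'l) tm \<Rightarrow> ('c, 'l) tm" where
  "LogEquiv A B = Times (Arr A B) (Arr B A)"

text \<open>\<open>\<Pi>(x y : A), x = y\<close>\<close>
definition IsProp :: "('c, 'l) tm \<Rightarrow> ('c, 'l) tm" where
  "IsProp A = Pi A (Pi (wk A) (Id (wk (wk A)) (Var 1) (Var 0)))"

text \<open>\<open>\<Pi>(x : A), g (f x) = x\<close>, that is, \<open>g \<circ> f \<sim> id\<close>\<close>
definition LeftInv :: "('c, 'l) tm \<Rightarrow> ('c, 'l) tm \<Rightarrow> ('c, 'l) tm \<Rightarrow> ('c, 'l) tm" where
  "LeftInv A f g = Pi A (Id (wk A) (App (wk g) (App (wk f) (Var 0))) (Var 0))"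

text \<open>\<open>\<Sigma>(s : A \<rightarrow> B), \<Sigma>(r : B \<rightarrow> A), r \<circ> s \<sim> id\<close>\<close>
definition RetractOf :: "('c, 'l) tm \<Rightarrow> ('c, 'l) tm \<Rightarrow> ('c, 'l) tm" where
  "RetractOf A B = Sg (Arr A B) (Sg (wk (Arr B A)) (LeftInv (wk (wk A)) (Var 1) (Var 0)))"

text \<open>
  \<open>f : A \<rightarrow> B\<close> is an equivalence if it has a section and a retraction:
  \<open>(\<Sigma>(s : B \<rightarrow> A), f \<circ> s \<sim> id) \<times> (\<Sigma>(r : B \<rightarrow> A), r \<circ> f \<sim> id)\<close>.
\<close>
definition IsEquiv :: "('c, 'l) tm \<Rightarrow> ('c, 'l) tm \<Rightarrow> ('c, 'l) tm \<Rightarrow> ('c, 'l) tm" where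
  "IsEquiv A B f = Times
     (Sg (Arr B A) (LeftInv (wk B) (Var 0) (wk f)))
     (Sg (Arr B A) (LeftInv (wk A) (wk f) (Var 0)))"

definition Equiv :: "('c, 'l) tm \<Rightarrow> ('c, 'l) tm \<Rightarrow> ('c, 'l) tm" where
  "Equiv A B = Sg (Arr A B) (IsEquiv (wk A) (wk B) (Var 0))"

text \<open>\<open>\<Sigma>(x : A), f x = y\<close>\<close>
definition Fiber :: "('c, 'l) tm \<Rightarrow> ('c, 'l) tm \<Rightarrow> ('c, 'l) tm \<Rightarrow> ('c, 'l) tm \<Rightarrow> ('c, 'l) tm" where
  "Fiber A B f y = Sg A (Id (wk B) (App (wk f) (Var 0)) (wk y))"

definition IsEmbedding :: "('c, 'l) tm \<Rightarrow> ('c, 'l) tm \<Rightarrow> ('c, 'l) tm \<Rightarrow> ('c, 'l) tm" where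
  "IsEmbedding A B f = Pi B (IsProp (Fiber (wk A) (wk B) (wk f) (Var 0)))"

definition Embedding :: "('c, 'l) tm \<Rightarrow> ('c, 'l) tm \<Rightarrow> ('c, 'l) tm" where
  "Embedding A B = Sg (Arr A B) (IsEmbedding (wk A) (wk B) (Var 0))"

text \<open>
  \<open>\<Pi>(X : U) \<Pi>(Y : V) \<Pi>(j : X \<hookrightarrow> Y) \<Pi>(f : X \<rightarrow> D) \<Sigma>(g : Y \<rightarrow> D) \<Pi>(x : X), g (j x) = f x\<close>.
  Under all six binders, \<open>X, Y, j, f, g, x\<close> are the variables 5, 4, 3, 2, 1, 0.
\<close>
definition AInjective :: "'l \<Rightarrow> 'l \<Rightarrow> ('c, 'l) tm \<Rightarrow> ('c, 'l) tm" where
  "AInjective u v D =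
     Pi (Univ u) (Pi (Univ v) (Pi (Embedding (Var 1) (Var 0))
       (Pi (Arr (Var 2) ((wk ^^ 3) D))
         (Sg (Arr (Var 2) ((wk ^^ 4) D))
           (Pi (Var 4)
             (Id ((wk ^^ 6) D)
               (App (Var 1) (App (Fst (Arr (Var 5) (Var 4)) (Var 3)) (Var 0)))
               (App (Var 2) (Var 0))))))))"

text \<open>\<open>\<Sigma>(X : U), D\<close> is a retract of \<open>X \<rightarrow> U\<close>\<close>
definition RetractOfPower :: "'l \<Rightarrow> ('c, 'l) tm \<Rightarrow> ('c, 'l) tm" where
  "RetractOfPower u D = Sg (Univ u) (RetractOf (wk D) (Arr (Var 0) (Univ u)))"


section \<open>Standing assumptions on the object theory\<close>

text \<open>The identity of \<open>A\<close> as an element of \<open>Equiv A A\<close>.\<close>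
definition IdEquiv :: "('c, 'l) tm \<Rightarrow> ('c, 'l) tm" where
  "IdEquiv A =
     (let i = Lam A (Var 0);
          h = Lam A (Refl (Var 0));
          P = LeftInv (wk A) (Var 0) (wk i);
          Q = LeftInv (wk A) (wk i) (Var 0)
      in Pr (IsEquiv (wk A) (wk A) (Var 0)) i (Pr (wk (Sg (Arr A A) Q)) (Pr P i h) (Pr Q i h)))"

text \<open>
  The map \<open>A = B \<rightarrow> A \<simeq> B\<close> for \<open>A B : U\<close>, defined by \<open>J\<close> from the identity equivalence.
\<close>
definition IdToEquiv :: "'l \<Rightarrow> ('c, 'l) tm \<Rightarrow> ('c, 'l) tm \<Rightarrow> ('c, 'l) tm" where
  "IdToEquiv u A B =
     Lam (Id (Univ u) A B) (J (Equiv (Var 2) (Var 1)) (IdEquiv (Var 0)) (Var 0))"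

definition UnivalenceTy :: "'l \<Rightarrow> ('c, 'l) tm" where
  "UnivalenceTy u = Pi (Univ u) (Pi (Univ u)
     (IsEquiv (Id (Univ u) (Var 1) (Var 0)) (Equiv (Var 1) (Var 0))
       (IdToEquiv u (Var 1) (Var 0))))"

definition ResizingTy :: "'l \<Rightarrow> 'l \<Rightarrow> ('c, 'l) tm" where
  "ResizingTy u v = Pi (Univ u) (Arr (IsProp (Var 0)) (Sg (Univ v) (Equiv (Var 0) (Var 1))))"

text \<open>
  These are schematic in the universes, hence expressed by derivability in the theory given by
  the signature; they hold, for instance, if constants of the respective types are declared.
\<close>

definition univalence :: "('c, 'l::ulevel) sig \<Rightarrow> bool" where
  "univalence S \<longleftrightarrow> (\<forall>u. \<exists>t. S \<triangleright> [] \<turnstile> t \<Colon> UnivalenceTy u)"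

definition prop_resizing :: "('c, 'l::ulevel) sig \<Rightarrow> bool" where
  "prop_resizing S \<longleftrightarrow> (\<forall>u v. \<exists>t. S \<triangleright> [] \<turnstile> t \<Colon> ResizingTy u v)"

text \<open>
  A truncation operator on every universe, valued in propositions of the same universe, with unit
  and with recursion into the propositions of every universe.
\<close>
definition prop_truncations :: "('c, 'l::ulevel) sig \<Rightarrow> bool" where
  "prop_truncations S \<longleftrightarrow> (\<forall>u. \<exists>T i e.
     S \<triangleright> [] \<turnstile> T \<Colon> Arr (Univ u) (Univ u) \<and>
     S \<triangleright> [] \<turnstile> i \<Colon> Pi (Univ u) (IsProp (App (wk T) (Var 0))) \<and>
     S \<triangleright> [] \<turnstile> e \<Colon> Pi (Univ u) (Arr (Var 0) (App (wk T) (Var 0))) \<and>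
     (\<forall>v. \<exists>r. S \<triangleright> [] \<turnstile> r \<Colon> Pi (Univ u) (Pi (Univ v) (Arr (IsProp (Var 0))
        (Arr (Arr (Var 1) (Var 0)) (Arr (App (wk (wk T)) (Var 1)) (Var 0)))))))"

end

theory Submission
  imports Defs
begin

text \<open>
  From right to left, let \<open>D\<close> be a retract of \<open>E \<rightarrow> U\<close> with section \<open>s\<close> and retraction \<open>r\<close>.  A map
  \<open>f : X \<rightarrow> D\<close> extends along an embedding \<open>j : X \<rightarrow> Y\<close> to
  \<open>g y = r (\<lambda>a. \<Sigma>(w : fiber j y), s (f (fst w)) a)\<close>.  The fiber over \<open>j x\<close> is an inhabited
  proposition, so by univalence and function extensionality \<open>g (j x) = r (s (f x)) = f x\<close>.

  From left to right, \<open>D\<close> is a retract of \<open>D \<rightarrow> U\<close>, with section \<open>s x = (\<lambda>y. x = y)\<close>.  For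
  \<open>A : D \<rightarrow> U\<close>, contractibility of \<open>\<Sigma>(y : D), A y\<close> is a proposition in \<open>U\<close>, and the first component of
  the center is a map from it to \<open>D\<close>; extending this map along the embedding into the unit type gives
  the retraction.  It is a left inverse of \<open>s\<close> since \<open>\<Sigma>(y : D), x = y\<close> is contractible with a
  center over \<open>x\<close>.  Working with contractibility instead of the fibers of \<open>s\<close> keeps everything
  inside \<open>U\<close>, without resizing.

  Only non-dependent function extensionality is needed.  It comes from univalence at the level of
  the codomain \<open>B\<close>: the constant paths form an equivalence from \<open>B\<close> to the type of paths in \<open>B\<close>,
  so the source and the target map, which agree after composition with it, are equal.
\<close>

section \<open>Substitution calculus\<close>

text \<open>The sum over the fiber is the formula for a left Kan extension: \<open>s (f x)\<close>
  is a family of types, and the value at \<open>y\<close> glues the families belonging to all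
  preimages of \<open>y\<close>, of which an embedding admits at most one up to identity. The
  section of \<open>D\<close> into \<open>D \<rightarrow> U\<close> is the Yoneda map, and
  contractibility of the total space is what singles out the families that are representable, that
  is, of the form \<open>x = y\<close> in \<open>y\<close>. The type theory is present as raw
  syntax, so instantiating a typed term is a theorem about derivations and has to be established
  before anything else. Sums and the unit type have no uniqueness rule: an element of a sum is a
  pair only up to identity, and statements about all elements go through \<open>Split\<close> on a
  generic pair. Computation on explicit pairs and functions is judgmental, however, and the
  constructions are arranged so that the endpoints of the required paths agree by
  computation.\<close>

definition shift :: "nat \<Rightarrow> nat \<Rightarrow> ('c, 'l) tm" where
  "shift n = (\<lambda>i. Var (i + n))"

definition sub_comp :: "(nat \<Rightarrow> ('c, 'l) tm) \<Rightarrow> (nat \<Rightarrow> ('c, 'l) tm) \<Rightarrow> nat \<Rightarrow> ('c, 'l) tm"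
    (infixr "\<odot>" 65) where
  "(s \<odot> t) = (\<lambda>i. sub s (t i))"

lemma shift_apply [simp]: "shift n i = Var (i + n)"
  by (simp add: shift_def)

lemma sub_comp_apply [simp]: "(s \<odot> t) i = sub s (t i)"
  by (simp add: sub_comp_def)

lemma lift_ren_comp: "(\<lambda>i. lift_ren r (lift_ren q i)) = lift_ren (\<lambda>i. r (q i))"
proof
  show "lift_ren r (lift_ren q i) = lift_ren (\<lambda>i. r (q i)) i" for i
    by (cases i) simp_all
qed

lemma ren_ren: "ren r (ren q t) = ren (\<lambda>i. r (q i)) t"
  by (induction t arbitrary: r q) (simp_all add: lift_ren_comp)

lemma lift_sub_Var_ren: "lift_sub (\<lambda>i. Var (r i)) = (\<lambda>i. Var (lift_ren r i))"
proof
  show "lift_sub (\<lambda>i. Var (r i)) i = Var (lift_ren r i)" for i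
    by (cases i) (simp_all add: lift_sub_def wk_def)
qed

lemma ren_eq_sub: "ren r t = sub (\<lambda>i. Var (r i)) t"
  by (induction t arbitrary: r) (simp_all add: lift_sub_Var_ren)

lemma lift_sub_lift_ren: "(\<lambda>i. lift_sub s (lift_ren r i)) = lift_sub (\<lambda>i. s (r i))"
proof
  show "lift_sub s (lift_ren r i) = lift_sub (\<lambda>i. s (r i)) i" for i
    by (cases i) (simp_all add: lift_sub_def)
qed

lemma sub_ren: "sub s (ren r t) = sub (\<lambda>i. s (r i)) t"
  by (induction t arbitrary: r s) (simp_all add: lift_sub_lift_ren)

lemma lift_ren_lift_sub: "(\<lambda>i. ren (lift_ren r) (lift_sub s i)) = lift_sub (\<lambda>i. ren r (s i))"
proof
  show "ren (lift_ren r) (lift_sub s i) = lift_sub (\<lambda>i. ren r (s i)) i" for i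
    by (cases i) (simp_all add: lift_sub_def wk_def ren_ren)
qed

lemma ren_sub: "ren r (sub s t) = sub (\<lambda>i. ren r (s i)) t"
  by (induction t arbitrary: r s) (simp_all add: lift_ren_lift_sub)

lemma lift_sub_comp: "lift_sub s \<odot> lift_sub t = lift_sub (s \<odot> t)"
proof
  show "(lift_sub s \<odot> lift_sub t) i = lift_sub (s \<odot> t) i" for i
    by (cases i) (simp_all add: lift_sub_def wk_def sub_ren ren_sub)
qed

text \<open>The binder case is \<open>lift_sub_comp\<close>. As \<open>lift_sub\<close> weakens by a
  renaming, it rests on both mixed laws, \<open>sub_ren\<close> and \<open>ren_sub\<close>, which
  therefore come first.\<close>

lemma sub_sub [simp]: "sub s (sub t a) = sub (s \<odot> t) a"
  by (induction a arbitrary: s t) (simp_all add: lift_sub_comp)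

lemma lift_sub_Var: "lift_sub Var = Var"
proof
  show "lift_sub Var i = Var i" for i
    by (cases i) (simp_all add: lift_sub_def wk_def)
qed

lemma sub_Var [simp]: "sub Var t = t"
  by (induction t) (simp_all add: lift_sub_Var)

lemma shift_0 [simp]: "shift 0 = Var"
  by (simp add: fun_eq_iff)

text \<open>Weakening becomes a substitution as well, so that every operation on terms is a single
  \<open>sub\<close> whose argument has a normal form built from \<open>\<bullet>\<close>,
  \<open>\<odot>\<close> and \<open>shift\<close>. Equations between types are then settled by
  rewriting.\<close>

lemma wk_eq [simp]: "wk t = sub (shift (Suc 0)) t"
  by (simp add: wk_def ren_eq_sub shift_def)

lemma sub_comp_Var [simp]: "s \<odot> Var = s" "Var \<odot> s = s"
  by (simp_all add: fun_eq_iff)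

lemma sub_comp_assoc [simp]: "(s \<odot> t) \<odot> r = s \<odot> t \<odot> r"
  by (simp add: fun_eq_iff)

lemma sub_comp_scons [simp]: "s \<odot> (a \<bullet> t) = sub s a \<bullet> (s \<odot> t)"
proof
  show "(s \<odot> (a \<bullet> t)) i = (sub s a \<bullet> (s \<odot> t)) i" for i
    by (cases i) simp_all
qed

lemma scons_comp_shift [simp]: "(a \<bullet> s) \<odot> shift (Suc n) = s \<odot> shift n"
  by (simp add: fun_eq_iff)

text \<open>Composition associates to the right, which hides the redex of
  \<open>scons_comp_shift\<close> when another factor follows.\<close>

lemma scons_comp_shift' [simp]: "(a \<bullet> s) \<odot> shift (Suc n) \<odot> t = s \<odot> shift n \<odot> t"
  by (simp flip: sub_comp_assoc)

lemma shift_comp_shift [simp]: "shift m \<odot> shift n = shift (m + n)"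
  by (simp add: fun_eq_iff ac_simps)

lemma shift_comp_shift' [simp]: "shift m \<odot> shift n \<odot> t = shift (m + n) \<odot> t"
  by (simp flip: sub_comp_assoc)

text \<open>A substitution is determined by its head and its tail; for \<open>n = 0\<close> this
  collapses the lifted identity to \<open>Var\<close>.\<close>

lemma scons_Var_shift [simp]: "Var n \<bullet> shift (Suc n) = shift n"
proof
  show "(Var n \<bullet> shift (Suc n)) i = shift n i" for i
    by (cases i) simp_all
qed

lemma lift_sub_eq [simp]: "lift_sub s = Var 0 \<bullet> (shift (Suc 0) \<odot> s)"
  by (simp add: lift_sub_def sub_comp_def)

text \<open>Indices are kept in \<open>Suc\<close> form, on which the rules for \<open>\<bullet>\<close> and \<open>shift\<close> match.\<close>
lemmas nat_index [simp] = numeral_eq_Suc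

text \<open>The inference rules mention \<open>shift_by\<close>, an abbreviation for a lambda term;
  rewriting needs the constant \<open>shift\<close> in its place. The equations
  \<open>shift_by_eq\<close> do the same for small distances whose numeral has already been
  simplified.\<close>

lemmas fold_shift = shift_def[symmetric]

lemma shift_by_eq [simp]:
  "(\<lambda>i. Var (Suc i)) = shift (Suc 0)"
  "(\<lambda>i. Var (Suc (Suc i))) = shift (Suc (Suc 0))"
  "(\<lambda>i. Var (Suc (Suc (Suc i)))) = shift (Suc (Suc (Suc 0)))"
  by (simp_all add: fun_eq_iff)

text \<open>These keep the internal notions folded while substitutions are computed; otherwise every
  instantiation would expose their de Bruijn encodings.\<close>

lemma sub_defs [simp]:
  "sub s (Arr A B) = Arr (sub s A) (sub s B)"
  "sub s (Times A B) = Times (sub s A) (sub s B)"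
  "sub s (Fst A p) = Fst (sub s A) (sub s p)"
  "sub s (LogEquiv A B) = LogEquiv (sub s A) (sub s B)"
  "sub s (IsProp A) = IsProp (sub s A)"
  "sub s (LeftInv A f g) = LeftInv (sub s A) (sub s f) (sub s g)"
  "sub s (RetractOf A B) = RetractOf (sub s A) (sub s B)"
  "sub s (IsEquiv A B f) = IsEquiv (sub s A) (sub s B) (sub s f)"
  "sub s (Equiv A B) = Equiv (sub s A) (sub s B)"
  "sub s (Fiber A B f y) = Fiber (sub s A) (sub s B) (sub s f) (sub s y)"
  "sub s (IsEmbedding A B f) = IsEmbedding (sub s A) (sub s B) (sub s f)"
  "sub s (Embedding A B) = Embedding (sub s A) (sub s B)"
  "sub s (RetractOfPower u D) = RetractOfPower u (sub s D)"
  "sub s (AInjective u v D) = AInjective u v (sub s D)"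
  "sub s (IdEquiv A) = IdEquiv (sub s A)"
  "sub s (IdToEquiv u A B) = IdToEquiv u (sub s A) (sub s B)"
  by (simp_all add: Arr_def Times_def Fst_def LogEquiv_def IsProp_def LeftInv_def RetractOf_def
      IsEquiv_def Equiv_def Fiber_def IsEmbedding_def Embedding_def RetractOfPower_def
      AInjective_def IdEquiv_def IdToEquiv_def Let_def)

section \<open>Admissibility of substitution\<close>

definition agree :: "nat \<Rightarrow> (nat \<Rightarrow> ('c, 'l) tm) \<Rightarrow> (nat \<Rightarrow> ('c, 'l) tm) \<Rightarrow> bool" where
  "agree n s t \<longleftrightarrow> (\<forall>i < n. s i = t i)"

lemma agree_lift_sub: "agree n s t \<Longrightarrow> agree (Suc n) (lift_sub s) (lift_sub t)"
  by (auto simp: agree_def lift_sub_def less_Suc_eq_0_disj)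

text \<open>Raw terms carry no scope, so the bound on their free variables is read off from the
  derivation: a term typed in \<open>\<Gamma>\<close> only sees the values at indices below
  \<open>length \<Gamma>\<close>.\<close>

lemma sub_agree:
  "S \<triangleright> \<Gamma> ctx \<Longrightarrow> True"
  "S \<triangleright> \<Gamma> \<turnstile> a \<Colon> A \<Longrightarrow> \<forall>s t. agree (length \<Gamma>) s t \<longrightarrow> sub s a = sub t a"
  "S \<triangleright> \<Gamma> \<turnstile> a \<doteq> b \<Colon> A \<Longrightarrow> True"
proof (induction rule: wf_ctx_has_type_eq_tm.inducts)
  case (var \<Gamma> i)
  then show ?case by (simp add: agree_def)
qed (simp_all del: lift_sub_eq wk_eq add: agree_lift_sub)

text \<open>The rule \<open>const\<close> leaves the declared type as it is in every context; this
  is compatible with substitution because that type is closed.\<close>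

lemma sub_closed:
  assumes "S \<triangleright> [] \<turnstile> a \<Colon> A"
  shows "sub s a = a"
  using sub_agree(2)[OF assms] by (metis agree_def length_0_conv not_less_zero sub_Var)

text \<open>The types in the conclusions of the rules have the shape
  \<open>sub (a \<bullet> Var) B\<close> and match a substituted goal only up to the laws of
  substitution. The cast turns the mismatch into an equation for the simplifier.\<close>

lemma has_type_cast: "S \<triangleright> \<Gamma> \<turnstile> a \<Colon> A \<Longrightarrow> A = B \<Longrightarrow> S \<triangleright> \<Gamma> \<turnstile> a \<Colon> B"
  by simp

lemma eq_tm_cast:
  "S \<triangleright> \<Gamma> \<turnstile> a \<doteq> b \<Colon> A \<Longrightarrow> A = B \<Longrightarrow> S \<triangleright> \<Gamma> \<turnstile> a \<doteq> b \<Colon> B"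
  by simp

lemma eq_tm_cast_beta:
  "S \<triangleright> \<Gamma> \<turnstile> a \<doteq> b \<Colon> A \<Longrightarrow> b = b' \<Longrightarrow> A = B \<Longrightarrow> S \<triangleright> \<Gamma> \<turnstile> a \<doteq> b' \<Colon> B"
  by simp

lemma has_type_ctx:
  "S \<triangleright> \<Gamma> ctx \<Longrightarrow> case \<Gamma> of [] \<Rightarrow> True | A # \<Gamma> \<Rightarrow> S \<triangleright> \<Gamma> ctx \<and> (\<exists>u. S \<triangleright> \<Gamma> \<turnstile> A \<Colon> Univ u)"
  "S \<triangleright> \<Gamma> \<turnstile> a \<Colon> A \<Longrightarrow> S \<triangleright> \<Gamma> ctx"
  "S \<triangleright> \<Gamma> \<turnstile> a \<doteq> b \<Colon> A \<Longrightarrow> S \<triangleright> \<Gamma> ctx"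
  by (induction rule: wf_ctx_has_type_eq_tm.inducts) auto

type_synonym ('c, 'l) sub_class =
  "('c, 'l) tm list \<Rightarrow> ('c, 'l) tm list \<Rightarrow> (nat \<Rightarrow> ('c, 'l) tm) \<Rightarrow> bool"

text \<open>
  One induction serves for renamings and for substitutions: it applies to every class \<open>K\<close> of
  substitutions that is closed under lifting and sends variables to terms of the right types.
  Typing rules such as the one for pairs do not have the typing of the domain \<open>A\<close> as a premise,
  but it is needed for lifting; hence the predicate \<open>good\<close> carries the induction hypotheses for
  the entries of the context along.
\<close>
locale substitution_class =
  fixes S :: "('c, 'l::ulevel) sig" and K :: "('c, 'l) sub_class"
  assumes var_K: "\<And>\<Gamma> \<Delta> s i. K \<Gamma> \<Delta> s \<Longrightarrow> S \<triangleright> \<Delta> ctx \<Longrightarrow> i < length \<Gamma> \<Longrightarrow>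
      S \<triangleright> \<Delta> \<turnstile> s i \<Colon> sub s (sub (shift (Suc i)) (\<Gamma> ! i))"
    and lift_K: "\<And>\<Gamma> \<Delta> s A. K \<Gamma> \<Delta> s \<Longrightarrow> S \<triangleright> sub s A # \<Delta> ctx \<Longrightarrow> K (A # \<Gamma>) (sub s A # \<Delta>) (lift_sub s)"
begin

definition ok :: "('c, 'l) sub_class" where
  "ok \<Gamma> \<Delta> s \<longleftrightarrow> K \<Gamma> \<Delta> s \<and> S \<triangleright> \<Delta> ctx"

primrec good :: "('c, 'l) tm list \<Rightarrow> bool" where
  "good [] \<longleftrightarrow> True"
| "good (A # \<Gamma>) \<longleftrightarrow> good \<Gamma> \<and> (\<exists>u. \<forall>\<Delta> s. ok \<Gamma> \<Delta> s \<longrightarrow> S \<triangleright> \<Delta> \<turnstile> sub s A \<Colon> Univ u)"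

definition ty_pred :: "('c, 'l) tm list \<Rightarrow> ('c, 'l) tm \<Rightarrow> ('c, 'l) tm \<Rightarrow> bool" where
  "ty_pred \<Gamma> a A \<longleftrightarrow> good \<Gamma> \<and> (\<forall>\<Delta> s. ok \<Gamma> \<Delta> s \<longrightarrow> S \<triangleright> \<Delta> \<turnstile> sub s a \<Colon> sub s A)"

definition eq_pred :: "('c, 'l) tm list \<Rightarrow> ('c, 'l) tm \<Rightarrow> ('c, 'l) tm \<Rightarrow> ('c, 'l) tm \<Rightarrow> bool" where
  "eq_pred \<Gamma> a b A \<longleftrightarrow> good \<Gamma> \<and> (\<forall>\<Delta> s. ok \<Gamma> \<Delta> s \<longrightarrow> S \<triangleright> \<Delta> \<turnstile> sub s a \<doteq> sub s b \<Colon> sub s A)"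

text \<open>\<open>good\<close> provides the typing of \<open>sub s A\<close>, without which the
  extended target context would not be known to be well formed.\<close>

lemma ok_lift: "ok \<Gamma> \<Delta> s \<Longrightarrow> good (A # \<Gamma>) \<Longrightarrow> ok (A # \<Gamma>) (sub s A # \<Delta>) (lift_sub s)"
  unfolding ok_def by (auto simp del: lift_sub_eq simp: ok_def intro!: lift_K intro: ctx_cons)

lemma ty_predI:
  "good \<Gamma> \<Longrightarrow> (\<And>\<Delta> s. ok \<Gamma> \<Delta> s \<Longrightarrow> S \<triangleright> \<Delta> \<turnstile> sub s a \<Colon> sub s A) \<Longrightarrow> ty_pred \<Gamma> a A"
  by (simp add: ty_pred_def)

lemma eq_predI:
  "good \<Gamma> \<Longrightarrow> (\<And>\<Delta> s. ok \<Gamma> \<Delta> s \<Longrightarrow> S \<triangleright> \<Delta> \<turnstile> sub s a \<doteq> sub s b \<Colon> sub s A) \<Longrightarrow> eq_pred \<Gamma> a b A"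
  by (simp add: eq_pred_def)

lemma ty_pred_good: "ty_pred \<Gamma> a A \<Longrightarrow> good \<Gamma>"
  by (simp add: ty_pred_def)

lemma eq_pred_good: "eq_pred \<Gamma> a b A \<Longrightarrow> good \<Gamma>"
  by (simp add: eq_pred_def)

lemma tyD0: "ty_pred \<Gamma> a A \<Longrightarrow> ok \<Gamma> \<Delta> s \<Longrightarrow> S \<triangleright> \<Delta> \<turnstile> sub s a \<Colon> sub s A"
  by (simp add: ty_pred_def)

lemma tyD1:
  "ty_pred (B # \<Gamma>) a A \<Longrightarrow> ok \<Gamma> \<Delta> s \<Longrightarrow> S \<triangleright> sub s B # \<Delta> \<turnstile> sub (lift_sub s) a \<Colon> sub (lift_sub s) A"
  using ok_lift by (blast intro: tyD0 ty_pred_good)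

lemma tyD2:
  "ty_pred (C # B # \<Gamma>) a A \<Longrightarrow> ok \<Gamma> \<Delta> s \<Longrightarrow> S \<triangleright> sub (lift_sub s) C # sub s B # \<Delta> \<turnstile>
    sub (lift_sub (lift_sub s)) a \<Colon> sub (lift_sub (lift_sub s)) A"
  using ty_pred_good[of "C # B # \<Gamma>" a A] by (blast intro: tyD1 ok_lift good.simps(2)[THEN iffD1, THEN conjunct1])

text \<open>Depth three is reached by the motive of \<open>J\<close>, and no rule goes
  deeper.\<close>

lemma tyD3:
  "ty_pred (D # C # B # \<Gamma>) a A \<Longrightarrow> ok \<Gamma> \<Delta> s \<Longrightarrow>
    S \<triangleright> sub (lift_sub (lift_sub s)) D # sub (lift_sub s) C # sub s B # \<Delta> \<turnstile>
    sub (lift_sub (lift_sub (lift_sub s))) a \<Colon> sub (lift_sub (lift_sub (lift_sub s))) A"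
  using ty_pred_good[of "D # C # B # \<Gamma>" a A] by (blast intro: tyD2 ok_lift good.simps(2)[THEN iffD1, THEN conjunct1])

lemma eqD0: "eq_pred \<Gamma> a b A \<Longrightarrow> ok \<Gamma> \<Delta> s \<Longrightarrow> S \<triangleright> \<Delta> \<turnstile> sub s a \<doteq> sub s b \<Colon> sub s A"
  by (simp add: eq_pred_def)

lemma eqD1:
  "eq_pred (B # \<Gamma>) a b A \<Longrightarrow> ok \<Gamma> \<Delta> s \<Longrightarrow>
    S \<triangleright> sub s B # \<Delta> \<turnstile> sub (lift_sub s) a \<doteq> sub (lift_sub s) b \<Colon> sub (lift_sub s) A"
  using ok_lift by (blast intro: eqD0 eq_pred_good)

lemma eqD2:
  "eq_pred (C # B # \<Gamma>) a b A \<Longrightarrow> ok \<Gamma> \<Delta> s \<Longrightarrow> S \<triangleright> sub (lift_sub s) C # sub s B # \<Delta> \<turnstile>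
    sub (lift_sub (lift_sub s)) a \<doteq> sub (lift_sub (lift_sub s)) b \<Colon> sub (lift_sub (lift_sub s)) A"
  using eq_pred_good[of "C # B # \<Gamma>" a b A] by (blast intro: eqD1 ok_lift good.simps(2)[THEN iffD1, THEN conjunct1])

lemma eqD3:
  "eq_pred (D # C # B # \<Gamma>) a b A \<Longrightarrow> ok \<Gamma> \<Delta> s \<Longrightarrow>
    S \<triangleright> sub (lift_sub (lift_sub s)) D # sub (lift_sub s) C # sub s B # \<Delta> \<turnstile>
    sub (lift_sub (lift_sub (lift_sub s))) a \<doteq> sub (lift_sub (lift_sub (lift_sub s))) b
    \<Colon> sub (lift_sub (lift_sub (lift_sub s))) A"
  using eq_pred_good[of "D # C # B # \<Gamma>" a b A] by (blast intro: eqD2 ok_lift good.simps(2)[THEN iffD1, THEN conjunct1])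

text \<open>Each rule is applied again to its substituted premises, with the substitution lifted
  once for every variable that a premise binds. \<open>good \<Gamma>\<close> is taken from the
  hypothesis for a premise over \<open>\<Gamma>\<close> itself.\<close>

lemma substitution:
  "S \<triangleright> \<Gamma> ctx \<Longrightarrow> good \<Gamma>"
  "S \<triangleright> \<Gamma> \<turnstile> a \<Colon> A \<Longrightarrow> ty_pred \<Gamma> a A"
  "S \<triangleright> \<Gamma> \<turnstile> a \<doteq> b \<Colon> A \<Longrightarrow> eq_pred \<Gamma> a b A"
proof (induction rule: wf_ctx_has_type_eq_tm.inducts)
  case ctx_nil
  then show ?case by simp
next
  case (ctx_cons \<Gamma> A u)
  then show ?case by (auto simp: ty_pred_def)
next
  case (var \<Gamma> i)
  show ?case
    unfolding sub.simps fold_shift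
    by (rule ty_predI[OF var(2)]) (use var_K var(3) in \<open>simp only: ok_def sub.simps\<close>)
next
  case (const \<Gamma> c A u)
  show ?case
    using const by (auto simp: ok_def sub_closed[OF const(4)] intro!: ty_predI wf_ctx_has_type_eq_tm.const)
next
  case (univ \<Gamma> u)
  then show ?case by (auto simp: ok_def intro!: ty_predI wf_ctx_has_type_eq_tm.univ)
next
  case (emp_form \<Gamma> u)
  then show ?case by (auto simp: ok_def intro!: ty_predI wf_ctx_has_type_eq_tm.emp_form)
next
  case (one_form \<Gamma> u)
  then show ?case by (auto simp: ok_def intro!: ty_predI wf_ctx_has_type_eq_tm.one_form)
next
  case (one_intro \<Gamma> u)
  then show ?case by (auto simp: ok_def intro!: ty_predI wf_ctx_has_type_eq_tm.one_intro)
next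
  case (nat_form \<Gamma> u)
  then show ?case by (auto simp: ok_def intro!: ty_predI wf_ctx_has_type_eq_tm.nat_form)
next
  case (nat_intro0 \<Gamma> u)
  then show ?case by (auto simp: ok_def intro!: ty_predI wf_ctx_has_type_eq_tm.nat_intro0)
next
  case h: (pi_form \<Gamma> A u B v)
  show ?case
  proof (rule ty_predI[OF h(2)[THEN ty_pred_good]], goal_cases)
    case (1 \<Delta> s)
    show ?case
      unfolding sub.simps
      by (rule has_type_cast[OF pi_form[where u = u and v = v]])
        (use h(2)[THEN tyD0, OF 1] h(4)[THEN tyD1, OF 1] in simp_all)
  qed
next
  case h: (pi_intro \<Gamma> A u b B)
  show ?case
  proof (rule ty_predI[OF h(2)[THEN ty_pred_good]], goal_cases)
    case (1 \<Delta> s)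
    show ?case
      unfolding sub.simps
      by (rule has_type_cast[OF pi_intro[where u = u and B = "sub (lift_sub s) B"]])
        (use h(2)[THEN tyD0, OF 1] h(4)[THEN tyD1, OF 1] in simp_all)
  qed
next
  case h: (pi_elim \<Gamma> f A B a)
  show ?case
  proof (rule ty_predI[OF h(2)[THEN ty_pred_good]], goal_cases)
    case (1 \<Delta> s)
    show ?case
      unfolding sub.simps
      by (rule has_type_cast[OF pi_elim[where A = "sub s A" and B = "sub (lift_sub s) B"]])
        (use h(2)[THEN tyD0, OF 1] h(4)[THEN tyD0, OF 1] in simp_all)
  qed
next
  case h: (sg_form \<Gamma> A u B v)
  show ?case
  proof (rule ty_predI[OF h(2)[THEN ty_pred_good]], goal_cases)
    case (1 \<Delta> s)
    show ?case
      unfolding sub.simps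
      by (rule has_type_cast[OF sg_form[where u = u and v = v]])
        (use h(2)[THEN tyD0, OF 1] h(4)[THEN tyD1, OF 1] in simp_all)
  qed
next
  case h: (sg_intro A \<Gamma> B v a b)
  show ?case
  proof (rule ty_predI[OF h(4)[THEN ty_pred_good]], goal_cases)
    case (1 \<Delta> s)
    show ?case
      unfolding sub.simps
      by (rule has_type_cast[OF sg_intro[where A = "sub s A" and v = v]])
        (use h(2)[THEN tyD1, OF 1] h(4)[THEN tyD0, OF 1] h(6)[THEN tyD0, OF 1] in simp_all)
  qed
next
  case h: (sg_elim A B \<Gamma> C w d p)
  show ?case
  proof (rule ty_predI[OF h(6)[THEN ty_pred_good]], goal_cases)
    case (1 \<Delta> s)
    show ?case
      unfolding sub.simps
      by (rule has_type_cast[OF sg_elim[where A = "sub s A" and B = "sub (lift_sub s) B" and w = w]])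
        (use h(2)[THEN tyD1, OF 1] h(4)[THEN tyD2, OF 1] h(6)[THEN tyD0, OF 1] in simp_all)
  qed
next
  case h: (plus_form \<Gamma> A u B v)
  show ?case
  proof (rule ty_predI[OF h(2)[THEN ty_pred_good]], goal_cases)
    case (1 \<Delta> s)
    show ?case
      unfolding sub.simps
      by (rule has_type_cast[OF plus_form[where u = u and v = v]])
        (use h(2)[THEN tyD0, OF 1] h(4)[THEN tyD0, OF 1] in simp_all)
  qed
next
  case h: (plus_introL \<Gamma> a A B u)
  show ?case
  proof (rule ty_predI[OF h(2)[THEN ty_pred_good]], goal_cases)
    case (1 \<Delta> s)
    show ?case
      unfolding sub.simps
      by (rule has_type_cast[OF plus_introL[where A = "sub s A" and u = u]])
        (use h(2)[THEN tyD0, OF 1] h(4)[THEN tyD0, OF 1] in simp_all)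
  qed
next
  case h: (plus_introR \<Gamma> b B A u)
  show ?case
  proof (rule ty_predI[OF h(2)[THEN ty_pred_good]], goal_cases)
    case (1 \<Delta> s)
    show ?case
      unfolding sub.simps
      by (rule has_type_cast[OF plus_introR[where B = "sub s B" and u = u]])
        (use h(2)[THEN tyD0, OF 1] h(4)[THEN tyD0, OF 1] in simp_all)
  qed
next
  case h: (plus_elim A B \<Gamma> C w d e p)
  show ?case
  proof (rule ty_predI[OF h(8)[THEN ty_pred_good]], goal_cases)
    case (1 \<Delta> s)
    show ?case
      unfolding sub.simps
      by (rule has_type_cast[OF plus_elim[where A = "sub s A" and B = "sub s B" and w = w]])
        (use h(2)[THEN tyD1, OF 1] h(4)[THEN tyD1, OF 1] h(6)[THEN tyD1, OF 1] h(8)[THEN tyD0, OF 1] in simp_all)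
  qed
next
  case h: (emp_elim u \<Gamma> C w p)
  show ?case
  proof (rule ty_predI[OF h(4)[THEN ty_pred_good]], goal_cases)
    case (1 \<Delta> s)
    show ?case
      unfolding sub.simps
      by (rule has_type_cast[OF emp_elim[where u = u and w = w]])
        (use h(2)[THEN tyD1, OF 1] h(4)[THEN tyD0, OF 1] in simp_all)
  qed
next
  case h: (one_elim u \<Gamma> C w d p)
  show ?case
  proof (rule ty_predI[OF h(4)[THEN ty_pred_good]], goal_cases)
    case (1 \<Delta> s)
    show ?case
      unfolding sub.simps
      by (rule has_type_cast[OF one_elim[where u = u and w = w]])
        (use h(2)[THEN tyD1, OF 1] h(4)[THEN tyD0, OF 1] h(6)[THEN tyD0, OF 1] in simp_all)
  qed
next
  case h: (nat_introS \<Gamma> n u)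
  show ?case
  proof (rule ty_predI[OF h(2)[THEN ty_pred_good]], goal_cases)
    case (1 \<Delta> s)
    show ?case
      unfolding sub.simps
      by (rule has_type_cast[OF nat_introS[where u = u]])
        (use h(2)[THEN tyD0, OF 1] in simp_all)
  qed
next
  case h: (nat_elim u \<Gamma> C w d e n)
  show ?case
  proof (rule ty_predI[OF h(4)[THEN ty_pred_good]], goal_cases)
    case (1 \<Delta> s)
    show ?case
      unfolding sub.simps
      by (rule has_type_cast[OF nat_elim[where u = u and w = w]])
        (use h(2)[THEN tyD1, OF 1] h(4)[THEN tyD0, OF 1] h(6)[THEN tyD2, OF 1] h(8)[THEN tyD0, OF 1] in simp_all)
  qed
next
  case h: (id_form \<Gamma> A u a b)
  show ?case
  proof (rule ty_predI[OF h(2)[THEN ty_pred_good]], goal_cases)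
    case (1 \<Delta> s)
    show ?case
      unfolding sub.simps
      by (rule has_type_cast[OF id_form[where u = u]])
        (use h(2)[THEN tyD0, OF 1] h(4)[THEN tyD0, OF 1] h(6)[THEN tyD0, OF 1] in simp_all)
  qed
next
  case h: (id_intro \<Gamma> a A)
  show ?case
  proof (rule ty_predI[OF h(2)[THEN ty_pred_good]], goal_cases)
    case (1 \<Delta> s)
    show ?case
      unfolding sub.simps
      by (rule has_type_cast[OF id_intro[where A = "sub s A"]])
        (use h(2)[THEN tyD0, OF 1] in simp_all)
  qed
next
  case h: (id_elim A \<Gamma> C w d a b p)
  show ?case
  proof (rule ty_predI[OF h(6)[THEN ty_pred_good]], goal_cases)
    case (1 \<Delta> s)
    show ?case
      unfolding sub.simps
      by (rule has_type_cast[OF id_elim[where A = "sub s A" and w = w and a = "sub s a" and b = "sub s b"]])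
        (use h(2)[THEN tyD3, OF 1] h(4)[THEN tyD1, OF 1] h(6)[THEN tyD0, OF 1] h(8)[THEN tyD0, OF 1] h(10)[THEN tyD0, OF 1] in simp_all)
  qed
next
  case h: (conv \<Gamma> a A B u)
  show ?case
  proof (rule ty_predI[OF h(2)[THEN ty_pred_good]], goal_cases)
    case (1 \<Delta> s)
    show ?case
      unfolding sub.simps
      by (rule has_type_cast[OF conv[where A = "sub s A" and B = "sub s B" and u = u]])
        (use h(2)[THEN tyD0, OF 1] h(4)[THEN eqD0, OF 1] in simp_all)
  qed
next
  case h: (eq_refl \<Gamma> a A)
  show ?case
  proof (rule eq_predI[OF h(2)[THEN ty_pred_good]], goal_cases)
    case (1 \<Delta> s)
    show ?case
      unfolding sub.simps
      by (rule eq_tm_cast[OF eq_refl[where A = "sub s A"]])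
        (use h(2)[THEN tyD0, OF 1] in simp_all)
  qed
next
  case h: (eq_sym \<Gamma> a b A)
  show ?case
  proof (rule eq_predI[OF h(2)[THEN eq_pred_good]], goal_cases)
    case (1 \<Delta> s)
    show ?case
      unfolding sub.simps
      by (rule eq_tm_cast[OF eq_sym[where A = "sub s A"]])
        (use h(2)[THEN eqD0, OF 1] in simp_all)
  qed
next
  case h: (eq_trans \<Gamma> a b A c)
  show ?case
  proof (rule eq_predI[OF h(2)[THEN eq_pred_good]], goal_cases)
    case (1 \<Delta> s)
    show ?case
      unfolding sub.simps
      by (rule eq_tm_cast[OF eq_trans[where b = "sub s b" and A = "sub s A"]])
        (use h(2)[THEN eqD0, OF 1] h(4)[THEN eqD0, OF 1] in simp_all)
  qed
next
  case h: (eq_conv \<Gamma> a b A B u)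
  show ?case
  proof (rule eq_predI[OF h(2)[THEN eq_pred_good]], goal_cases)
    case (1 \<Delta> s)
    show ?case
      unfolding sub.simps
      by (rule eq_tm_cast[OF eq_conv[where A = "sub s A" and B = "sub s B" and u = u]])
        (use h(2)[THEN eqD0, OF 1] h(4)[THEN eqD0, OF 1] in simp_all)
  qed
next
  case h: (pi_beta \<Gamma> A u b B a)
  show ?case
  proof (rule eq_predI[OF h(2)[THEN ty_pred_good]], goal_cases)
    case (1 \<Delta> s)
    show ?case
      unfolding sub.simps
      by (rule eq_tm_cast_beta[OF pi_beta[where u = u and B = "sub (lift_sub s) B"]])
        (use h(2)[THEN tyD0, OF 1] h(4)[THEN tyD1, OF 1] h(6)[THEN tyD0, OF 1] in simp_all)
  qed
next
  case h: (pi_eta \<Gamma> f A B)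
  show ?case
  proof (rule eq_predI[OF h(2)[THEN ty_pred_good]], goal_cases)
    case (1 \<Delta> s)
    show ?case
      unfolding sub.simps
      by (rule eq_tm_cast_beta[OF pi_eta[where A = "sub s A" and B = "sub (lift_sub s) B"]])
        (use h(2)[THEN tyD0, OF 1] in simp_all)
  qed
next
  case h: (sg_beta A B \<Gamma> C w d a b)
  show ?case
  proof (rule eq_predI[OF h(6)[THEN ty_pred_good]], goal_cases)
    case (1 \<Delta> s)
    show ?case
      unfolding sub.simps
      by (rule eq_tm_cast_beta[OF sg_beta[where A = "sub s A" and w = w]])
        (use h(2)[THEN tyD1, OF 1] h(4)[THEN tyD2, OF 1] h(6)[THEN tyD0, OF 1] h(8)[THEN tyD0, OF 1] in simp_all)
  qed
next
  case h: (plus_betaL A B \<Gamma> C w d e a)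
  show ?case
  proof (rule eq_predI[OF h(8)[THEN ty_pred_good]], goal_cases)
    case (1 \<Delta> s)
    show ?case
      unfolding sub.simps
      by (rule eq_tm_cast_beta[OF plus_betaL[where A = "sub s A" and w = w]])
        (use h(2)[THEN tyD1, OF 1] h(4)[THEN tyD1, OF 1] h(6)[THEN tyD1, OF 1] h(8)[THEN tyD0, OF 1] in simp_all)
  qed
next
  case h: (plus_betaR A B \<Gamma> C w d e b)
  show ?case
  proof (rule eq_predI[OF h(8)[THEN ty_pred_good]], goal_cases)
    case (1 \<Delta> s)
    show ?case
      unfolding sub.simps
      by (rule eq_tm_cast_beta[OF plus_betaR[where B = "sub s B" and w = w]])
        (use h(2)[THEN tyD1, OF 1] h(4)[THEN tyD1, OF 1] h(6)[THEN tyD1, OF 1] h(8)[THEN tyD0, OF 1] in simp_all)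
  qed
next
  case h: (one_beta u \<Gamma> C w d)
  show ?case
  proof (rule eq_predI[OF h(4)[THEN ty_pred_good]], goal_cases)
    case (1 \<Delta> s)
    show ?case
      unfolding sub.simps
      by (rule eq_tm_cast_beta[OF one_beta[where w = w]])
        (use h(2)[THEN tyD1, OF 1] h(4)[THEN tyD0, OF 1] in simp_all)
  qed
next
  case h: (nat_beta0 u \<Gamma> C w d e)
  show ?case
  proof (rule eq_predI[OF h(4)[THEN ty_pred_good]], goal_cases)
    case (1 \<Delta> s)
    show ?case
      unfolding sub.simps
      by (rule eq_tm_cast_beta[OF nat_beta0[where w = w]])
        (use h(2)[THEN tyD1, OF 1] h(4)[THEN tyD0, OF 1] h(6)[THEN tyD2, OF 1] in simp_all)
  qed
next
  case h: (nat_betaS u \<Gamma> C w d e n)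
  show ?case
  proof (rule eq_predI[OF h(4)[THEN ty_pred_good]], goal_cases)
    case (1 \<Delta> s)
    show ?case
      unfolding sub.simps
      by (rule eq_tm_cast_beta[OF nat_betaS[where u = u and w = w]])
        (use h(2)[THEN tyD1, OF 1] h(4)[THEN tyD0, OF 1] h(6)[THEN tyD2, OF 1] h(8)[THEN tyD0, OF 1] in simp_all)
  qed
next
  case h: (id_beta A \<Gamma> C w d a)
  show ?case
  proof (rule eq_predI[OF h(6)[THEN ty_pred_good]], goal_cases)
    case (1 \<Delta> s)
    show ?case
      unfolding sub.simps
      by (rule eq_tm_cast_beta[OF id_beta[where A = "sub s A" and w = w]])
        (use h(2)[THEN tyD3, OF 1] h(4)[THEN tyD1, OF 1] h(6)[THEN tyD0, OF 1] in simp_all)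
  qed
next
  case h: (pi_cong \<Gamma> A u A' B B' v)
  show ?case
  proof (rule eq_predI[OF h(2)[THEN ty_pred_good]], goal_cases)
    case (1 \<Delta> s)
    show ?case
      unfolding sub.simps
      by (rule eq_tm_cast[OF pi_cong[where u = u and v = v]])
        (use h(2)[THEN tyD0, OF 1] h(4)[THEN eqD0, OF 1] h(6)[THEN eqD1, OF 1] in simp_all)
  qed
next
  case h: (lam_cong \<Gamma> A u A' b b' B)
  show ?case
  proof (rule eq_predI[OF h(2)[THEN ty_pred_good]], goal_cases)
    case (1 \<Delta> s)
    show ?case
      unfolding sub.simps
      by (rule eq_tm_cast[OF lam_cong[where u = u and B = "sub (lift_sub s) B"]])
        (use h(2)[THEN tyD0, OF 1] h(4)[THEN eqD0, OF 1] h(6)[THEN eqD1, OF 1] in simp_all)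
  qed
next
  case h: (app_cong \<Gamma> f f' A B a a')
  show ?case
  proof (rule eq_predI[OF h(2)[THEN eq_pred_good]], goal_cases)
    case (1 \<Delta> s)
    show ?case
      unfolding sub.simps
      by (rule eq_tm_cast[OF app_cong[where A = "sub s A" and B = "sub (lift_sub s) B"]])
        (use h(2)[THEN eqD0, OF 1] h(4)[THEN eqD0, OF 1] in simp_all)
  qed
next
  case h: (sg_cong \<Gamma> A u A' B B' v)
  show ?case
  proof (rule eq_predI[OF h(2)[THEN ty_pred_good]], goal_cases)
    case (1 \<Delta> s)
    show ?case
      unfolding sub.simps
      by (rule eq_tm_cast[OF sg_cong[where u = u and v = v]])
        (use h(2)[THEN tyD0, OF 1] h(4)[THEN eqD0, OF 1] h(6)[THEN eqD1, OF 1] in simp_all)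
  qed
next
  case h: (pr_cong A \<Gamma> B v B' a a' b b')
  show ?case
  proof (rule eq_predI[OF h(6)[THEN eq_pred_good]], goal_cases)
    case (1 \<Delta> s)
    show ?case
      unfolding sub.simps
      by (rule eq_tm_cast[OF pr_cong[where A = "sub s A" and v = v]])
        (use h(2)[THEN tyD1, OF 1] h(4)[THEN eqD1, OF 1] h(6)[THEN eqD0, OF 1] h(8)[THEN eqD0, OF 1] in simp_all)
  qed
next
  case h: (split_cong A B \<Gamma> C w C' d d' p p')
  show ?case
  proof (rule eq_predI[OF h(8)[THEN eq_pred_good]], goal_cases)
    case (1 \<Delta> s)
    show ?case
      unfolding sub.simps
      by (rule eq_tm_cast[OF split_cong[where A = "sub s A" and B = "sub (lift_sub s) B" and w = w]])
        (use h(2)[THEN tyD1, OF 1] h(4)[THEN eqD1, OF 1] h(6)[THEN eqD2, OF 1] h(8)[THEN eqD0, OF 1] in simp_all)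
  qed
next
  case h: (plus_cong \<Gamma> A A' u B B' v)
  show ?case
  proof (rule eq_predI[OF h(2)[THEN eq_pred_good]], goal_cases)
    case (1 \<Delta> s)
    show ?case
      unfolding sub.simps
      by (rule eq_tm_cast[OF plus_cong[where u = u and v = v]])
        (use h(2)[THEN eqD0, OF 1] h(4)[THEN eqD0, OF 1] in simp_all)
  qed
next
  case h: (inL_cong \<Gamma> a a' A B u B' v)
  show ?case
  proof (rule eq_predI[OF h(2)[THEN eq_pred_good]], goal_cases)
    case (1 \<Delta> s)
    show ?case
      unfolding sub.simps
      by (rule eq_tm_cast[OF inL_cong[where A = "sub s A" and u = u and v = v]])
        (use h(2)[THEN eqD0, OF 1] h(4)[THEN tyD0, OF 1] h(6)[THEN eqD0, OF 1] in simp_all)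
  qed
next
  case h: (inR_cong \<Gamma> b b' B A u A' v)
  show ?case
  proof (rule eq_predI[OF h(2)[THEN eq_pred_good]], goal_cases)
    case (1 \<Delta> s)
    show ?case
      unfolding sub.simps
      by (rule eq_tm_cast[OF inR_cong[where B = "sub s B" and u = u and v = v]])
        (use h(2)[THEN eqD0, OF 1] h(4)[THEN tyD0, OF 1] h(6)[THEN eqD0, OF 1] in simp_all)
  qed
next
  case h: (cases_cong A B \<Gamma> C w C' d d' e e' p p')
  show ?case
  proof (rule eq_predI[OF h(10)[THEN eq_pred_good]], goal_cases)
    case (1 \<Delta> s)
    show ?case
      unfolding sub.simps
      by (rule eq_tm_cast[OF cases_cong[where A = "sub s A" and B = "sub s B" and w = w]])
        (use h(2)[THEN tyD1, OF 1] h(4)[THEN eqD1, OF 1] h(6)[THEN eqD1, OF 1] h(8)[THEN eqD1, OF 1] h(10)[THEN eqD0, OF 1] in simp_all)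
  qed
next
  case h: (abort_cong u \<Gamma> C w C' p p')
  show ?case
  proof (rule eq_predI[OF h(6)[THEN eq_pred_good]], goal_cases)
    case (1 \<Delta> s)
    show ?case
      unfolding sub.simps
      by (rule eq_tm_cast[OF abort_cong[where u = u and w = w]])
        (use h(2)[THEN tyD1, OF 1] h(4)[THEN eqD1, OF 1] h(6)[THEN eqD0, OF 1] in simp_all)
  qed
next
  case h: (oneRec_cong u \<Gamma> C w C' d d' p p')
  show ?case
  proof (rule eq_predI[OF h(6)[THEN eq_pred_good]], goal_cases)
    case (1 \<Delta> s)
    show ?case
      unfolding sub.simps
      by (rule eq_tm_cast[OF oneRec_cong[where u = u and w = w]])
        (use h(2)[THEN tyD1, OF 1] h(4)[THEN eqD1, OF 1] h(6)[THEN eqD0, OF 1] h(8)[THEN eqD0, OF 1] in simp_all)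
  qed
next
  case h: (su_cong \<Gamma> n n' u)
  show ?case
  proof (rule eq_predI[OF h(2)[THEN eq_pred_good]], goal_cases)
    case (1 \<Delta> s)
    show ?case
      unfolding sub.simps
      by (rule eq_tm_cast[OF su_cong[where u = u]])
        (use h(2)[THEN eqD0, OF 1] in simp_all)
  qed
next
  case h: (natRec_cong u \<Gamma> C w C' d d' e e' n n')
  show ?case
  proof (rule eq_predI[OF h(6)[THEN eq_pred_good]], goal_cases)
    case (1 \<Delta> s)
    show ?case
      unfolding sub.simps
      by (rule eq_tm_cast[OF natRec_cong[where u = u and w = w]])
        (use h(2)[THEN tyD1, OF 1] h(4)[THEN eqD1, OF 1] h(6)[THEN eqD0, OF 1] h(8)[THEN eqD2, OF 1] h(10)[THEN eqD0, OF 1] in simp_all)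
  qed
next
  case h: (id_cong \<Gamma> A A' u a a' b b')
  show ?case
  proof (rule eq_predI[OF h(2)[THEN eq_pred_good]], goal_cases)
    case (1 \<Delta> s)
    show ?case
      unfolding sub.simps
      by (rule eq_tm_cast[OF id_cong[where u = u]])
        (use h(2)[THEN eqD0, OF 1] h(4)[THEN eqD0, OF 1] h(6)[THEN eqD0, OF 1] in simp_all)
  qed
next
  case h: (refl_cong \<Gamma> a a' A)
  show ?case
  proof (rule eq_predI[OF h(2)[THEN eq_pred_good]], goal_cases)
    case (1 \<Delta> s)
    show ?case
      unfolding sub.simps
      by (rule eq_tm_cast[OF refl_cong[where A = "sub s A"]])
        (use h(2)[THEN eqD0, OF 1] in simp_all)
  qed
next
  case h: (J_cong A \<Gamma> C w C' d d' a b p p')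
  show ?case
  proof (rule eq_predI[OF h(8)[THEN ty_pred_good]], goal_cases)
    case (1 \<Delta> s)
    show ?case
      unfolding sub.simps
      by (rule eq_tm_cast[OF J_cong[where A = "sub s A" and w = w and a = "sub s a" and b = "sub s b"]])
        (use h(2)[THEN tyD3, OF 1] h(4)[THEN eqD3, OF 1] h(6)[THEN eqD1, OF 1] h(8)[THEN tyD0, OF 1] h(10)[THEN tyD0, OF 1] h(12)[THEN eqD0, OF 1] in simp_all)
  qed
qed

end

section \<open>Typed renamings and substitutions\<close>

definition wf_sub :: "('c, 'l::ulevel) sig \<Rightarrow> ('c, 'l) sub_class" where
  "wf_sub S \<Gamma> \<Delta> s \<longleftrightarrow>
    (\<forall>i < length \<Gamma>. S \<triangleright> \<Delta> \<turnstile> s i \<Colon> sub s (sub (shift (Suc i)) (\<Gamma> ! i)))"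

text \<open>Lifting a typed substitution requires weakening, which is the instance of the induction
  for renamings. Renamings are therefore treated first, and their condition is an equation between
  types rather than a typing, so that their lifting stays elementary.\<close>

definition wf_ren :: "('c, 'l::ulevel) sig \<Rightarrow> ('c, 'l) sub_class" where
  "wf_ren S \<Gamma> \<Delta> s \<longleftrightarrow> (\<exists>r. s = (\<lambda>i. Var (r i)) \<and>
    (\<forall>i < length \<Gamma>. r i < length \<Delta> \<and>
      sub (shift (Suc (r i))) (\<Delta> ! r i) = sub s (sub (shift (Suc i)) (\<Gamma> ! i))))"

interpretation ren: substitution_class S "wf_ren S" for S
proof
  show "S \<triangleright> \<Delta> \<turnstile> s i \<Colon> sub s (sub (shift (Suc i)) (\<Gamma> ! i))"
    if s: "wf_ren S \<Gamma> \<Delta> s" and \<Delta>: "S \<triangleright> \<Delta> ctx" and i: "i < length \<Gamma>" for \<Gamma> \<Delta> s i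
  proof -
    obtain r where "s i = Var (r i)" "r i < length \<Delta>"
      "sub (shift (Suc (r i))) (\<Delta> ! r i) = sub s (sub (shift (Suc i)) (\<Gamma> ! i))"
      using s i unfolding wf_ren_def by blast
    then show ?thesis
      using var[OF \<Delta>, of "r i"] unfolding fold_shift by simp
  qed
  show "wf_ren S (A # \<Gamma>) (sub s A # \<Delta>) (lift_sub s)" if w: "wf_ren S \<Gamma> \<Delta> s" for \<Gamma> \<Delta> s A
  proof -
    obtain r where s: "s = (\<lambda>i. Var (r i))"
      and r: "\<And>i. i < length \<Gamma> \<Longrightarrow> r i < length \<Delta> \<and>
        sub (shift (Suc (r i))) (\<Delta> ! r i) = sub s (sub (shift (Suc i)) (\<Gamma> ! i))"
      using w unfolding wf_ren_def by blast
    \<comment> \<open>The equation given by the hypothesis is weakened once more, since both of its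
      sides move below the new variable.\<close>
    have *: "sub (shift (Suc (Suc (r i)))) (\<Delta> ! r i) = sub (shift (Suc 0) \<odot> s \<odot> shift (Suc i)) (\<Gamma> ! i)"
      if "i < length \<Gamma>" for i
      using arg_cong[OF conjunct2[OF r[OF that]], of "sub (shift (Suc 0))"] by simp
    have l: "lift_sub s = (\<lambda>i. Var (lift_ren r i))"
      unfolding s by (rule lift_sub_Var_ren)
    show ?thesis
      unfolding wf_ren_def
    proof (rule exI[of _ "lift_ren r"], intro conjI l allI impI, goal_cases)
      case (1 i)
      then show ?case using r by (cases i) auto
    next
      case (2 i)
      then show ?case using * by (cases i) simp_all
    qed
  qed
qed

lemma weakening:
  assumes "S \<triangleright> A # \<Gamma> ctx"
  shows "S \<triangleright> \<Gamma> \<turnstile> b \<Colon> B \<Longrightarrow> S \<triangleright> A # \<Gamma> \<turnstile> sub (shift (Suc 0)) b \<Colon> sub (shift (Suc 0)) B"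
    and "S \<triangleright> \<Gamma> \<turnstile> b \<doteq> c \<Colon> B \<Longrightarrow>
      S \<triangleright> A # \<Gamma> \<turnstile> sub (shift (Suc 0)) b \<doteq> sub (shift (Suc 0)) c \<Colon> sub (shift (Suc 0)) B"
proof -
  have "ren.ok S \<Gamma> (A # \<Gamma>) (shift (Suc 0))"
    using assms unfolding ren.ok_def wf_ren_def by (auto intro!: exI[of _ Suc])
  from ren.tyD0[OF ren.substitution(2) this] ren.eqD0[OF ren.substitution(3) this]
  show "S \<triangleright> \<Gamma> \<turnstile> b \<Colon> B \<Longrightarrow> S \<triangleright> A # \<Gamma> \<turnstile> sub (shift (Suc 0)) b \<Colon> sub (shift (Suc 0)) B"
    and "S \<triangleright> \<Gamma> \<turnstile> b \<doteq> c \<Colon> B \<Longrightarrow>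
      S \<triangleright> A # \<Gamma> \<turnstile> sub (shift (Suc 0)) b \<doteq> sub (shift (Suc 0)) c \<Colon> sub (shift (Suc 0)) B"
    by blast+
qed

lemma var0: "S \<triangleright> A # \<Gamma> ctx \<Longrightarrow> S \<triangleright> A # \<Gamma> \<turnstile> Var 0 \<Colon> sub (shift (Suc 0)) A"
  using var[of S "A # \<Gamma>" 0] unfolding fold_shift by simp

text \<open>The values of a lifted substitution are typed by \<open>weakening\<close>, so this
  second instance of the induction depends on the first.\<close>

interpretation subst: substitution_class S "wf_sub S" for S
proof
  show "S \<triangleright> \<Delta> \<turnstile> s i \<Colon> sub s (sub (shift (Suc i)) (\<Gamma> ! i))"
    if "wf_sub S \<Gamma> \<Delta> s" "S \<triangleright> \<Delta> ctx" "i < length \<Gamma>" for \<Gamma> \<Delta> s i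
    using that unfolding wf_sub_def by blast
  show "wf_sub S (A # \<Gamma>) (sub s A # \<Delta>) (lift_sub s)"
    if s: "wf_sub S \<Gamma> \<Delta> s" and A: "S \<triangleright> sub s A # \<Delta> ctx" for \<Gamma> \<Delta> s A
    unfolding wf_sub_def
  proof (intro allI impI)
    fix i assume "i < length (A # \<Gamma>)"
    then show "S \<triangleright> sub s A # \<Delta> \<turnstile> lift_sub s i \<Colon> sub (lift_sub s) (sub (shift (Suc i)) ((A # \<Gamma>) ! i))"
      using weakening(1)[OF A s[unfolded wf_sub_def, rule_format]] var0[OF A] by (cases i) simp_all
  qed
qed

lemma wf_sub_nil: "wf_sub S [] \<Delta> s"
  by (simp add: wf_sub_def)

lemma wf_sub_scons:
  assumes "S \<triangleright> \<Delta> \<turnstile> a \<Colon> sub s A" "wf_sub S \<Gamma> \<Delta> s"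
  shows "wf_sub S (A # \<Gamma>) \<Delta> (a \<bullet> s)"
  unfolding wf_sub_def
proof (intro allI impI)
  fix i assume "i < length (A # \<Gamma>)"
  then show "S \<triangleright> \<Delta> \<turnstile> (a \<bullet> s) i \<Colon> sub (a \<bullet> s) (sub (shift (Suc i)) ((A # \<Gamma>) ! i))"
    using assms by (cases i) (simp_all add: wf_sub_def)
qed

lemma wf_sub_shift:
  assumes "S \<triangleright> \<Delta> ctx" "\<Delta> = \<Xi> @ \<Gamma>" "length \<Xi> = n"
  shows "wf_sub S \<Gamma> \<Delta> (shift n)"
  unfolding wf_sub_def
proof (intro allI impI)
  fix i assume "i < length \<Gamma>"
  then show "S \<triangleright> \<Delta> \<turnstile> shift n i \<Colon> sub (shift n) (sub (shift (Suc i)) (\<Gamma> ! i))"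
    using var[of S \<Delta> "i + n"] assms unfolding fold_shift by (simp add: nth_append ac_simps)
qed

lemma wf_sub_Var: "S \<triangleright> \<Gamma> ctx \<Longrightarrow> wf_sub S \<Gamma> \<Gamma> Var"
  using wf_sub_shift[of S \<Gamma> "[]" \<Gamma> 0] by simp

lemma substitute:
  assumes "wf_sub S \<Gamma> \<Delta> s" "S \<triangleright> \<Delta> ctx"
  shows "S \<triangleright> \<Gamma> \<turnstile> a \<Colon> A \<Longrightarrow> S \<triangleright> \<Delta> \<turnstile> sub s a \<Colon> sub s A"
    and "S \<triangleright> \<Gamma> \<turnstile> a \<doteq> b \<Colon> A \<Longrightarrow> S \<triangleright> \<Delta> \<turnstile> sub s a \<doteq> sub s b \<Colon> sub s A"
proof -
  have "subst.ok S \<Gamma> \<Delta> s"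
    using assms by (simp add: subst.ok_def)
  from subst.tyD0[OF subst.substitution(2) this] subst.eqD0[OF subst.substitution(3) this]
  show "S \<triangleright> \<Gamma> \<turnstile> a \<Colon> A \<Longrightarrow> S \<triangleright> \<Delta> \<turnstile> sub s a \<Colon> sub s A"
    and "S \<triangleright> \<Gamma> \<turnstile> a \<doteq> b \<Colon> A \<Longrightarrow> S \<triangleright> \<Delta> \<turnstile> sub s a \<doteq> sub s b \<Colon> sub s A"
    by blast+
qed

text \<open>Brings the closed witness of univalence into the context where it is used.\<close>

lemma weaken_closed:
  assumes "S \<triangleright> [] \<turnstile> a \<Colon> A" "S \<triangleright> \<Gamma> ctx"
  shows "S \<triangleright> \<Gamma> \<turnstile> a \<Colon> A"
  using substitute(1)[OF wf_sub_nil assms(2,1), of Var] by simp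

section \<open>Derived rules\<close>

context
  fixes S :: "('c, 'l::ulevel) sig"
begin

abbreviation (input) ctx_in :: "('c, 'l) tm list \<Rightarrow> bool" ("_ ctx" [51] 50) where
  "\<Gamma> ctx \<equiv> S \<triangleright> \<Gamma> ctx"

abbreviation (input) has_type_in :: "('c, 'l) tm list \<Rightarrow> ('c, 'l) tm \<Rightarrow> ('c, 'l) tm \<Rightarrow> bool"
    ("_ \<turnstile> _ \<Colon> _" [51, 51, 51] 50) where
  "\<Gamma> \<turnstile> a \<Colon> A \<equiv> S \<triangleright> \<Gamma> \<turnstile> a \<Colon> A"

abbreviation (input) eq_tm_in :: "('c, 'l) tm list \<Rightarrow> ('c, 'l) tm \<Rightarrow> ('c, 'l) tm \<Rightarrow> ('c, 'l) tm \<Rightarrow> bool"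
    ("_ \<turnstile> _ \<doteq> _ \<Colon> _" [51, 51, 51, 51] 50) where
  "\<Gamma> \<turnstile> a \<doteq> b \<Colon> A \<equiv> S \<triangleright> \<Gamma> \<turnstile> a \<doteq> b \<Colon> A"

text \<open>The theorem asks for the existence of inhabitants. Working with \<open>inh\<close> keeps
  proof terms out of the types; explicit terms remain where a later type mentions them.\<close>

definition inh :: "('c, 'l) tm list \<Rightarrow> ('c, 'l) tm \<Rightarrow> bool" where
  "inh \<Gamma> A \<longleftrightarrow> (\<exists>a. \<Gamma> \<turnstile> a \<Colon> A)"

lemma inhI: "\<Gamma> \<turnstile> a \<Colon> A \<Longrightarrow> inh \<Gamma> A"
  by (auto simp: inh_def)

lemma inhE: "inh \<Gamma> A \<Longrightarrow> (\<And>a. \<Gamma> \<turnstile> a \<Colon> A \<Longrightarrow> thesis) \<Longrightarrow> thesis"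
  by (auto simp: inh_def)

lemma ctx_ty: "\<Gamma> \<turnstile> A \<Colon> Univ u \<Longrightarrow> A # \<Gamma> ctx"
  using ctx_cons has_type_ctx(2) by blast

lemma var_cast: "\<Gamma> ctx \<Longrightarrow> i < length \<Gamma> \<Longrightarrow> sub (shift (Suc i)) (\<Gamma> ! i) = A \<Longrightarrow> \<Gamma> \<turnstile> Var i \<Colon> A"
  using var unfolding fold_shift by blast

lemma sup_usuc [simp]:
  "sup (usuc u) u = usuc u" "sup u (usuc u) = usuc u"
  using usuc_greater[of u] by (auto intro: sup_absorb1 sup_absorb2)

lemma wk_ty: "\<Gamma> \<turnstile> A \<Colon> Univ u \<Longrightarrow> \<Gamma> \<turnstile> b \<Colon> B \<Longrightarrow> A # \<Gamma> \<turnstile> wk b \<Colon> wk B"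
  using weakening(1)[OF ctx_ty] by simp

lemma wk_Univ: "\<Gamma> \<turnstile> A \<Colon> Univ u \<Longrightarrow> \<Gamma> \<turnstile> B \<Colon> Univ v \<Longrightarrow> A # \<Gamma> \<turnstile> wk B \<Colon> Univ v"
  using wk_ty[of \<Gamma> A u B "Univ v"] by simp

lemma wk_eqtm:
  "\<Gamma> \<turnstile> A \<Colon> Univ u \<Longrightarrow> \<Gamma> \<turnstile> b \<doteq> c \<Colon> B \<Longrightarrow> A # \<Gamma> \<turnstile> wk b \<doteq> wk c \<Colon> wk B"
  using weakening(2)[OF ctx_ty] by simp

lemma weaken:
  assumes "\<Gamma> \<turnstile> b \<Colon> B" "\<Delta> ctx" "\<Delta> = \<Xi> @ \<Gamma>" "length \<Xi> = n"
  shows "\<Delta> \<turnstile> sub (shift n) b \<Colon> sub (shift n) B"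
  by (rule substitute(1)[OF wf_sub_shift[OF assms(2,3,4)] assms(2,1)])

lemma inst_shift:
  assumes "A # \<Gamma> \<turnstile> b \<Colon> B" "\<Delta> \<turnstile> a \<Colon> sub (shift n) A" "\<Delta> = \<Xi> @ \<Gamma>" "length \<Xi> = n"
  shows "\<Delta> \<turnstile> sub (a \<bullet> shift n) b \<Colon> sub (a \<bullet> shift n) B"
  by (rule substitute(1)[OF wf_sub_scons[OF assms(2) wf_sub_shift[OF _ assms(3,4)]] _ assms(1)])
    (rule has_type_ctx(2)[OF assms(2)])+

lemma inst: "A # \<Gamma> \<turnstile> b \<Colon> B \<Longrightarrow> \<Gamma> \<turnstile> a \<Colon> A \<Longrightarrow> \<Gamma> \<turnstile> sub (a \<bullet> Var) b \<Colon> sub (a \<bullet> Var) B"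
  using inst_shift[of A \<Gamma> b B \<Gamma> a 0 "[]"] by simp

lemma inst_Univ:
  assumes "A # \<Gamma> \<turnstile> B \<Colon> Univ u" "\<Gamma> \<turnstile> a \<Colon> A"
  shows "\<Gamma> \<turnstile> sub (a \<bullet> Var) B \<Colon> Univ u"
  using inst[OF assms] by simp

lemma inh_conv:
  "inh \<Gamma> A \<Longrightarrow> \<Gamma> \<turnstile> A \<doteq> B \<Colon> Univ u \<Longrightarrow> inh \<Gamma> B"
  by (auto simp: inh_def intro: conv)

lemma inh_wk: "\<Gamma> \<turnstile> A \<Colon> Univ u \<Longrightarrow> inh \<Gamma> B \<Longrightarrow> inh (A # \<Gamma>) (wk B)"
  by (auto simp: inh_def simp del: wk_eq intro: wk_ty)

lemma inh_substitute:
  "wf_sub S \<Gamma> \<Delta> s \<Longrightarrow> \<Delta> ctx \<Longrightarrow> inh \<Gamma> A \<Longrightarrow> inh \<Delta> (sub s A)"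
  by (auto simp: inh_def dest: substitute(1))

lemma inh_weaken:
  "inh \<Gamma> A \<Longrightarrow> \<Delta> ctx \<Longrightarrow> \<Delta> = \<Xi> @ \<Gamma> \<Longrightarrow> length \<Xi> = n \<Longrightarrow> inh \<Delta> (sub (shift n) A)"
  by (blast intro: inh_substitute wf_sub_shift)

lemma inh_Lam: "\<Gamma> \<turnstile> A \<Colon> Univ u \<Longrightarrow> inh (A # \<Gamma>) B \<Longrightarrow> inh \<Gamma> (Pi A B)"
  by (auto simp: inh_def intro: pi_intro)

lemma inh_App: "inh \<Gamma> (Pi A B) \<Longrightarrow> \<Gamma> \<turnstile> a \<Colon> A \<Longrightarrow> inh \<Gamma> (sub (a \<bullet> Var) B)"
  by (auto simp: inh_def intro: pi_elim)

lemma arr_form: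
  "\<Gamma> \<turnstile> A \<Colon> Univ u \<Longrightarrow> \<Gamma> \<turnstile> B \<Colon> Univ v \<Longrightarrow> \<Gamma> \<turnstile> Arr A B \<Colon> Univ (sup u v)"
  unfolding Arr_def by (blast intro: pi_form wk_Univ)

lemma arr_intro: "\<Gamma> \<turnstile> A \<Colon> Univ u \<Longrightarrow> A # \<Gamma> \<turnstile> b \<Colon> wk B \<Longrightarrow> \<Gamma> \<turnstile> Lam A b \<Colon> Arr A B"
  unfolding Arr_def by (rule pi_intro)

lemma arr_elim: "\<Gamma> \<turnstile> f \<Colon> Arr A B \<Longrightarrow> \<Gamma> \<turnstile> a \<Colon> A \<Longrightarrow> \<Gamma> \<turnstile> App f a \<Colon> B"
  using pi_elim[of S \<Gamma> f A "wk B" a] by (simp add: Arr_def)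

lemma arr_beta:
  "\<Gamma> \<turnstile> A \<Colon> Univ u \<Longrightarrow> A # \<Gamma> \<turnstile> b \<Colon> wk B \<Longrightarrow> \<Gamma> \<turnstile> a \<Colon> A \<Longrightarrow>
    \<Gamma> \<turnstile> App (Lam A b) a \<doteq> sub (a \<bullet> Var) b \<Colon> B"
  using pi_beta[of S \<Gamma> A u b "wk B" a] by simp

lemma arr_app_cong:
  "\<Gamma> \<turnstile> f \<doteq> f' \<Colon> Arr A B \<Longrightarrow> \<Gamma> \<turnstile> a \<doteq> a' \<Colon> A \<Longrightarrow> \<Gamma> \<turnstile> App f a \<doteq> App f' a' \<Colon> B"
  using app_cong[of S \<Gamma> f f' A "wk B" a a'] by (simp add: Arr_def)

lemma inh_Arr: "\<Gamma> \<turnstile> A \<Colon> Univ u \<Longrightarrow> inh (A # \<Gamma>) (wk B) \<Longrightarrow> inh \<Gamma> (Arr A B)"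
  unfolding Arr_def by (rule inh_Lam)

lemma inh_mp: "inh \<Gamma> (Arr A B) \<Longrightarrow> inh \<Gamma> A \<Longrightarrow> inh \<Gamma> B"
  by (auto simp: inh_def intro: arr_elim)

text \<open>There is no congruence rule for substitution into a type. Beta turns both sides into
  applications of \<open>Lam A B\<close>, and these are related by congruence of
  application.\<close>

lemma family_cong:
  assumes A: "\<Gamma> \<turnstile> A \<Colon> Univ u" and B: "A # \<Gamma> \<turnstile> B \<Colon> Univ w"
    and a: "\<Gamma> \<turnstile> a \<Colon> A" "\<Gamma> \<turnstile> a' \<Colon> A" "\<Gamma> \<turnstile> a \<doteq> a' \<Colon> A"
  shows "\<Gamma> \<turnstile> sub (a \<bullet> Var) B \<doteq> sub (a' \<bullet> Var) B \<Colon> Univ w"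
proof -
  have B': "A # \<Gamma> \<turnstile> B \<Colon> wk (Univ w)"
    using B by simp
  have "\<Gamma> \<turnstile> App (Lam A B) a \<doteq> App (Lam A B) a' \<Colon> Univ w"
    by (rule arr_app_cong[OF eq_refl[OF arr_intro[OF A B']] a(3)])
  then show ?thesis
    using arr_beta[OF A B' a(1)] arr_beta[OF A B' a(2)] by (blast intro: eq_sym eq_trans)
qed

lemma Id_conv:
  assumes "\<Gamma> \<turnstile> A \<Colon> Univ u" "\<Gamma> \<turnstile> a \<doteq> a' \<Colon> A" "\<Gamma> \<turnstile> b \<doteq> b' \<Colon> A"
  shows "inh \<Gamma> (Id A a b) \<longleftrightarrow> inh \<Gamma> (Id A a' b')"
  using id_cong[OF eq_refl[OF assms(1)] assms(2,3)] by (blast intro: inh_conv eq_sym)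

lemma inh_Refl: "\<Gamma> \<turnstile> a \<Colon> A \<Longrightarrow> inh \<Gamma> (Id A a a)"
  by (auto simp: inh_def intro: id_intro)

lemma Id_of_eq:
  assumes "\<Gamma> \<turnstile> A \<Colon> Univ u" "\<Gamma> \<turnstile> a \<Colon> A" "\<Gamma> \<turnstile> a \<doteq> b \<Colon> A"
  shows "inh \<Gamma> (Id A a b)"
  using Id_conv[OF assms(1) eq_refl[OF assms(2)] assms(3)] inh_Refl[OF assms(2)] by blast

subsection \<open>Pairs\<close>

lemma times_form:
  "\<Gamma> \<turnstile> A \<Colon> Univ u \<Longrightarrow> \<Gamma> \<turnstile> B \<Colon> Univ v \<Longrightarrow> \<Gamma> \<turnstile> Times A B \<Colon> Univ (sup u v)"
  unfolding Times_def by (blast intro: sg_form wk_Univ)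

lemma inh_Pr:
  "A # \<Gamma> \<turnstile> B \<Colon> Univ v \<Longrightarrow> \<Gamma> \<turnstile> a \<Colon> A \<Longrightarrow> inh \<Gamma> (sub (a \<bullet> Var) B) \<Longrightarrow> inh \<Gamma> (Sg A B)"
  by (auto simp: inh_def intro: sg_intro)

lemma inh_Times:
  assumes "\<Gamma> \<turnstile> A \<Colon> Univ u" "\<Gamma> \<turnstile> B \<Colon> Univ v" "inh \<Gamma> A" "inh \<Gamma> B"
  shows "inh \<Gamma> (Times A B)"
proof -
  obtain a where "\<Gamma> \<turnstile> a \<Colon> A"
    using assms(3) by (rule inhE)
  from inh_Pr[OF wk_Univ[OF assms(1,2)] this] assms(4) show ?thesis
    by (simp add: Times_def)
qed

text \<open>This is the generic pair at which the branch of \<open>Split\<close> is typed. Its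
  annotation is \<open>B\<close> with its own variable kept and the rest moved past that variable
  and the two new ones, hence the 3.\<close>

lemma sg_ctx:
  assumes "\<Gamma> \<turnstile> A \<Colon> Univ u" "A # \<Gamma> \<turnstile> B \<Colon> Univ v"
  shows "B # A # \<Gamma> \<turnstile> Pr (sub (Var 0 \<bullet> shift 3) B) (Var 1) (Var 0) \<Colon> sub (shift 2) (Sg A B)"
proof -
  have c: "B # A # \<Gamma> ctx"
    by (rule ctx_ty[OF assms(2)])
  have A2: "B # A # \<Gamma> \<turnstile> wk (wk A) \<Colon> Univ u"
    by (rule wk_Univ[OF assms(2) wk_Univ[OF assms(1,1)]])
  have c3: "wk (wk A) # B # A # \<Gamma> ctx"
    by (rule ctx_ty[OF A2])
  have B: "wk (wk A) # B # A # \<Gamma> \<turnstile> sub (Var 0 \<bullet> shift 3) B \<Colon> Univ v"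
    using inst_shift[OF assms(2) var_cast[OF c3], of 0 3 "[_, _, _]"] by simp
  show ?thesis
    using sg_intro[OF B var_cast[OF c, of 1] var_cast[OF c, of 0]] by simp
qed

lemma inh_Split:
  assumes "Sg A B # \<Gamma> \<turnstile> C \<Colon> Univ w"
    and "inh (B # A # \<Gamma>) (sub (Pr (sub (Var 0 \<bullet> shift 3) B) (Var 1) (Var 0) \<bullet> shift 2) C)"
    and "\<Gamma> \<turnstile> p \<Colon> Sg A B"
  shows "inh \<Gamma> (sub (p \<bullet> Var) C)"
  using assms(2) sg_elim[unfolded fold_shift, OF assms(1) _ assms(3)] by (auto simp: inh_def)

lemma split_nondep:
  assumes "\<Gamma> \<turnstile> C \<Colon> Univ w" "\<Gamma> \<turnstile> Sg A B \<Colon> Univ v" "B # A # \<Gamma> \<turnstile> d \<Colon> wk (wk C)"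
  shows "\<Gamma> \<turnstile> p \<Colon> Sg A B \<Longrightarrow> \<Gamma> \<turnstile> Split (wk C) d p \<Colon> C"
    and "\<Gamma> \<turnstile> a \<Colon> A \<Longrightarrow> \<Gamma> \<turnstile> b \<Colon> sub (a \<bullet> Var) B \<Longrightarrow>
      \<Gamma> \<turnstile> Split (wk C) d (Pr B a b) \<doteq> sub (b \<bullet> a \<bullet> Var) d \<Colon> C"
proof -
  have C: "Sg A B # \<Gamma> \<turnstile> wk C \<Colon> Univ w"
    by (rule wk_Univ[OF assms(2,1)])
  have d: "B # A # \<Gamma> \<turnstile> d \<Colon> sub (Pr (sub (Var 0 \<bullet> shift 3) B) (Var 1) (Var 0) \<bullet> shift 2) (wk C)"
    using assms(3) by simp
  show "\<Gamma> \<turnstile> p \<Colon> Sg A B \<Longrightarrow> \<Gamma> \<turnstile> Split (wk C) d p \<Colon> C"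
    using sg_elim[unfolded fold_shift, OF C d] by simp
  show "\<Gamma> \<turnstile> a \<Colon> A \<Longrightarrow> \<Gamma> \<turnstile> b \<Colon> sub (a \<bullet> Var) B \<Longrightarrow>
      \<Gamma> \<turnstile> Split (wk C) d (Pr B a b) \<doteq> sub (b \<bullet> a \<bullet> Var) d \<Colon> C"
    using sg_beta[unfolded fold_shift, OF C d] by simp
qed

lemma Fst:
  assumes A: "\<Gamma> \<turnstile> A \<Colon> Univ u" and B: "A # \<Gamma> \<turnstile> B \<Colon> Univ v"
  shows "\<Gamma> \<turnstile> p \<Colon> Sg A B \<Longrightarrow> \<Gamma> \<turnstile> Fst A p \<Colon> A"
    and "\<Gamma> \<turnstile> a \<Colon> A \<Longrightarrow> \<Gamma> \<turnstile> b \<Colon> sub (a \<bullet> Var) B \<Longrightarrow> \<Gamma> \<turnstile> Fst A (Pr B a b) \<doteq> a \<Colon> A"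
proof -
  have v: "B # A # \<Gamma> \<turnstile> Var 1 \<Colon> wk (wk A)"
    by (rule var_cast[OF ctx_ty[OF B]]) simp_all
  show "\<Gamma> \<turnstile> p \<Colon> Sg A B \<Longrightarrow> \<Gamma> \<turnstile> Fst A p \<Colon> A"
    using split_nondep(1)[OF A sg_form[OF A B] v] by (simp add: Fst_def)
  show "\<Gamma> \<turnstile> a \<Colon> A \<Longrightarrow> \<Gamma> \<turnstile> b \<Colon> sub (a \<bullet> Var) B \<Longrightarrow> \<Gamma> \<turnstile> Fst A (Pr B a b) \<doteq> a \<Colon> A"
    using split_nondep(2)[OF A sg_form[OF A B] v] by (simp add: Fst_def)
qed

text \<open>The second projection is a dependent \<open>Split\<close>. On the generic pair the
  component at hand has type \<open>B\<close> at the first component, while the motive asks for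
  \<open>B\<close> at \<open>Fst\<close> of the pair; beta for \<open>Fst\<close> and
  \<open>family_cong\<close> make the two convertible.\<close>

lemma inh_Snd:
  assumes A: "\<Gamma> \<turnstile> A \<Colon> Univ u" and B: "A # \<Gamma> \<turnstile> B \<Colon> Univ v"
    and p: "\<Gamma> \<turnstile> p \<Colon> Sg A B"
  shows "inh \<Gamma> (sub (Fst A p \<bullet> Var) B)"
proof -
  have Sg: "\<Gamma> \<turnstile> Sg A B \<Colon> Univ (sup u v)"
    by (rule sg_form[OF A B])
  have c: "B # A # \<Gamma> ctx" and c': "Sg A B # \<Gamma> ctx"
    by (rule ctx_ty[OF B], rule ctx_ty[OF Sg])
  have A1: "Sg A B # \<Gamma> \<turnstile> wk A \<Colon> Univ u"
    by (rule wk_Univ[OF Sg A])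
  have A2: "B # A # \<Gamma> \<turnstile> wk (wk A) \<Colon> Univ u"
    by (rule wk_Univ[OF B wk_Univ[OF A A]])
  have B1: "wk A # Sg A B # \<Gamma> \<turnstile> sub (Var 0 \<bullet> shift 2) B \<Colon> Univ v"
    using inst_shift[OF B var_cast[OF ctx_ty[OF A1]], of 0 2 "[_, _]"] by simp
  have B2: "wk (wk A) # B # A # \<Gamma> \<turnstile> sub (Var 0 \<bullet> shift 3) B \<Colon> Univ v"
    using inst_shift[OF B var_cast[OF ctx_ty[OF A2]], of 0 3 "[_, _, _]"] by simp
  have F: "Sg A B # \<Gamma> \<turnstile> Fst (wk A) (Var 0) \<Colon> wk A"
    by (rule Fst(1)[OF A1 B1], rule var_cast[OF c']) simp_all
  have C: "Sg A B # \<Gamma> \<turnstile> sub (Fst (wk A) (Var 0) \<bullet> shift 1) B \<Colon> Univ v"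
    using inst_shift[OF B, of _ "Fst (wk A) (Var 0)" 1 "[_]"] F by simp
  let ?P = "Pr (sub (Var 0 \<bullet> shift 3) B) (Var 1) (Var 0)"
  have v1: "B # A # \<Gamma> \<turnstile> Var 1 \<Colon> wk (wk A)"
    by (rule var_cast[OF c]) simp_all
  have v0: "B # A # \<Gamma> \<turnstile> Var 0 \<Colon> sub (Var 1 \<bullet> Var) (sub (Var 0 \<bullet> shift 3) B)"
    by (rule var_cast[OF c]) simp_all
  have P: "B # A # \<Gamma> \<turnstile> ?P \<Colon> Sg (wk (wk A)) (sub (Var 0 \<bullet> shift 3) B)"
    by (rule sg_intro[OF B2 v1 v0])
  have "B # A # \<Gamma> \<turnstile> sub (Var 1 \<bullet> Var) (sub (Var 0 \<bullet> shift 3) B) \<doteq>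
      sub (Fst (wk (wk A)) ?P \<bullet> Var) (sub (Var 0 \<bullet> shift 3) B) \<Colon> Univ v"
    by (rule family_cong[OF A2 B2 v1 Fst(1)[OF A2 B2 P] eq_sym[OF Fst(2)[OF A2 B2 v1 v0]]])
  from inh_conv[OF inhI[OF v0] this]
  have "inh (B # A # \<Gamma>) (sub (?P \<bullet> shift 2) (sub (Fst (wk A) (Var 0) \<bullet> shift 1) B))"
    by simp
  from inh_Split[OF C this p] show ?thesis
    by simp
qed

subsection \<open>Identity types\<close>

lemma Id_ctx:
  assumes "\<Gamma> \<turnstile> A \<Colon> Univ u"
  shows "wk A # A # \<Gamma> \<turnstile> Id (wk (wk A)) (Var 1) (Var 0) \<Colon> Univ u"
    and "Id (wk (wk A)) (Var 1) (Var 0) # wk A # A # \<Gamma> ctx"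
proof -
  have A1: "A # \<Gamma> \<turnstile> wk A \<Colon> Univ u"
    by (rule wk_Univ[OF assms assms])
  note c = ctx_ty[OF A1]
  show *: "wk A # A # \<Gamma> \<turnstile> Id (wk (wk A)) (Var 1) (Var 0) \<Colon> Univ u"
    by (rule id_form[OF wk_Univ[OF A1 A1]]; rule var_cast[OF c]) simp_all
  show "Id (wk (wk A)) (Var 1) (Var 0) # wk A # A # \<Gamma> ctx"
    by (rule ctx_ty[OF *])
qed

lemma inh_J:
  assumes A: "\<Gamma> \<turnstile> A \<Colon> Univ u"
    and C: "Id (wk (wk A)) (Var 1) (Var 0) # wk A # A # \<Gamma> \<turnstile> C \<Colon> Univ w"
    and d: "inh (A # \<Gamma>) (sub (Refl (Var 0) \<bullet> Var 0 \<bullet> Var 0 \<bullet> shift 1) C)"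
    and ab: "\<Gamma> \<turnstile> a \<Colon> A" "\<Gamma> \<turnstile> b \<Colon> A" and p: "\<Gamma> \<turnstile> p \<Colon> Id A a b"
  shows "inh \<Gamma> (sub (p \<bullet> b \<bullet> a \<bullet> Var) C)"
  using d id_elim[unfolded fold_shift, OF C _ ab p] by (auto simp: inh_def)

text \<open>\<open>J\<close> with the motive \<open>B x \<rightarrow> B y\<close>, which the
  identity function inhabits on the diagonal. The motive is an arrow because \<open>J\<close>
  generalizes both endpoints; the element over \<open>a\<close> is supplied afterwards.\<close>

lemma inh_transport:
  assumes A: "\<Gamma> \<turnstile> A \<Colon> Univ u" and B: "A # \<Gamma> \<turnstile> B \<Colon> Univ v"
    and a: "\<Gamma> \<turnstile> a \<Colon> A" and b: "\<Gamma> \<turnstile> b \<Colon> A" and p: "inh \<Gamma> (Id A a b)"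
    and d: "inh \<Gamma> (sub (a \<bullet> Var) B)"
  shows "inh \<Gamma> (sub (b \<bullet> Var) B)"
proof -
  obtain p where p: "\<Gamma> \<turnstile> p \<Colon> Id A a b"
    using p by (rule inhE)
  let ?\<Delta> = "Id (wk (wk A)) (Var 1) (Var 0) # wk A # A # \<Gamma>"
  note c = Id_ctx(2)[OF A]
  have B': "?\<Delta> \<turnstile> sub (Var 2 \<bullet> shift 3) B \<Colon> Univ v" "?\<Delta> \<turnstile> sub (Var 1 \<bullet> shift 3) B \<Colon> Univ v"
    using inst_shift[OF B var_cast[OF c, of 2], of 3 "[_, _, _]"]
      inst_shift[OF B var_cast[OF c, of 1], of 3 "[_, _, _]"] by simp_all
  have "inh (A # \<Gamma>) (Arr B B)"
    by (rule inhI[OF arr_intro[OF B var_cast[OF ctx_ty[OF B], of 0]]]) simp_all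
  then have "inh (A # \<Gamma>) (sub (Refl (Var 0) \<bullet> Var 0 \<bullet> Var 0 \<bullet> shift 1)
      (Arr (sub (Var 2 \<bullet> shift 3) B) (sub (Var 1 \<bullet> shift 3) B)))"
    by simp
  from inh_J[OF A arr_form[OF B'] this a b p] d show ?thesis
    by (auto intro: inh_mp)
qed

text \<open>Transport in the family \<open>t a = t x\<close> with \<open>a\<close> kept fixed. The
  map is given as an open term \<open>t\<close>, so that its values arise by substitution and need
  no beta step.\<close>

lemma inh_ap:
  assumes A: "\<Gamma> \<turnstile> A \<Colon> Univ u" and T: "\<Gamma> \<turnstile> T \<Colon> Univ v" and t: "A # \<Gamma> \<turnstile> t \<Colon> wk T"
    and a: "\<Gamma> \<turnstile> a \<Colon> A" and b: "\<Gamma> \<turnstile> b \<Colon> A" and p: "inh \<Gamma> (Id A a b)"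
  shows "inh \<Gamma> (Id T (sub (a \<bullet> Var) t) (sub (b \<bullet> Var) t))"
proof -
  have ta: "\<Gamma> \<turnstile> sub (a \<bullet> Var) t \<Colon> T"
    using inst[OF t a] by simp
  have "inh \<Gamma> (sub (b \<bullet> Var) (Id (wk T) (wk (sub (a \<bullet> Var) t)) t))"
    by (rule inh_transport[OF A id_form[OF wk_Univ[OF A T] wk_ty[OF A ta] t] a b p])
      (use inh_Refl[OF ta] in simp)
  then show ?thesis
    by simp
qed

lemma inh_sym:
  assumes A: "\<Gamma> \<turnstile> A \<Colon> Univ u"
    and a: "\<Gamma> \<turnstile> a \<Colon> A" and b: "\<Gamma> \<turnstile> b \<Colon> A" and p: "inh \<Gamma> (Id A a b)"
  shows "inh \<Gamma> (Id A b a)"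
proof -
  have "inh \<Gamma> (sub (b \<bullet> Var) (Id (wk A) (Var 0) (wk a)))"
    by (rule inh_transport[OF A id_form[OF wk_Univ[OF A A] var_cast[OF ctx_ty[OF A]] wk_ty[OF A a]] a b p])
      (use inh_Refl[OF a] in simp_all)
  then show ?thesis
    by simp
qed

lemma inh_trans:
  assumes A: "\<Gamma> \<turnstile> A \<Colon> Univ u"
    and a: "\<Gamma> \<turnstile> a \<Colon> A" and b: "\<Gamma> \<turnstile> b \<Colon> A" and c: "\<Gamma> \<turnstile> c \<Colon> A"
    and p: "inh \<Gamma> (Id A a b)" and q: "inh \<Gamma> (Id A b c)"
  shows "inh \<Gamma> (Id A a c)"
proof -
  have "inh \<Gamma> (sub (c \<bullet> Var) (Id (wk A) (wk a) (Var 0)))"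
    by (rule inh_transport[OF A id_form[OF wk_Univ[OF A A] wk_ty[OF A a] var_cast[OF ctx_ty[OF A]]] b c q])
      (use p in simp_all)
  then show ?thesis
    by simp
qed

text \<open>\<open>p\<inverse> \<cdot> q\<close> for \<open>p : x = y\<close> and \<open>q : x = z\<close>; \<open>J\<close> acts on \<open>p\<close>, so that it reduces to \<open>q\<close> if \<open>p\<close> is \<open>Refl\<close>.\<close>
definition cmp :: "('c, 'l) tm \<Rightarrow> ('c, 'l) tm \<Rightarrow> ('c, 'l) tm \<Rightarrow> ('c, 'l) tm \<Rightarrow> ('c, 'l) tm" where
  "cmp A z p q = App
     (J (Arr (Id (sub (shift 3) A) (Var 2) (sub (shift 3) z)) (Id (sub (shift 3) A) (Var 1) (sub (shift 3) z)))
        (Lam (Id (wk A) (Var 0) (wk z)) (Var 0)) p) q"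

lemma sub_cmp [simp]: "sub s (cmp A z p q) = cmp (sub s A) (sub s z) (sub s p) (sub s q)"
  by (simp add: cmp_def)

lemma cmp:
  assumes A: "\<Gamma> \<turnstile> A \<Colon> Univ u" and z: "\<Gamma> \<turnstile> z \<Colon> A" and x: "\<Gamma> \<turnstile> x \<Colon> A"
    and q: "\<Gamma> \<turnstile> q \<Colon> Id A x z"
  shows "\<Gamma> \<turnstile> y \<Colon> A \<Longrightarrow> \<Gamma> \<turnstile> p \<Colon> Id A x y \<Longrightarrow> \<Gamma> \<turnstile> cmp A z p q \<Colon> Id A y z"
    and "\<Gamma> \<turnstile> cmp A z (Refl x) q \<doteq> q \<Colon> Id A x z"
proof -
  let ?\<Delta> = "Id (wk (wk A)) (Var 1) (Var 0) # wk A # A # \<Gamma>"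
  let ?C = "Arr (Id (sub (shift 3) A) (Var 2) (sub (shift 3) z)) (Id (sub (shift 3) A) (Var 1) (sub (shift 3) z))"
  note c = Id_ctx(2)[OF A]
  have A3: "?\<Delta> \<turnstile> sub (shift 3) A \<Colon> Univ u" and z3: "?\<Delta> \<turnstile> sub (shift 3) z \<Colon> sub (shift 3) A"
    using weaken[OF A c, of "[_, _, _]" 3] weaken[OF z c, of "[_, _, _]" 3] by simp_all
  have C: "?\<Delta> \<turnstile> ?C \<Colon> Univ (sup u u)"
    by (rule arr_form[OF id_form[OF A3 var_cast[OF c] z3] id_form[OF A3 var_cast[OF c] z3]]) simp_all
  have I: "A # \<Gamma> \<turnstile> Id (wk A) (Var 0) (wk z) \<Colon> Univ u"
    by (rule id_form[OF wk_Univ[OF A A] var_cast[OF ctx_ty[OF A]] wk_ty[OF A z]]) simp_all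
  have d: "A # \<Gamma> \<turnstile> Lam (Id (wk A) (Var 0) (wk z)) (Var 0) \<Colon>
      sub (Refl (Var 0) \<bullet> Var 0 \<bullet> Var 0 \<bullet> shift 1) ?C"
    using arr_intro[OF I var_cast[OF ctx_ty[OF I], of 0]] by simp
  show "\<Gamma> \<turnstile> y \<Colon> A \<Longrightarrow> \<Gamma> \<turnstile> p \<Colon> Id A x y \<Longrightarrow> \<Gamma> \<turnstile> cmp A z p q \<Colon> Id A y z"
    using arr_elim[OF _ q] id_elim[unfolded fold_shift, OF C d x] by (simp add: cmp_def)
  have Ix: "\<Gamma> \<turnstile> Id A x z \<Colon> Univ u"
    by (rule id_form[OF A x z])
  have "\<Gamma> \<turnstile> J ?C (Lam (Id (wk A) (Var 0) (wk z)) (Var 0)) (Refl x) \<doteq>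
      Lam (Id A x z) (Var 0) \<Colon> Arr (Id A x z) (Id A x z)"
    using id_beta[unfolded fold_shift, OF C d x] by simp
  from arr_app_cong[OF this eq_refl[OF q]]
  have "\<Gamma> \<turnstile> cmp A z (Refl x) q \<doteq> App (Lam (Id A x z) (Var 0)) q \<Colon> Id A x z"
    by (simp add: cmp_def)
  moreover have "\<Gamma> \<turnstile> App (Lam (Id A x z) (Var 0)) q \<doteq> q \<Colon> Id A x z"
    using arr_beta[OF Ix var_cast[OF ctx_ty[OF Ix], of 0] q] by simp
  ultimately show "\<Gamma> \<turnstile> cmp A z (Refl x) q \<doteq> q \<Colon> Id A x z"
    by (rule eq_trans)
qed

text \<open>\<open>J\<close> reduces \<open>p\<close> to \<open>Refl\<close>, where the composite
  computes.\<close>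

lemma inh_cmp_self:
  assumes A: "\<Gamma> \<turnstile> A \<Colon> Univ u" and x: "\<Gamma> \<turnstile> x \<Colon> A" and y: "\<Gamma> \<turnstile> y \<Colon> A"
    and p: "\<Gamma> \<turnstile> p \<Colon> Id A x y"
  shows "inh \<Gamma> (Id (Id A y y) (cmp A y p p) (Refl y))"
proof -
  let ?\<Delta> = "Id (wk (wk A)) (Var 1) (Var 0) # wk A # A # \<Gamma>"
  let ?A = "sub (shift 3) A"
  note c = Id_ctx(2)[OF A]
  have A3: "?\<Delta> \<turnstile> ?A \<Colon> Univ u"
    using weaken[OF A c, of "[_, _, _]" 3] by simp
  have v: "?\<Delta> \<turnstile> Var 2 \<Colon> ?A" "?\<Delta> \<turnstile> Var 1 \<Colon> ?A" "?\<Delta> \<turnstile> Var 0 \<Colon> Id ?A (Var 2) (Var 1)"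
    by (rule var_cast[OF c]; simp)+
  have C: "?\<Delta> \<turnstile> Id (Id ?A (Var 1) (Var 1)) (cmp ?A (Var 1) (Var 0) (Var 0)) (Refl (Var 1)) \<Colon> Univ u"
    by (rule id_form[OF id_form[OF A3 v(2,2)] cmp(1)[OF A3 v(2,1,3,2,3)] id_intro[OF v(2)]])
  have A1: "A # \<Gamma> \<turnstile> wk A \<Colon> Univ u"
    by (rule wk_Univ[OF A A])
  have v1: "A # \<Gamma> \<turnstile> Var 0 \<Colon> wk A"
    by (rule var_cast[OF ctx_ty[OF A]]) simp_all
  note r = id_intro[OF v1]
  have "inh (A # \<Gamma>) (Id (Id (wk A) (Var 0) (Var 0)) (cmp (wk A) (Var 0) (Refl (Var 0)) (Refl (Var 0))) (Refl (Var 0)))"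
    by (rule Id_of_eq[OF id_form[OF A1 v1 v1] cmp(1)[OF A1 v1 v1 r v1 r] cmp(2)[OF A1 v1 v1 r]])
  then show ?thesis
    using inh_J[OF A C _ x y p] by simp
qed

section \<open>Propositions and sums of propositions\<close>

lemma isProp_form: "\<Gamma> \<turnstile> A \<Colon> Univ u \<Longrightarrow> \<Gamma> \<turnstile> IsProp A \<Colon> Univ u"
  using pi_form[OF _ pi_form[OF wk_Univ Id_ctx(1)]] unfolding IsProp_def by fastforce

lemma isProp_intro:
  assumes "\<Gamma> \<turnstile> A \<Colon> Univ u" "inh (wk A # A # \<Gamma>) (Id (wk (wk A)) (Var 1) (Var 0))"
  shows "inh \<Gamma> (IsProp A)"
  unfolding IsProp_def by (rule inh_Lam[OF assms(1) inh_Lam[OF wk_Univ[OF assms(1,1)] assms(2)]])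

lemma isProp_App:
  assumes "\<Gamma> \<turnstile> h \<Colon> IsProp A" "\<Gamma> \<turnstile> a \<Colon> A" "\<Gamma> \<turnstile> b \<Colon> A"
  shows "\<Gamma> \<turnstile> App (App h a) b \<Colon> Id A a b"
  using pi_elim[OF pi_elim[OF assms(1)[unfolded IsProp_def] assms(2), simplified] assms(3)] by simp

lemma isProp_elim:
  assumes "inh \<Gamma> (IsProp A)" "\<Gamma> \<turnstile> a \<Colon> A" "\<Gamma> \<turnstile> b \<Colon> A"
  shows "inh \<Gamma> (Id A a b)"
  using assms by (auto simp: inh_def intro: isProp_App)

text \<open>
  Hedberg's argument: with \<open>h x : a = x\<close>, every path \<open>p : x = y\<close> equals the composite
  of \<open>h x\<close> reversed with \<open>h y\<close>, by \<open>J\<close>.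
\<close>
lemma isProp_isSet:
  assumes A: "\<Gamma> \<turnstile> A \<Colon> Univ u" and h: "inh \<Gamma> (IsProp A)"
    and x: "\<Gamma> \<turnstile> x \<Colon> A" and y: "\<Gamma> \<turnstile> y \<Colon> A"
    and p: "\<Gamma> \<turnstile> p \<Colon> Id A x y" and q: "\<Gamma> \<turnstile> q \<Colon> Id A x y"
  shows "inh \<Gamma> (Id (Id A x y) p q)"
proof -
  obtain h where h: "\<Gamma> \<turnstile> h \<Colon> IsProp A"
    using h by (rule inhE)
  let ?\<Delta> = "Id (wk (wk A)) (Var 1) (Var 0) # wk A # A # \<Gamma>"
  let ?A = "sub (shift 3) A" and ?x = "sub (shift 3) x" and ?h = "App (App (sub (shift 3) h) (sub (shift 3) x))"
  let ?w = "cmp A y (App (App h x) x) (App (App h x) y)"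
  note c = Id_ctx(2)[OF A]
  have A3: "?\<Delta> \<turnstile> ?A \<Colon> Univ u" and x3: "?\<Delta> \<turnstile> ?x \<Colon> ?A"
    using weaken[OF A c, of "[_, _, _]" 3] weaken[OF x c, of "[_, _, _]" 3] by simp_all
  have v: "?\<Delta> \<turnstile> Var 2 \<Colon> ?A" "?\<Delta> \<turnstile> Var 1 \<Colon> ?A" "?\<Delta> \<turnstile> Var 0 \<Colon> Id ?A (Var 2) (Var 1)"
    by (rule var_cast[OF c]; simp)+
  have h3: "?\<Delta> \<turnstile> ?h (Var 2) \<Colon> Id ?A ?x (Var 2)" "?\<Delta> \<turnstile> ?h (Var 1) \<Colon> Id ?A ?x (Var 1)"
    using isProp_App[OF _ x3 v(1)] isProp_App[OF _ x3 v(2)] weaken[OF h c, of "[_, _, _]" 3] by simp_all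
  have C: "?\<Delta> \<turnstile> Id (Id ?A (Var 2) (Var 1)) (cmp ?A (Var 1) (?h (Var 2)) (?h (Var 1))) (Var 0) \<Colon> Univ u"
    by (rule id_form[OF id_form[OF A3 v(1,2)] cmp(1)[OF A3 v(2) x3 h3(2) v(1) h3(1)] v(3)])
  have A1: "A # \<Gamma> \<turnstile> wk A \<Colon> Univ u" and x1: "A # \<Gamma> \<turnstile> wk x \<Colon> wk A"
    by (rule wk_Univ[OF A A], rule wk_ty[OF A x])
  have v1: "A # \<Gamma> \<turnstile> Var 0 \<Colon> wk A"
    by (rule var_cast[OF ctx_ty[OF A]]) simp_all
  have h1: "A # \<Gamma> \<turnstile> App (App (wk h) (wk x)) (Var 0) \<Colon> Id (wk A) (wk x) (Var 0)"
    using isProp_App[OF _ x1 v1] wk_ty[OF A h] by simp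
  have h0: "\<Gamma> \<turnstile> App (App h x) b \<Colon> Id A x b" if "\<Gamma> \<turnstile> b \<Colon> A" for b
    by (rule isProp_App[OF h x that])
  have w: "inh \<Gamma> (Id (Id A x y) ?w p)" if "\<Gamma> \<turnstile> p \<Colon> Id A x y" for p
    using inh_J[OF A C _ x y that] inh_cmp_self[OF A1 x1 v1 h1] by simp
  note I = id_form[OF A x y]
  have t: "\<Gamma> \<turnstile> ?w \<Colon> Id A x y"
    by (rule cmp(1)[OF A y x h0[OF y] x h0[OF x]])
  show ?thesis
    by (rule inh_trans[OF I p t q inh_sym[OF I t p w[OF p]] w[OF q]])
qed

lemma isProp_Id:
  assumes A: "\<Gamma> \<turnstile> A \<Colon> Univ u" and h: "inh \<Gamma> (IsProp A)"
    and x: "\<Gamma> \<turnstile> x \<Colon> A" and y: "\<Gamma> \<turnstile> y \<Colon> A"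
  shows "inh \<Gamma> (IsProp (Id A x y))"
proof (rule isProp_intro)
  show I: "\<Gamma> \<turnstile> Id A x y \<Colon> Univ u"
    by (rule id_form[OF A x y])
  let ?\<Delta> = "wk (Id A x y) # Id A x y # \<Gamma>"
  note I1 = wk_Univ[OF I I]
  note c = ctx_ty[OF I1]
  have "?\<Delta> \<turnstile> sub (shift 2) A \<Colon> Univ u" "inh ?\<Delta> (IsProp (sub (shift 2) A))"
    "?\<Delta> \<turnstile> sub (shift 2) x \<Colon> sub (shift 2) A" "?\<Delta> \<turnstile> sub (shift 2) y \<Colon> sub (shift 2) A"
    using wk_Univ[OF I1 wk_Univ[OF I A]] inh_wk[OF I1 inh_wk[OF I h]]
      wk_ty[OF I1 wk_ty[OF I x]] wk_ty[OF I1 wk_ty[OF I y]] by simp_all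
  from isProp_isSet[OF this var_cast[OF c, of 1] var_cast[OF c, of 0]]
  show "inh ?\<Delta> (Id (wk (wk (Id A x y))) (Var 1) (Var 0))"
    by simp
qed

text \<open>Paths over a path are avoided by transporting a quantified statement: every
  \<open>y\<close> over the moving point \<open>x\<close> makes \<open>(a, b)\<close> equal to
  \<open>(x, y)\<close>. At \<open>x = a\<close> only the second component varies, within a
  proposition; at \<open>x = a'\<close> the statement is applied to \<open>b'\<close>.\<close>

lemma sg_prop_eq:
  assumes A: "\<Gamma> \<turnstile> A \<Colon> Univ u" and B: "A # \<Gamma> \<turnstile> B \<Colon> Univ v"
    and hB: "inh (A # \<Gamma>) (IsProp B)"
    and a: "\<Gamma> \<turnstile> a \<Colon> A" and a': "\<Gamma> \<turnstile> a' \<Colon> A" and p: "inh \<Gamma> (Id A a a')"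
    and b: "\<Gamma> \<turnstile> b \<Colon> sub (a \<bullet> Var) B" and b': "\<Gamma> \<turnstile> b' \<Colon> sub (a' \<bullet> Var) B"
  shows "inh \<Gamma> (Id (Sg A B) (Pr B a b) (Pr B a' b'))"
proof -
  note Sg = sg_form[OF A B] and P = sg_intro[OF B a b]
  let ?C = "Pi B (Id (sub (shift 2) (Sg A B)) (sub (shift 2) (Pr B a b)) (Pr (sub (Var 0 \<bullet> shift 3) B) (Var 1) (Var 0)))"
  have cB: "B # A # \<Gamma> ctx"
    by (rule ctx_ty[OF B])
  have C: "A # \<Gamma> \<turnstile> ?C \<Colon> Univ (sup v (sup u v))"
    using pi_form[OF B id_form[OF _ _ sg_ctx[OF A B]]]
      weaken[OF Sg cB, of "[_, _]" 2] weaken[OF P cB, of "[_, _]" 2] by simp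
  note Ba = inst_Univ[OF B a]
  let ?\<Gamma> = "sub (a \<bullet> Var) B # \<Gamma>"
  have c: "?\<Gamma> ctx"
    by (rule ctx_ty[OF Ba])
  have hBa: "inh \<Gamma> (IsProp (sub (a \<bullet> Var) B))"
    using inh_App[OF inh_Lam[OF A hB] a] by simp
  have Ba1: "?\<Gamma> \<turnstile> wk (sub (a \<bullet> Var) B) \<Colon> Univ v"
    by (rule wk_Univ[OF Ba Ba])
  have v0: "?\<Gamma> \<turnstile> Var 0 \<Colon> wk (sub (a \<bullet> Var) B)"
    by (rule var_cast[OF c]) simp_all
  note b1 = wk_ty[OF Ba b]
  have e: "inh ?\<Gamma> (Id (wk (sub (a \<bullet> Var) B)) (wk b) (Var 0))"
    using isProp_elim[OF _ b1 v0] inh_wk[OF Ba hBa] by simp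
  have c2: "wk (sub (a \<bullet> Var) B) # ?\<Gamma> ctx"
    by (rule ctx_ty[OF Ba1])
  have B3: "sub (shift 2) A # wk (sub (a \<bullet> Var) B) # ?\<Gamma> \<turnstile> sub (Var 0 \<bullet> shift 3) B \<Colon> Univ v"
    using inst_shift[OF B var_cast, of "sub (shift 2) A # wk (sub (a \<bullet> Var) B) # ?\<Gamma>" 0 3 "[_, _, _]"]
      weaken[OF A c2, of "[_, _]" 2] by (simp add: ctx_ty)
  have t: "wk (sub (a \<bullet> Var) B) # ?\<Gamma> \<turnstile>
      Pr (sub (Var 0 \<bullet> shift 3) B) (sub (shift 2) a) (Var 0) \<Colon> wk (wk (Sg A B))"
    using sg_intro[OF B3 weaken[OF a c2, of "[_, _]" 2], where b = "Var 0"] var_cast[OF c2, of 0] by simp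
  have "inh ?\<Gamma> (Id (wk (Sg A B)) (wk (Pr B a b)) (Pr (sub (Var 0 \<bullet> shift 2) B) (wk a) (Var 0)))"
    using inh_ap[OF Ba1 wk_Univ[OF Ba Sg] t b1 v0 e] by simp
  then have "inh \<Gamma> (sub (a \<bullet> Var) ?C)"
    using inh_Lam[OF Ba] by simp
  from inh_App[OF inh_transport[OF A C a a' p this, unfolded sub.simps] b'] show ?thesis
    by simp
qed

text \<open>In place of a uniqueness rule for pairs: the variable ranging over the sum is eliminated
  by \<open>Split\<close>, which leaves the generic pair.\<close>

lemma inh_Pi_Sg:
  assumes A: "\<Gamma> \<turnstile> A \<Colon> Univ u" and B: "A # \<Gamma> \<turnstile> B \<Colon> Univ v"
    and C: "Sg A B # \<Gamma> \<turnstile> C \<Colon> Univ w"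
    and d: "inh (B # A # \<Gamma>) (sub (Pr (sub (Var 0 \<bullet> shift 3) B) (Var 1) (Var 0) \<bullet> shift 2) C)"
  shows "inh \<Gamma> (Pi (Sg A B) C)"
proof -
  note Sg = sg_form[OF A B]
  let ?\<Gamma> = "Sg A B # \<Gamma>"
  note A1 = wk_Univ[OF Sg A]
  have B1: "wk A # ?\<Gamma> \<turnstile> sub (Var 0 \<bullet> shift 2) B \<Colon> Univ v"
    using inst_shift[OF B var_cast[OF ctx_ty[OF A1]], of 0 2 "[_, _]"] by simp
  have S1: "?\<Gamma> \<turnstile> wk (Sg A B) \<Colon> Univ (sup u v)"
    by (rule wk_Univ[OF Sg Sg])
  have C1: "Sg (wk A) (sub (Var 0 \<bullet> shift 2) B) # ?\<Gamma> \<turnstile> sub (Var 0 \<bullet> shift 2) C \<Colon> Univ w"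
    using inst_shift[OF C var_cast[OF ctx_ty[OF S1]], of 0 2 "[_, _]"] by simp
  note c = ctx_ty[OF B1]
  \<comment> \<open>The branch was given over \<open>\<Gamma>\<close> but is used below the variable
    of the sum, which this substitution skips.\<close>
  have s: "wf_sub S (B # A # \<Gamma>) (sub (Var 0 \<bullet> shift 2) B # wk A # ?\<Gamma>) (Var 0 \<bullet> Var 1 \<bullet> shift 3)"
    by (rule wf_sub_scons[OF var_cast[OF c] wf_sub_scons[OF var_cast[OF c] wf_sub_shift[OF c, of "[_, _, _]"]]])
      simp_all
  obtain t where t: "B # A # \<Gamma> \<turnstile> t \<Colon> sub (Pr (sub (Var 0 \<bullet> shift 3) B) (Var 1) (Var 0) \<bullet> shift 2) C"
    using d by (rule inhE)
  have "inh ?\<Gamma> (sub (Var 0 \<bullet> Var) (sub (Var 0 \<bullet> shift 2) C))"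
    by (rule inh_Split[OF C1 inhI])
      (use substitute(1)[OF s c t] var_cast[OF ctx_ty[OF Sg], of 0] in simp_all)
  then have "inh ?\<Gamma> C"
    by simp
  then show ?thesis
    by (rule inh_Lam[OF Sg])
qed

text \<open>Both arguments are replaced by generic pairs, one quantifier at a time. The variables 3
  and 2 are then the components of the first pair, 1 and 0 those of the second.\<close>

lemma isProp_Sg:
  assumes A: "\<Gamma> \<turnstile> A \<Colon> Univ u" and B: "A # \<Gamma> \<turnstile> B \<Colon> Univ v"
    and hA: "inh \<Gamma> (IsProp A)" and hB: "inh (A # \<Gamma>) (IsProp B)"
  shows "inh \<Gamma> (IsProp (Sg A B))"
proof -
  note Sg = sg_form[OF A B]
  let ?\<Gamma> = "B # A # \<Gamma>"
  let ?A = "sub (shift 2) A" and ?B = "sub (Var 0 \<bullet> shift 3) B"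
  note c = ctx_ty[OF B]
  have A': "?\<Gamma> \<turnstile> ?A \<Colon> Univ u"
    using weaken[OF A c, of "[_, _]" 2] by simp
  have B': "?A # ?\<Gamma> \<turnstile> ?B \<Colon> Univ v"
    using inst_shift[OF B var_cast[OF ctx_ty[OF A']], of 0 3 "[_, _, _]"] by simp
  note Sg' = sg_form[OF A' B']
  let ?P = "Pr ?B (Var 1) (Var 0)"
  have P: "?\<Gamma> \<turnstile> ?P \<Colon> Sg ?A ?B"
    using sg_ctx[OF A B] by simp
  let ?I = "Id (wk (Sg ?A ?B)) (wk ?P) (Var 0)"
  have I: "Sg ?A ?B # ?\<Gamma> \<turnstile> ?I \<Colon> Univ (sup u v)"
    by (rule id_form[OF wk_Univ[OF Sg' Sg'] wk_ty[OF Sg' P] var_cast[OF ctx_ty[OF Sg']]]) simp_all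
  let ?\<Delta> = "?B # ?A # ?\<Gamma>"
  note d = ctx_ty[OF B']
  have A4: "?\<Delta> \<turnstile> sub (shift 4) A \<Colon> Univ u"
    using weaken[OF A d, of "[_, _, _, _]" 4] by simp
  have s: "wf_sub S (A # \<Gamma>) (sub (shift 4) A # ?\<Delta>) (Var 0 \<bullet> shift 5)"
    by (rule wf_sub_scons[OF var_cast[OF ctx_ty[OF A4]] wf_sub_shift[OF ctx_ty[OF A4], of "[_, _, _, _, _]"]]) simp_all
  have B4: "sub (shift 4) A # ?\<Delta> \<turnstile> sub (Var 0 \<bullet> shift 5) B \<Colon> Univ v"
    using substitute(1)[OF s ctx_ty[OF A4] B] by simp
  have hA4: "inh ?\<Delta> (IsProp (sub (shift 4) A))"
    using inh_weaken[OF hA d, of "[_, _, _, _]" 4] by simp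
  have hB4: "inh (sub (shift 4) A # ?\<Delta>) (IsProp (sub (Var 0 \<bullet> shift 5) B))"
    using inh_substitute[OF s ctx_ty[OF A4] hB] by simp
  have v: "?\<Delta> \<turnstile> Var 3 \<Colon> sub (shift 4) A" "?\<Delta> \<turnstile> Var 1 \<Colon> sub (shift 4) A"
    "?\<Delta> \<turnstile> Var 2 \<Colon> sub (Var 3 \<bullet> Var) (sub (Var 0 \<bullet> shift 5) B)"
    "?\<Delta> \<turnstile> Var 0 \<Colon> sub (Var 1 \<bullet> Var) (sub (Var 0 \<bullet> shift 5) B)"
    by (rule var_cast[OF d]; simp)+
  from sg_prop_eq[OF A4 B4 hB4 v(1,2) isProp_elim[OF hA4 v(1,2)] v(3,4)]
  have "inh ?\<Gamma> (Pi (Sg ?A ?B) ?I)"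
    by (intro inh_Pi_Sg[OF A' B' I]) simp
  moreover have "Sg A B # \<Gamma> \<turnstile> Pi (wk (Sg A B)) (Id (wk (wk (Sg A B))) (Var 1) (Var 0)) \<Colon> Univ (sup u v)"
    using pi_form[OF wk_Univ[OF Sg Sg] Id_ctx(1)[OF Sg]] by simp
  ultimately show ?thesis
    unfolding IsProp_def by (intro inh_Pi_Sg[OF A B]) simp_all
qed

section \<open>Fibers and the unit type\<close>

lemma fiber_family:
  assumes X: "\<Gamma> \<turnstile> X \<Colon> Univ u" and Y: "\<Gamma> \<turnstile> Y \<Colon> Univ v"
    and f: "\<Gamma> \<turnstile> f \<Colon> Arr X Y" and y: "\<Gamma> \<turnstile> y \<Colon> Y"
  shows "X # \<Gamma> \<turnstile> Id (wk Y) (App (wk f) (Var 0)) (wk y) \<Colon> Univ v"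
proof (rule id_form[OF wk_Univ[OF X Y] _ wk_ty[OF X y]])
  have "X # \<Gamma> \<turnstile> wk f \<Colon> Arr (wk X) (wk Y)"
    using wk_ty[OF X f] by simp
  from arr_elim[OF this var_cast[OF ctx_ty[OF X], of 0]]
  show "X # \<Gamma> \<turnstile> App (wk f) (Var 0) \<Colon> wk Y"
    by simp
qed

lemma fiber_form:
  assumes "\<Gamma> \<turnstile> X \<Colon> Univ u" "\<Gamma> \<turnstile> Y \<Colon> Univ v" "\<Gamma> \<turnstile> f \<Colon> Arr X Y" "\<Gamma> \<turnstile> y \<Colon> Y"
  shows "\<Gamma> \<turnstile> Fiber X Y f y \<Colon> Univ (sup u v)"
  unfolding Fiber_def by (rule sg_form[OF assms(1) fiber_family[OF assms]])

text \<open>The fiber is a sum of identity types of a proposition, indexed by a proposition. This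
  serves both for the map into the unit type and for contractibility, which is encoded as a
  fiber.\<close>

lemma isProp_Fiber:
  assumes X: "\<Gamma> \<turnstile> X \<Colon> Univ u" and Y: "\<Gamma> \<turnstile> Y \<Colon> Univ v"
    and f: "\<Gamma> \<turnstile> f \<Colon> Arr X Y" and y: "\<Gamma> \<turnstile> y \<Colon> Y"
    and hX: "inh \<Gamma> (IsProp X)" and hY: "inh \<Gamma> (IsProp Y)"
  shows "inh \<Gamma> (IsProp (Fiber X Y f y))"
  unfolding Fiber_def
proof (rule isProp_Sg[OF X fiber_family[OF X Y f y] hX])
  have "X # \<Gamma> \<turnstile> wk f \<Colon> Arr (wk X) (wk Y)"
    using wk_ty[OF X f] by simp
  from arr_elim[OF this var_cast[OF ctx_ty[OF X], of 0]]
  have "X # \<Gamma> \<turnstile> App (wk f) (Var 0) \<Colon> wk Y"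
    by simp
  moreover have "inh (X # \<Gamma>) (IsProp (wk Y))"
    using inh_wk[OF X hY] by simp
  ultimately show "inh (X # \<Gamma>) (IsProp (Id (wk Y) (App (wk f) (Var 0)) (wk y)))"
    using isProp_Id[OF wk_Univ[OF X Y] _ _ wk_ty[OF X y]] by blast
qed

lemma inh_Star_eq:
  assumes "\<Gamma> \<turnstile> x \<Colon> One u"
  shows "inh \<Gamma> (Id (One u) (Star u) x)"
proof -
  note c = has_type_ctx(2)[OF assms]
  have c1: "One u # \<Gamma> ctx"
    by (rule ctx_ty[OF one_form[OF c]])
  have v: "One u # \<Gamma> \<turnstile> Var 0 \<Colon> One u"
    by (rule var_cast[OF c1]) simp_all
  show ?thesis
    using one_elim[OF id_form[OF one_form[OF c1] one_intro[OF c1] v] _ assms] id_intro[OF one_intro[OF c]]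
    by (auto simp: inh_def)
qed

lemma isProp_One:
  assumes "\<Gamma> ctx"
  shows "inh \<Gamma> (IsProp (One u))"
proof (rule isProp_intro[OF one_form[OF assms]])
  have O1: "One u # \<Gamma> \<turnstile> One u \<Colon> Univ u"
    by (rule one_form[OF ctx_ty[OF one_form[OF assms]]])
  note c = ctx_ty[OF O1]
  have v: "One u # One u # \<Gamma> \<turnstile> Var 1 \<Colon> One u" "One u # One u # \<Gamma> \<turnstile> Var 0 \<Colon> One u"
    by (rule var_cast[OF c]; simp)+
  note O = one_form[OF c] and st = one_intro[OF c]
  show "inh (wk (One u) # One u # \<Gamma>) (Id (wk (wk (One u))) (Var 1) (Var 0))"
    using inh_trans[OF O v(1) st v(2) inh_sym[OF O st v(1) inh_Star_eq[OF v(1)]] inh_Star_eq[OF v(2)]] by simp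
qed

section \<open>Equivalences and univalence\<close>

lemma Fst_cong:
  assumes A: "\<Gamma> \<turnstile> A \<Colon> Univ u" and B: "A # \<Gamma> \<turnstile> B \<Colon> Univ v"
    and p: "\<Gamma> \<turnstile> p \<doteq> q \<Colon> Sg A B"
  shows "\<Gamma> \<turnstile> Fst A p \<doteq> Fst A q \<Colon> A"
proof -
  have A1: "Sg A B # \<Gamma> \<turnstile> wk A \<Colon> Univ u"
    by (rule wk_Univ[OF sg_form[OF A B] A])
  have d: "B # A # \<Gamma> \<turnstile> Var 1 \<Colon> sub (Pr (sub (Var 0 \<bullet> shift 3) B) (Var 1) (Var 0) \<bullet> shift 2) (wk A)"
    by (rule var_cast[OF ctx_ty[OF B]]) simp_all
  show ?thesis
    using split_cong[unfolded fold_shift, OF A1 eq_refl[OF A1] eq_refl[OF d] p] by (simp add: Fst_def)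
qed

lemma leftInv_body:
  assumes A: "\<Gamma> \<turnstile> A \<Colon> Univ u"
    and f: "\<Gamma> \<turnstile> f \<Colon> Arr A B" and g: "\<Gamma> \<turnstile> g \<Colon> Arr B A"
  shows "A # \<Gamma> \<turnstile> Id (wk A) (App (wk g) (App (wk f) (Var 0))) (Var 0) \<Colon> Univ u"
proof -
  have f1: "A # \<Gamma> \<turnstile> wk f \<Colon> Arr (wk A) (wk B)" and g1: "A # \<Gamma> \<turnstile> wk g \<Colon> Arr (wk B) (wk A)"
    using wk_ty[OF A f] wk_ty[OF A g] by simp_all
  have v: "A # \<Gamma> \<turnstile> Var 0 \<Colon> wk A"
    by (rule var_cast[OF ctx_ty[OF A]]) simp_all
  show ?thesis
    by (rule id_form[OF wk_Univ[OF A A] arr_elim[OF g1 arr_elim[OF f1 v]] v])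
qed

lemma leftInv_App:
  assumes "inh \<Gamma> (LeftInv A f g)" "\<Gamma> \<turnstile> a \<Colon> A"
  shows "inh \<Gamma> (Id A (App g (App f a)) a)"
  using inh_App[OF assms(1)[unfolded LeftInv_def] assms(2)] by simp

lemma leftInv_form:
  assumes A: "\<Gamma> \<turnstile> A \<Colon> Univ u"
    and f: "\<Gamma> \<turnstile> f \<Colon> Arr A B" and g: "\<Gamma> \<turnstile> g \<Colon> Arr B A"
  shows "\<Gamma> \<turnstile> LeftInv A f g \<Colon> Univ u"
  unfolding LeftInv_def using pi_form[OF A leftInv_body[OF A f g]] by simp

lemma sections_form:
  assumes A: "\<Gamma> \<turnstile> A \<Colon> Univ u" and B: "\<Gamma> \<turnstile> B \<Colon> Univ v" and f: "\<Gamma> \<turnstile> f \<Colon> Arr A B"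
  shows "Arr B A # \<Gamma> \<turnstile> LeftInv (wk B) (Var 0) (wk f) \<Colon> Univ v"
    and "Arr B A # \<Gamma> \<turnstile> LeftInv (wk A) (wk f) (Var 0) \<Colon> Univ u"
proof -
  note F = arr_form[OF B A]
  have v: "Arr B A # \<Gamma> \<turnstile> Var 0 \<Colon> Arr (wk B) (wk A)"
    by (rule var_cast[OF ctx_ty[OF F]]) simp_all
  have f1: "Arr B A # \<Gamma> \<turnstile> wk f \<Colon> Arr (wk A) (wk B)"
    using wk_ty[OF F f] by simp
  show "Arr B A # \<Gamma> \<turnstile> LeftInv (wk B) (Var 0) (wk f) \<Colon> Univ v"
    by (rule leftInv_form[OF wk_Univ[OF F B] v f1])
  show "Arr B A # \<Gamma> \<turnstile> LeftInv (wk A) (wk f) (Var 0) \<Colon> Univ u"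
    by (rule leftInv_form[OF wk_Univ[OF F A] f1 v])
qed

lemma isEquiv_form:
  assumes "\<Gamma> \<turnstile> A \<Colon> Univ u" "\<Gamma> \<turnstile> B \<Colon> Univ v" "\<Gamma> \<turnstile> f \<Colon> Arr A B"
  shows "\<Gamma> \<turnstile> IsEquiv A B f \<Colon> Univ (sup u v)"
  using times_form[OF sg_form[OF arr_form[OF assms(2,1)] sections_form(1)[OF assms]]
      sg_form[OF arr_form[OF assms(2,1)] sections_form(2)[OF assms]]]
  by (simp add: IsEquiv_def sup_aci del: wk_eq)

lemma isEquiv_family:
  assumes "\<Gamma> \<turnstile> A \<Colon> Univ u" "\<Gamma> \<turnstile> B \<Colon> Univ v"
  shows "Arr A B # \<Gamma> \<turnstile> IsEquiv (wk A) (wk B) (Var 0) \<Colon> Univ (sup u v)"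
proof -
  note F = arr_form[OF assms]
  show ?thesis
    by (rule isEquiv_form[OF wk_Univ[OF F assms(1)] wk_Univ[OF F assms(2)] var_cast[OF ctx_ty[OF F]]]) simp_all
qed

lemma equiv_form:
  assumes "\<Gamma> \<turnstile> A \<Colon> Univ u" "\<Gamma> \<turnstile> B \<Colon> Univ v"
  shows "\<Gamma> \<turnstile> Equiv A B \<Colon> Univ (sup u v)"
  unfolding Equiv_def using sg_form[OF arr_form[OF assms] isEquiv_family[OF assms]] by (simp add: sup_aci)

text \<open>One two-sided inverse serves as the section and as the retraction.\<close>

lemma inh_isEquiv:
  assumes A: "\<Gamma> \<turnstile> A \<Colon> Univ u" and B: "\<Gamma> \<turnstile> B \<Colon> Univ v"
    and f: "\<Gamma> \<turnstile> f \<Colon> Arr A B" and g: "\<Gamma> \<turnstile> g \<Colon> Arr B A"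
    and "inh \<Gamma> (LeftInv B g f)" "inh \<Gamma> (LeftInv A f g)"
  shows "inh \<Gamma> (IsEquiv A B f)"
proof -
  note F = arr_form[OF B A] and sec = sections_form[OF A B f]
  have "inh \<Gamma> (Sg (Arr B A) (LeftInv (wk B) (Var 0) (wk f)))"
    by (rule inh_Pr[OF sec(1) g]) (use assms(5) in simp)
  moreover have "inh \<Gamma> (Sg (Arr B A) (LeftInv (wk A) (wk f) (Var 0)))"
    by (rule inh_Pr[OF sec(2) g]) (use assms(6) in simp)
  ultimately show ?thesis
    unfolding IsEquiv_def by (rule inh_Times[OF sg_form[OF F sec(1)] sg_form[OF F sec(2)]])
qed

text \<open>The identity law holds by computation at every point, so reflexivity paths serve as both
  homotopies. The judgmental equation for the underlying map is what later starts the induction on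
  equivalences.\<close>

lemma idEquiv:
  assumes A: "\<Gamma> \<turnstile> A \<Colon> Univ u"
  shows "\<Gamma> \<turnstile> IdEquiv A \<Colon> Equiv A A"
    and "\<Gamma> \<turnstile> Fst (Arr A A) (IdEquiv A) \<doteq> Lam A (Var 0) \<Colon> Arr A A"
proof -
  let ?i = "Lam A (Var 0)" and ?h = "Lam A (Refl (Var 0))"
  let ?P = "LeftInv (wk A) (Var 0) (wk ?i)" and ?Q = "LeftInv (wk A) (wk ?i) (Var 0)"
  let ?e = "Pr (wk (Sg (Arr A A) ?Q)) (Pr ?P ?i ?h) (Pr ?Q ?i ?h)"
  have v: "A # \<Gamma> \<turnstile> Var 0 \<Colon> wk A"
    by (rule var_cast[OF ctx_ty[OF A]]) simp_all
  note i = arr_intro[OF A v] and F = arr_form[OF A A]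
  have i1: "A # \<Gamma> \<turnstile> wk ?i \<Colon> Arr (wk A) (wk A)"
    using wk_ty[OF A i] by simp
  note A1 = wk_Univ[OF A A]
  have A2: "wk A # A # \<Gamma> \<turnstile> Var 0 \<Colon> wk (wk A)"
    by (rule var_cast[OF ctx_ty[OF A1]]) simp_all
  have b: "A # \<Gamma> \<turnstile> App (wk ?i) a \<doteq> a \<Colon> wk A" if "A # \<Gamma> \<turnstile> a \<Colon> wk A" for a
    using arr_beta[OF A1 A2 that] by simp
  have "A # \<Gamma> \<turnstile> App (wk ?i) (App (wk ?i) (Var 0)) \<doteq> Var 0 \<Colon> wk A"
    by (rule eq_trans[OF b[OF arr_elim[OF i1 v]] b[OF v]])
  from conv[OF id_intro[OF v] id_cong[OF eq_refl[OF A1] eq_sym[OF this] eq_refl[OF v]]]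
  have h: "\<Gamma> \<turnstile> ?h \<Colon> LeftInv A ?i ?i"
    unfolding LeftInv_def by (rule pi_intro[OF A])
  note sec = sections_form[OF A A i]
  have P: "\<Gamma> \<turnstile> Pr ?P ?i ?h \<Colon> Sg (Arr A A) ?P" and Q: "\<Gamma> \<turnstile> Pr ?Q ?i ?h \<Colon> Sg (Arr A A) ?Q"
    by (rule sg_intro[OF sec(1) i] sg_intro[OF sec(2) i], use h in simp)+
  have "\<Gamma> \<turnstile> ?e \<Colon> IsEquiv A A ?i"
    unfolding IsEquiv_def Times_def
    by (rule sg_intro[OF wk_Univ[OF sg_form[OF F sec(1)] sg_form[OF F sec(2)]] P]) (use Q in simp)
  then have e': "\<Gamma> \<turnstile> ?e \<Colon> sub (?i \<bullet> Var) (IsEquiv (wk A) (wk A) (Var 0))"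
    by simp
  show "\<Gamma> \<turnstile> IdEquiv A \<Colon> Equiv A A"
    unfolding IdEquiv_def Equiv_def Let_def by (rule sg_intro[OF isEquiv_family[OF A A] i e'])
  show "\<Gamma> \<turnstile> Fst (Arr A A) (IdEquiv A) \<doteq> ?i \<Colon> Arr A A"
    unfolding IdEquiv_def Let_def by (rule Fst(2)[OF F isEquiv_family[OF A A] i e'])
qed

text \<open>The value at a reflexivity path arises by beta for the outer abstraction and then for
  \<open>J\<close>.\<close>

lemma idToEquiv:
  assumes A: "\<Gamma> \<turnstile> A \<Colon> Univ u"
  shows "\<Gamma> \<turnstile> B \<Colon> Univ u \<Longrightarrow> \<Gamma> \<turnstile> IdToEquiv u A B \<Colon> Arr (Id (Univ u) A B) (Equiv A B)"
    and "\<Gamma> \<turnstile> App (IdToEquiv u A A) (Refl A) \<doteq> IdEquiv A \<Colon> Equiv A A"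
proof -
  have J: "Id (wk (wk (Univ u))) (Var 1) (Var 0) # wk (Univ u) # Univ u # \<Delta> \<turnstile> Equiv (Var 2) (Var 1) \<Colon> Univ u"
    "Univ u # \<Delta> \<turnstile> IdEquiv (Var 0) \<Colon> sub (Refl (Var 0) \<bullet> Var 0 \<bullet> Var 0 \<bullet> shift 1) (Equiv (Var 2) (Var 1))"
    if "\<Delta> ctx" for \<Delta>
  proof -
    note U = univ[OF that, of u]
    note c = Id_ctx(2)[OF U]
    show "Id (wk (wk (Univ u))) (Var 1) (Var 0) # wk (Univ u) # Univ u # \<Delta> \<turnstile> Equiv (Var 2) (Var 1) \<Colon> Univ u"
      using equiv_form[OF var_cast[OF c, of 2] var_cast[OF c, of 1]] by simp
    show "Univ u # \<Delta> \<turnstile> IdEquiv (Var 0) \<Colon> sub (Refl (Var 0) \<bullet> Var 0 \<bullet> Var 0 \<bullet> shift 1) (Equiv (Var 2) (Var 1))"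
      using idEquiv(1)[OF var_cast[OF ctx_ty[OF U], of 0]] by simp
  qed
  have body: "Id (Univ u) A B # \<Gamma> \<turnstile> J (Equiv (Var 2) (Var 1)) (IdEquiv (Var 0)) (Var 0) \<Colon> wk (Equiv A B)"
    and I: "\<Gamma> \<turnstile> Id (Univ u) A B \<Colon> Univ (usuc u)"
    if B: "\<Gamma> \<turnstile> B \<Colon> Univ u" for B
  proof -
    show I: "\<Gamma> \<turnstile> Id (Univ u) A B \<Colon> Univ (usuc u)"
      by (rule id_form[OF univ[OF has_type_ctx(2)[OF A]] A B])
    note c = ctx_ty[OF I]
    have "Id (Univ u) A B # \<Gamma> \<turnstile> Var 0 \<Colon> Id (Univ u) (wk A) (wk B)"
      by (rule var_cast[OF c]) simp_all
    from id_elim[unfolded fold_shift, OF J[OF c] wk_Univ[OF I A] wk_Univ[OF I B] this]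
    show "Id (Univ u) A B # \<Gamma> \<turnstile> J (Equiv (Var 2) (Var 1)) (IdEquiv (Var 0)) (Var 0) \<Colon> wk (Equiv A B)"
      by simp
  qed
  show "\<Gamma> \<turnstile> B \<Colon> Univ u \<Longrightarrow> \<Gamma> \<turnstile> IdToEquiv u A B \<Colon> Arr (Id (Univ u) A B) (Equiv A B)"
    unfolding IdToEquiv_def by (rule arr_intro[OF I body])
  have "\<Gamma> \<turnstile> App (IdToEquiv u A A) (Refl A) \<doteq> J (Equiv (Var 2) (Var 1)) (IdEquiv (Var 0)) (Refl A) \<Colon> Equiv A A"
    using arr_beta[OF I[OF A] body[OF A] id_intro[OF A]] by (simp add: IdToEquiv_def)
  moreover have "\<Gamma> \<turnstile> J (Equiv (Var 2) (Var 1)) (IdEquiv (Var 0)) (Refl A) \<doteq> IdEquiv A \<Colon> Equiv A A"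
    using id_beta[unfolded fold_shift, OF J[OF has_type_ctx(2)[OF A]] A] by simp
  ultimately show "\<Gamma> \<turnstile> App (IdToEquiv u A A) (Refl A) \<doteq> IdEquiv A \<Colon> Equiv A A"
    by (rule eq_trans)
qed

text \<open>The section of \<open>IdToEquiv\<close> is applied to \<open>e\<close>. The image of the
  resulting path is \<open>e\<close> only up to identity, so that the induction on equivalences has
  to transport afterwards.\<close>

lemma univalenceE:
  assumes S: "univalence S" and A: "\<Gamma> \<turnstile> A \<Colon> Univ u" and B: "\<Gamma> \<turnstile> B \<Colon> Univ u"
    and e: "\<Gamma> \<turnstile> e \<Colon> Equiv A B"
  obtains p where "\<Gamma> \<turnstile> p \<Colon> Id (Univ u) A B"
    and "inh \<Gamma> (Id (Equiv A B) (App (IdToEquiv u A B) p) e)"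
proof -
  let ?I = "Id (Univ u) A B" and ?E = "Equiv A B" and ?f = "IdToEquiv u A B"
  note c = has_type_ctx(2)[OF A]
  obtain t where "S \<triangleright> [] \<turnstile> t \<Colon> UnivalenceTy u"
    using S unfolding univalence_def by blast
  from weaken_closed[OF this c, unfolded UnivalenceTy_def]
  have t: "\<Gamma> \<turnstile> t \<Colon> Pi (Univ u) (Pi (Univ u)
      (IsEquiv (Id (Univ u) (Var 1) (Var 0)) (Equiv (Var 1) (Var 0)) (IdToEquiv u (Var 1) (Var 0))))" .
  have h: "\<Gamma> \<turnstile> App (App t A) B \<Colon> IsEquiv ?I ?E ?f"
    using pi_elim[OF pi_elim[OF t A, simplified] B] by simp
  note I = id_form[OF univ[OF c] A B] and E = equiv_form[OF A B] and f = idToEquiv(1)[OF A B]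
  note F = arr_form[OF E I] and sec = sections_form[OF I E f]
  let ?P = "Sg (Arr ?E ?I) (LeftInv (wk ?E) (Var 0) (wk ?f))"
  let ?q = "Fst ?P (App (App t A) B)"
  note P = sg_form[OF F sec(1)] and Q = sg_form[OF F sec(2)]
  have q: "\<Gamma> \<turnstile> ?q \<Colon> ?P"
    using Fst(1)[OF P wk_Univ[OF P Q]] h by (simp add: IsEquiv_def Times_def)
  let ?s = "Fst (Arr ?E ?I) ?q"
  have s: "\<Gamma> \<turnstile> ?s \<Colon> Arr ?E ?I"
    by (rule Fst(1)[OF F sec(1) q])
  have "inh \<Gamma> (LeftInv ?E ?s ?f)"
    using inh_Snd[OF F sec(1) q] by simp
  from that[OF arr_elim[OF s e] leftInv_App[OF this e]] show thesis .
qed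

text \<open>Induction on equivalences, for a motive that sees the underlying map. Univalence
  presents the equivalence as the image of a path, and \<open>J\<close> on that path leaves the case
  of the identity map.\<close>

lemma equiv_induct:
  assumes S: "univalence S" and A: "\<Gamma> \<turnstile> A \<Colon> Univ u" and B: "\<Gamma> \<turnstile> B \<Colon> Univ u"
    and f: "\<Gamma> \<turnstile> f \<Colon> Arr A B" and e: "inh \<Gamma> (IsEquiv A B f)"
    and C: "Arr (Var 1) (Var 0) # Univ u # Univ u # \<Gamma> \<turnstile> C \<Colon> Univ w"
    and d: "inh (Univ u # \<Gamma>) (sub (Lam (Var 0) (Var 0) \<bullet> Var 0 \<bullet> Var 0 \<bullet> shift 1) C)"
  shows "inh \<Gamma> (sub (f \<bullet> B \<bullet> A \<bullet> Var) C)"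
proof -
  note c = has_type_ctx(2)[OF A]
  note F = arr_form[OF A B] and W = isEquiv_family[OF A B] and E = equiv_form[OF A B]
  have C': "\<Delta> \<turnstile> sub (g \<bullet> Y \<bullet> X \<bullet> shift n) C \<Colon> Univ w"
    if "\<Delta> \<turnstile> X \<Colon> Univ u" "\<Delta> \<turnstile> Y \<Colon> Univ u" "\<Delta> \<turnstile> g \<Colon> Arr X Y" "\<Delta> = \<Xi> @ \<Gamma>" "length \<Xi> = n"
    for \<Delta> X Y g \<Xi> n
  proof -
    have "wf_sub S (Arr (Var 1) (Var 0) # Univ u # Univ u # \<Gamma>) \<Delta> (g \<bullet> Y \<bullet> X \<bullet> shift n)"
      by (intro wf_sub_scons wf_sub_shift[OF has_type_ctx(2)[OF that(1)] that(4,5)]) (use that in simp_all)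
    from substitute(1)[OF this has_type_ctx(2)[OF that(1)] C] show ?thesis
      by simp
  qed
  note U = univ[OF c, of u]
  let ?\<Delta> = "Id (wk (wk (Univ u))) (Var 1) (Var 0) # wk (Univ u) # Univ u # \<Gamma>"
  note c3 = Id_ctx(2)[OF U]
  have v: "?\<Delta> \<turnstile> Var 2 \<Colon> Univ u" "?\<Delta> \<turnstile> Var 1 \<Colon> Univ u" "?\<Delta> \<turnstile> Var 0 \<Colon> Id (Univ u) (Var 2) (Var 1)"
    by (rule var_cast[OF c3]; simp)+
  \<comment> \<open>In the motive for \<open>J\<close>, the map that a path induces between its
    endpoints takes the place of \<open>f\<close>.\<close>
  let ?g = "Fst (Arr (Var 2) (Var 1)) (App (IdToEquiv u (Var 2) (Var 1)) (Var 0))"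
  have g: "?\<Delta> \<turnstile> ?g \<Colon> Arr (Var 2) (Var 1)"
    by (rule Fst(1)[OF arr_form[OF v(1,2)] isEquiv_family[OF v(1,2)]])
      (use arr_elim[OF idToEquiv(1)[OF v(1,2)] v(3)] in \<open>simp add: Equiv_def\<close>)
  have J: "?\<Delta> \<turnstile> sub (?g \<bullet> Var 1 \<bullet> Var 2 \<bullet> shift 3) C \<Colon> Univ w"
    by (rule C'[OF v(1,2) g, of "[_, _, _]"]) simp_all

  have c1: "Univ u # \<Gamma> ctx"
    by (rule ctx_ty[OF U])
  have v1: "Univ u # \<Gamma> \<turnstile> Var 0 \<Colon> Univ u"
    by (rule var_cast[OF c1]) simp_all
  let ?g1 = "Fst (Arr (Var 0) (Var 0)) (App (IdToEquiv u (Var 0) (Var 0)) (Refl (Var 0)))"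
  note F1 = arr_form[OF v1 v1]
  have t1: "Univ u # \<Gamma> \<turnstile> App (IdToEquiv u (Var 0) (Var 0)) (Refl (Var 0)) \<Colon> Equiv (Var 0) (Var 0)"
    by (rule arr_elim[OF idToEquiv(1)[OF v1 v1] id_intro[OF v1]])
  note f1 = Fst(1)[OF F1 isEquiv_family[OF v1 v1], folded Equiv_def]
  have i1: "Univ u # \<Gamma> \<turnstile> Lam (Var 0) (Var 0) \<Colon> Arr (Var 0) (Var 0)"
    by (rule arr_intro[OF v1 var_cast[OF ctx_ty[OF v1]]]) simp_all
  have "Univ u # \<Gamma> \<turnstile> ?g1 \<doteq> Fst (Arr (Var 0) (Var 0)) (IdEquiv (Var 0)) \<Colon> Arr (Var 0) (Var 0)"
    by (rule Fst_cong[OF F1 isEquiv_family[OF v1 v1] idToEquiv(2)[OF v1, unfolded Equiv_def]])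
  from eq_trans[OF this idEquiv(2)[OF v1]]
  have q1: "Univ u # \<Gamma> \<turnstile> Lam (Var 0) (Var 0) \<doteq> ?g1 \<Colon> Arr (Var 0) (Var 0)"
    by (rule eq_sym)
  have v2: "Arr (Var 0) (Var 0) # Univ u # \<Gamma> \<turnstile> Var 1 \<Colon> Univ u"
    "Arr (Var 0) (Var 0) # Univ u # \<Gamma> \<turnstile> Var 0 \<Colon> Arr (Var 1) (Var 1)"
    by (rule var_cast[OF ctx_ty[OF F1]]; simp)+
  have C1: "Arr (Var 0) (Var 0) # Univ u # \<Gamma> \<turnstile> sub (Var 0 \<bullet> Var 1 \<bullet> Var 1 \<bullet> shift 2) C \<Colon> Univ w"
    by (rule C'[OF v2(1,1,2), of "[_, _]"]) simp_all
  \<comment> \<open>The map induced by \<open>Refl\<close> computes to the identity function, so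
    that \<open>d\<close> covers the diagonal.\<close>
  have "inh (Univ u # \<Gamma>) (sub (?g1 \<bullet> Var) (sub (Var 0 \<bullet> Var 1 \<bullet> Var 1 \<bullet> shift 2) C))"
    by (rule inh_conv[OF _ family_cong[OF F1 C1 i1 f1[OF t1] q1]]) (use d in simp)
  then have base: "inh (Univ u # \<Gamma>) (sub (Refl (Var 0) \<bullet> Var 0 \<bullet> Var 0 \<bullet> shift 1)
      (sub (?g \<bullet> Var 1 \<bullet> Var 2 \<bullet> shift 3) C))"
    by simp

  obtain z where z: "\<Gamma> \<turnstile> z \<Colon> IsEquiv A B f"
    using e by (rule inhE)
  then have z': "\<Gamma> \<turnstile> z \<Colon> sub (f \<bullet> Var) (IsEquiv (wk A) (wk B) (Var 0))"
    by simp
  let ?e = "Pr (IsEquiv (wk A) (wk B) (Var 0)) f z"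
  have e: "\<Gamma> \<turnstile> ?e \<Colon> Equiv A B"
    unfolding Equiv_def by (rule sg_intro[OF W f z'])
  obtain p where p: "\<Gamma> \<turnstile> p \<Colon> Id (Univ u) A B"
    and q: "inh \<Gamma> (Id (Equiv A B) (App (IdToEquiv u A B) p) ?e)"
    by (rule univalenceE[OF S A B e])
  have t: "\<Gamma> \<turnstile> App (IdToEquiv u A B) p \<Colon> Equiv A B"
    by (rule arr_elim[OF idToEquiv(1)[OF A B] p])
  have E1: "Equiv A B # \<Gamma> \<turnstile> Fst (Arr (wk A) (wk B)) (Var 0) \<Colon> Arr (wk A) (wk B)"
    by (rule Fst(1)[OF arr_form[OF wk_Univ[OF E A] wk_Univ[OF E B]]
          isEquiv_family[OF wk_Univ[OF E A] wk_Univ[OF E B]], folded Equiv_def], rule var_cast[OF ctx_ty[OF E]])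
      simp_all
  have T: "Equiv A B # \<Gamma> \<turnstile> sub (Fst (Arr (wk A) (wk B)) (Var 0) \<bullet> wk B \<bullet> wk A \<bullet> shift 1) C \<Colon> Univ w"
    by (rule C'[OF wk_Univ[OF E A] wk_Univ[OF E B] E1, of "[_]"]) simp_all
  \<comment> \<open>\<open>J\<close> proves the motive for the equivalence induced by
    \<open>p\<close>, and the path \<open>q\<close> carries it over to the pair of \<open>f\<close>
    and its proof.\<close>
  have "inh \<Gamma> (sub (?e \<bullet> Var) (sub (Fst (Arr (wk A) (wk B)) (Var 0) \<bullet> wk B \<bullet> wk A \<bullet> shift 1) C))"
    by (rule inh_transport[OF E T t e q]) (use inh_J[OF U J base A B p] in simp)
  then have e': "inh \<Gamma> (sub (Fst (Arr A B) ?e \<bullet> Var) (sub (Var 0 \<bullet> wk B \<bullet> wk A \<bullet> shift 1) C))"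
    by simp
  have "Arr A B # \<Gamma> \<turnstile> Var 0 \<Colon> Arr (wk A) (wk B)"
    by (rule var_cast[OF ctx_ty[OF F]]) simp_all
  then have C2: "Arr A B # \<Gamma> \<turnstile> sub (Var 0 \<bullet> wk B \<bullet> wk A \<bullet> shift 1) C \<Colon> Univ w"
    by (rule C'[OF wk_Univ[OF F A] wk_Univ[OF F B], of _ "[_]"]) simp_all
  show ?thesis
    using inh_conv[OF e' family_cong[OF F C2 Fst(1)[OF F W e[unfolded Equiv_def]] f Fst(2)[OF F W f z']]]
    by simp
qed

section \<open>Function extensionality\<close>

definition Singl :: "('c, 'l) tm \<Rightarrow> ('c, 'l) tm \<Rightarrow> ('c, 'l) tm" where
  "Singl A x = Sg A (Id (wk A) (wk x) (Var 0))"

definition singl :: "('c, 'l) tm \<Rightarrow> ('c, 'l) tm \<Rightarrow> ('c, 'l) tm" where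
  "singl A x = Pr (Id (wk A) (wk x) (Var 0)) x (Refl x)"

definition Comp :: "('c, 'l) tm \<Rightarrow> ('c, 'l) tm \<Rightarrow> ('c, 'l) tm \<Rightarrow> ('c, 'l) tm" where
  "Comp A g f = Lam A (App (wk g) (App (wk f) (Var 0)))"

text \<open>The space of all paths in \<open>A\<close>, bracketed as
  \<open>\<Sigma>(x : A), \<Sigma>(y : A), x = y\<close>. The inner sum is the singleton at
  \<open>x\<close>, so that contracting singletons is enough to compare the space with
  \<open>A\<close>.\<close>

definition PathSp :: "('c, 'l) tm \<Rightarrow> ('c, 'l) tm" where
  "PathSp A = Sg A (Singl (wk A) (Var 0))"

definition path :: "('c, 'l) tm \<Rightarrow> ('c, 'l) tm \<Rightarrow> ('c, 'l) tm \<Rightarrow> ('c, 'l) tm" where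
  "path A x w = Pr (Singl (wk A) (Var 0)) x w"

definition trg :: "('c, 'l) tm \<Rightarrow> ('c, 'l) tm \<Rightarrow> ('c, 'l) tm" where
  "trg A p = Split (wk A) (Fst (wk (wk A)) (Var 0)) p"

definition refls :: "('c, 'l) tm \<Rightarrow> ('c, 'l) tm" where
  "refls A = Lam A (path (wk A) (Var 0) (singl (wk A) (Var 0)))"

definition srcs :: "('c, 'l) tm \<Rightarrow> ('c, 'l) tm" where
  "srcs A = Lam (PathSp A) (Fst (wk A) (Var 0))"

definition trgs :: "('c, 'l) tm \<Rightarrow> ('c, 'l) tm" where
  "trgs A = Lam (PathSp A) (trg (wk A) (Var 0))"

lemma sub_paths [simp]:
  "sub s (Singl A x) = Singl (sub s A) (sub s x)"
  "sub s (singl A x) = singl (sub s A) (sub s x)"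
  "sub s (Comp A g f) = Comp (sub s A) (sub s g) (sub s f)"
  "sub s (PathSp A) = PathSp (sub s A)"
  "sub s (path A x w) = path (sub s A) (sub s x) (sub s w)"
  "sub s (trg A p) = trg (sub s A) (sub s p)"
  "sub s (refls A) = refls (sub s A)"
  "sub s (srcs A) = srcs (sub s A)"
  "sub s (trgs A) = trgs (sub s A)"
  by (simp_all add: Singl_def singl_def Comp_def PathSp_def path_def trg_def refls_def srcs_def trgs_def)

lemma singl_family:
  assumes A: "\<Gamma> \<turnstile> A \<Colon> Univ u" and x: "\<Gamma> \<turnstile> x \<Colon> A"
  shows "A # \<Gamma> \<turnstile> Id (wk A) (wk x) (Var 0) \<Colon> Univ u"
  by (rule id_form[OF wk_Univ[OF A A] wk_ty[OF A x] var_cast[OF ctx_ty[OF A]]]) simp_all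

lemma Singl_form:
  assumes "\<Gamma> \<turnstile> A \<Colon> Univ u" "\<Gamma> \<turnstile> x \<Colon> A"
  shows "\<Gamma> \<turnstile> Singl A x \<Colon> Univ u"
  using sg_form[OF assms(1) singl_family[OF assms]] by (simp add: Singl_def)

lemma Singl_pair:
  assumes "\<Gamma> \<turnstile> A \<Colon> Univ u" "\<Gamma> \<turnstile> x \<Colon> A" "\<Gamma> \<turnstile> y \<Colon> A" "\<Gamma> \<turnstile> p \<Colon> Id A x y"
  shows "\<Gamma> \<turnstile> Pr (Id (wk A) (wk x) (Var 0)) y p \<Colon> Singl A x"
  unfolding Singl_def by (rule sg_intro[OF singl_family[OF assms(1,2)] assms(3)]) (use assms(4) in simp)

lemma singl_ty:
  assumes "\<Gamma> \<turnstile> A \<Colon> Univ u" "\<Gamma> \<turnstile> x \<Colon> A"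
  shows "\<Gamma> \<turnstile> singl A x \<Colon> Singl A x"
  unfolding singl_def by (rule Singl_pair[OF assms assms(2) id_intro[OF assms(2)]])

text \<open>\<open>J\<close> on \<open>p\<close> with both endpoints free; on the diagonal the two
  pairs are the same term.\<close>

lemma Singl_pair_eq:
  assumes A: "\<Gamma> \<turnstile> A \<Colon> Univ u" and x: "\<Gamma> \<turnstile> x \<Colon> A" and y: "\<Gamma> \<turnstile> y \<Colon> A"
    and p: "\<Gamma> \<turnstile> p \<Colon> Id A x y"
  shows "inh \<Gamma> (Id (Singl A x) (singl A x) (Pr (Id (wk A) (wk x) (Var 0)) y p))"
proof -
  let ?\<Delta> = "Id (wk (wk A)) (Var 1) (Var 0) # wk A # A # \<Gamma>"
  let ?A = "sub (shift 3) A"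
  note c = Id_ctx(2)[OF A]
  have A3: "?\<Delta> \<turnstile> ?A \<Colon> Univ u"
    using weaken[OF A c, of "[_, _, _]" 3] by simp
  have v: "?\<Delta> \<turnstile> Var 2 \<Colon> ?A" "?\<Delta> \<turnstile> Var 1 \<Colon> ?A" "?\<Delta> \<turnstile> Var 0 \<Colon> Id ?A (Var 2) (Var 1)"
    by (rule var_cast[OF c]; simp)+
  have C: "?\<Delta> \<turnstile> Id (Singl ?A (Var 2)) (singl ?A (Var 2))
      (Pr (Id (wk ?A) (wk (Var 2)) (Var 0)) (Var 1) (Var 0)) \<Colon> Univ u"
    by (rule id_form[OF Singl_form[OF A3 v(1)] singl_ty[OF A3 v(1)] Singl_pair[OF A3 v]])
  have A1: "A # \<Gamma> \<turnstile> wk A \<Colon> Univ u" and v1: "A # \<Gamma> \<turnstile> Var 0 \<Colon> wk A"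
    by (rule wk_Univ[OF A A], rule var_cast[OF ctx_ty[OF A]]) simp_all
  show ?thesis
    using inh_J[OF A C _ x y p] inh_Refl[OF singl_ty[OF A1 v1]] by (simp add: singl_def)
qed

lemma Singl_contr:
  assumes A: "\<Gamma> \<turnstile> A \<Colon> Univ u" and x: "\<Gamma> \<turnstile> x \<Colon> A"
  shows "inh \<Gamma> (Pi (Singl A x) (Id (wk (Singl A x)) (wk (singl A x)) (Var 0)))"
proof -
  note F = singl_family[OF A x] and T = Singl_form[OF A x]
  let ?\<Delta> = "Id (wk A) (wk x) (Var 0) # A # \<Gamma>"
  note c = ctx_ty[OF F]
  have C: "Singl A x # \<Gamma> \<turnstile> Id (wk (Singl A x)) (wk (singl A x)) (Var 0) \<Colon> Univ u"
    by (rule id_form[OF wk_Univ[OF T T] wk_ty[OF T singl_ty[OF A x]] var_cast[OF ctx_ty[OF T]]]) simp_all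
  have A2: "?\<Delta> \<turnstile> sub (shift 2) A \<Colon> Univ u" and x2: "?\<Delta> \<turnstile> sub (shift 2) x \<Colon> sub (shift 2) A"
    using weaken[OF A c, of "[_, _]" 2] weaken[OF x c, of "[_, _]" 2] by simp_all
  have v: "?\<Delta> \<turnstile> Var 1 \<Colon> sub (shift 2) A" "?\<Delta> \<turnstile> Var 0 \<Colon> Id (sub (shift 2) A) (sub (shift 2) x) (Var 1)"
    by (rule var_cast[OF c]; simp)+
  show ?thesis
    unfolding Singl_def
    by (rule inh_Pi_Sg[OF A F C[unfolded Singl_def]]) (use Singl_pair_eq[OF A2 x2 v] in \<open>simp add: Singl_def\<close>)
qed

lemma Singl_eq:
  assumes A: "\<Gamma> \<turnstile> A \<Colon> Univ u" and x: "\<Gamma> \<turnstile> x \<Colon> A" and w: "\<Gamma> \<turnstile> w \<Colon> Singl A x"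
  shows "inh \<Gamma> (Id (Singl A x) (singl A x) w)"
  using inh_App[OF Singl_contr[OF A x] w] by simp

lemma PathSp_family:
  assumes A: "\<Gamma> \<turnstile> A \<Colon> Univ u"
  shows "A # \<Gamma> \<turnstile> Singl (wk A) (Var 0) \<Colon> Univ u"
  by (rule Singl_form[OF wk_Univ[OF A A] var_cast[OF ctx_ty[OF A]]]) simp_all

lemma PathSp_form: "\<Gamma> \<turnstile> A \<Colon> Univ u \<Longrightarrow> \<Gamma> \<turnstile> PathSp A \<Colon> Univ u"
  using sg_form[OF _ PathSp_family] unfolding PathSp_def by fastforce

lemma path_ty:
  assumes A: "\<Gamma> \<turnstile> A \<Colon> Univ u" and x: "\<Gamma> \<turnstile> x \<Colon> A" and w: "\<Gamma> \<turnstile> w \<Colon> Singl A x"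
  shows "\<Gamma> \<turnstile> path A x w \<Colon> PathSp A"
  unfolding path_def PathSp_def by (rule sg_intro[OF PathSp_family[OF A] x]) (use w in simp)

lemma src:
  assumes A: "\<Gamma> \<turnstile> A \<Colon> Univ u"
  shows "\<Gamma> \<turnstile> p \<Colon> PathSp A \<Longrightarrow> \<Gamma> \<turnstile> Fst A p \<Colon> A"
    and "\<Gamma> \<turnstile> x \<Colon> A \<Longrightarrow> \<Gamma> \<turnstile> w \<Colon> Singl A x \<Longrightarrow> \<Gamma> \<turnstile> Fst A (path A x w) \<doteq> x \<Colon> A"
  using Fst[OF A PathSp_family[OF A]] by (simp_all add: PathSp_def path_def)

lemma trg:
  assumes A: "\<Gamma> \<turnstile> A \<Colon> Univ u"
  shows "\<Gamma> \<turnstile> p \<Colon> PathSp A \<Longrightarrow> \<Gamma> \<turnstile> trg A p \<Colon> A"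
    and "\<Gamma> \<turnstile> x \<Colon> A \<Longrightarrow> \<Gamma> \<turnstile> w \<Colon> Singl A x \<Longrightarrow> \<Gamma> \<turnstile> trg A (path A x w) \<doteq> Fst A w \<Colon> A"
proof -
  note F = PathSp_family[OF A]
  let ?\<Delta> = "Singl (wk A) (Var 0) # A # \<Gamma>"
  note c = ctx_ty[OF F]
  have A2: "?\<Delta> \<turnstile> wk (wk A) \<Colon> Univ u"
    by (rule wk_Univ[OF F wk_Univ[OF A A]])
  have v: "?\<Delta> \<turnstile> Var 1 \<Colon> wk (wk A)" "?\<Delta> \<turnstile> Var 0 \<Colon> Singl (wk (wk A)) (Var 1)"
    by (rule var_cast[OF c]; simp)+
  have d: "?\<Delta> \<turnstile> Fst (wk (wk A)) (Var 0) \<Colon> wk (wk A)"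
    by (rule Fst(1)[OF A2 singl_family[OF A2 v(1)] v(2)[unfolded Singl_def[of "wk (wk A)"]]])
  note split = split_nondep[OF A PathSp_form[OF A, unfolded PathSp_def] d]
  show "\<Gamma> \<turnstile> p \<Colon> PathSp A \<Longrightarrow> \<Gamma> \<turnstile> trg A p \<Colon> A"
    using split(1) by (simp add: trg_def PathSp_def)
  show "\<Gamma> \<turnstile> x \<Colon> A \<Longrightarrow> \<Gamma> \<turnstile> w \<Colon> Singl A x \<Longrightarrow> \<Gamma> \<turnstile> trg A (path A x w) \<doteq> Fst A w \<Colon> A"
    using split(2) by (simp add: trg_def path_def)
qed

text \<open>The argument need only be convertible to \<open>a'\<close>. This is used where it is
  known to be a pair, or a particular family, by computation.\<close>

lemma Lam_App:
  assumes A: "\<Gamma> \<turnstile> A \<Colon> Univ u" and b: "A # \<Gamma> \<turnstile> b \<Colon> wk B"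
    and a: "\<Gamma> \<turnstile> a \<doteq> a' \<Colon> A" "\<Gamma> \<turnstile> a' \<Colon> A"
  shows "\<Gamma> \<turnstile> App (Lam A b) a \<doteq> sub (a' \<bullet> Var) b \<Colon> B"
  by (rule eq_trans[OF arr_app_cong[OF eq_refl[OF arr_intro[OF A b]] a(1)] arr_beta[OF A b a(2)]])

lemma path_maps:
  assumes A: "\<Gamma> \<turnstile> A \<Colon> Univ u"
  shows "\<Gamma> \<turnstile> refls A \<Colon> Arr A (PathSp A)"
    and "\<Gamma> \<turnstile> srcs A \<Colon> Arr (PathSp A) A"
    and "\<Gamma> \<turnstile> trgs A \<Colon> Arr (PathSp A) A"
    and "\<Gamma> \<turnstile> x \<Colon> A \<Longrightarrow> \<Gamma> \<turnstile> App (refls A) x \<doteq> path A x (singl A x) \<Colon> PathSp A"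
    and "\<Gamma> \<turnstile> p \<doteq> path A x w \<Colon> PathSp A \<Longrightarrow> \<Gamma> \<turnstile> x \<Colon> A \<Longrightarrow> \<Gamma> \<turnstile> w \<Colon> Singl A x \<Longrightarrow>
      \<Gamma> \<turnstile> App (srcs A) p \<doteq> x \<Colon> A"
    and "\<Gamma> \<turnstile> p \<doteq> path A x w \<Colon> PathSp A \<Longrightarrow> \<Gamma> \<turnstile> x \<Colon> A \<Longrightarrow> \<Gamma> \<turnstile> w \<Colon> Singl A x \<Longrightarrow>
      \<Gamma> \<turnstile> App (trgs A) p \<doteq> Fst A w \<Colon> A"
proof -
  note A1 = wk_Univ[OF A A] and P = PathSp_form[OF A]
  have v: "A # \<Gamma> \<turnstile> Var 0 \<Colon> wk A"
    by (rule var_cast[OF ctx_ty[OF A]]) simp_all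
  have r: "A # \<Gamma> \<turnstile> path (wk A) (Var 0) (singl (wk A) (Var 0)) \<Colon> wk (PathSp A)"
    using path_ty[OF A1 v singl_ty[OF A1 v]] by simp
  note A2 = wk_Univ[OF P A]
  have v2: "PathSp A # \<Gamma> \<turnstile> Var 0 \<Colon> PathSp (wk A)"
    by (rule var_cast[OF ctx_ty[OF P]]) simp_all
  note s = src(1)[OF A2 v2] and t = trg(1)[OF A2 v2]
  show "\<Gamma> \<turnstile> refls A \<Colon> Arr A (PathSp A)" "\<Gamma> \<turnstile> srcs A \<Colon> Arr (PathSp A) A"
    "\<Gamma> \<turnstile> trgs A \<Colon> Arr (PathSp A) A"
    unfolding refls_def srcs_def trgs_def by (rule arr_intro[OF A r] arr_intro[OF P s] arr_intro[OF P t])+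
  show "\<Gamma> \<turnstile> x \<Colon> A \<Longrightarrow> \<Gamma> \<turnstile> App (refls A) x \<doteq> path A x (singl A x) \<Colon> PathSp A"
    using arr_beta[OF A r] by (simp add: refls_def)
  assume p: "\<Gamma> \<turnstile> p \<doteq> path A x w \<Colon> PathSp A" and x: "\<Gamma> \<turnstile> x \<Colon> A" and w: "\<Gamma> \<turnstile> w \<Colon> Singl A x"
  show "\<Gamma> \<turnstile> App (srcs A) p \<doteq> x \<Colon> A"
    using Lam_App[OF P s p path_ty[OF A x w]] src(2)[OF A x w] by (auto simp: srcs_def intro: eq_trans)
  show "\<Gamma> \<turnstile> App (trgs A) p \<doteq> Fst A w \<Colon> A"
    using Lam_App[OF P t p path_ty[OF A x w]] trg(2)[OF A x w] by (auto simp: trgs_def intro: eq_trans)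
qed

lemma singl_Fst:
  assumes "\<Gamma> \<turnstile> A \<Colon> Univ u" "\<Gamma> \<turnstile> x \<Colon> A" "\<Gamma> \<turnstile> y \<Colon> A" "\<Gamma> \<turnstile> p \<Colon> Id A x y"
  shows "\<Gamma> \<turnstile> Fst A (Pr (Id (wk A) (wk x) (Var 0)) y p) \<doteq> y \<Colon> A"
  using Fst(2)[OF assms(1) singl_family[OF assms(1,2)] assms(3)] assms(4) by simp

text \<open>Both composites are identities by computation and not merely up to a path, which makes
  source and target agree after composition with \<open>refls\<close>.\<close>

lemma refls_App:
  assumes A: "\<Gamma> \<turnstile> A \<Colon> Univ u" and x: "\<Gamma> \<turnstile> x \<Colon> A"
  shows "\<Gamma> \<turnstile> App (srcs A) (App (refls A) x) \<doteq> x \<Colon> A"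
    and "\<Gamma> \<turnstile> App (trgs A) (App (refls A) x) \<doteq> x \<Colon> A"
proof -
  note r = path_maps(4)[OF A x] x singl_ty[OF A x]
  show "\<Gamma> \<turnstile> App (srcs A) (App (refls A) x) \<doteq> x \<Colon> A"
    by (rule path_maps(5)[OF A r])
  show "\<Gamma> \<turnstile> App (trgs A) (App (refls A) x) \<doteq> x \<Colon> A"
    using eq_trans[OF path_maps(6)[OF A r]] singl_Fst[OF A x x id_intro[OF x]] by (simp add: singl_def)
qed

text \<open>The source map is the inverse. One round trip computes; the other sends
  \<open>(x, w)\<close> to \<open>(x, singl A x)\<close>, and the contraction of the singleton
  provides the path from there back to \<open>(x, w)\<close>.\<close>

lemma isEquiv_refls:
  assumes A: "\<Gamma> \<turnstile> A \<Colon> Univ u"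
  shows "inh \<Gamma> (IsEquiv A (PathSp A) (refls A))"
proof (rule inh_isEquiv[OF A PathSp_form[OF A] path_maps(1,2)[OF A]])
  note A1 = wk_Univ[OF A A]
  have v: "A # \<Gamma> \<turnstile> Var 0 \<Colon> wk A"
    by (rule var_cast[OF ctx_ty[OF A]]) simp_all
  have "inh (A # \<Gamma>) (Id (wk A) (App (srcs (wk A)) (App (refls (wk A)) (Var 0))) (Var 0))"
    by (rule Id_of_eq[OF A1 arr_elim[OF path_maps(2)[OF A1] arr_elim[OF path_maps(1)[OF A1] v]] refls_App(1)[OF A1 v]])
  then show "inh \<Gamma> (LeftInv A (refls A) (srcs A))"
    unfolding LeftInv_def by (intro inh_Lam[OF A]) simp
next
  note F = PathSp_family[OF A] and P = PathSp_form[OF A]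
  note C = leftInv_body[OF P path_maps(2,1)[OF A]]
  let ?\<Delta> = "Singl (wk A) (Var 0) # A # \<Gamma>" and ?A = "sub (shift 2) A"
  let ?p = "path ?A (Var 1) (Var 0)"
  note c = ctx_ty[OF F]
  have A2: "?\<Delta> \<turnstile> ?A \<Colon> Univ u"
    using weaken[OF A c, of "[_, _]" 2] by simp
  have v: "?\<Delta> \<turnstile> Var 1 \<Colon> ?A" "?\<Delta> \<turnstile> Var 0 \<Colon> Singl ?A (Var 1)"
    by (rule var_cast[OF c]; simp)+
  note p = path_ty[OF A2 v]
  have e: "?\<Delta> \<turnstile> App (refls ?A) (App (srcs ?A) ?p) \<doteq> path ?A (Var 1) (singl ?A (Var 1)) \<Colon> PathSp ?A"
    by (rule eq_trans[OF arr_app_cong[OF eq_refl[OF path_maps(1)[OF A2]] path_maps(5)[OF A2 eq_refl[OF p] v]]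
          path_maps(4)[OF A2 v(1)]])
  note T = Singl_form[OF A2 v(1)]
  have t: "Singl ?A (Var 1) # ?\<Delta> \<turnstile> path (wk ?A) (Var 2) (Var 0) \<Colon> wk (PathSp ?A)"
    using path_ty[OF wk_Univ[OF T A2] wk_ty[OF T v(1)], of "Var 0"] var_cast[OF ctx_ty[OF T], of 0] by simp
  have "inh ?\<Delta> (Id (PathSp ?A) (path ?A (Var 1) (singl ?A (Var 1))) ?p)"
    using inh_ap[OF T PathSp_form[OF A2] t singl_ty[OF A2 v(1)] v(2) Singl_eq[OF A2 v]] by simp
  then have "inh ?\<Delta> (Id (PathSp ?A) (App (refls ?A) (App (srcs ?A) ?p)) ?p)"
    using Id_conv[OF PathSp_form[OF A2] e eq_refl[OF p]] by blast
  then show "inh \<Gamma> (LeftInv (PathSp A) (srcs A) (refls A))"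
    unfolding LeftInv_def PathSp_def
    by (intro inh_Pi_Sg[OF A F C[unfolded PathSp_def]]) (simp add: path_def PathSp_def)
qed

lemma comp_ty:
  assumes A: "\<Gamma> \<turnstile> A \<Colon> Univ u" and f: "\<Gamma> \<turnstile> f \<Colon> Arr A B" and g: "\<Gamma> \<turnstile> g \<Colon> Arr B C"
  shows "\<Gamma> \<turnstile> Comp A g f \<Colon> Arr A C"
proof -
  have "A # \<Gamma> \<turnstile> wk f \<Colon> Arr (wk A) (wk B)" "A # \<Gamma> \<turnstile> wk g \<Colon> Arr (wk B) (wk C)"
    using wk_ty[OF A f] wk_ty[OF A g] by simp_all
  moreover have "A # \<Gamma> \<turnstile> Var 0 \<Colon> wk A"
    by (rule var_cast[OF ctx_ty[OF A]]) simp_all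
  ultimately show ?thesis
    unfolding Comp_def by (blast intro: arr_intro[OF A] arr_elim)
qed

text \<open>Eta on \<open>h\<close> reduces an equation with a composite to one at a
  variable.\<close>

lemma comp_eqI:
  assumes A: "\<Gamma> \<turnstile> A \<Colon> Univ u" and h: "\<Gamma> \<turnstile> h \<Colon> Arr A C"
    and e: "A # \<Gamma> \<turnstile> App (wk g) (App (wk f) (Var 0)) \<doteq> App (wk h) (Var 0) \<Colon> wk C"
  shows "\<Gamma> \<turnstile> Comp A g f \<doteq> h \<Colon> Arr A C"
  using lam_cong[OF A eq_refl[OF A] e] pi_eta[OF h[unfolded Arr_def]]
  unfolding Comp_def Arr_def by (blast intro: eq_sym eq_trans)

text \<open>By induction on equivalences \<open>f\<close> may be taken to be the identity, and
  composition with it is judgmentally trivial by eta. The codomain \<open>A\<close> is one of the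
  two types over which the motive ranges, as it is when source and target are compared.\<close>

lemma equiv_cancel:
  assumes S: "univalence S" and A: "\<Gamma> \<turnstile> A \<Colon> Univ u" and B: "\<Gamma> \<turnstile> B \<Colon> Univ u"
    and f: "\<Gamma> \<turnstile> f \<Colon> Arr A B" and e: "inh \<Gamma> (IsEquiv A B f)"
    and g: "\<Gamma> \<turnstile> g \<Colon> Arr B A" and h: "\<Gamma> \<turnstile> h \<Colon> Arr B A"
    and gh: "inh \<Gamma> (Id (Arr A A) (Comp A g f) (Comp A h f))"
  shows "inh \<Gamma> (Id (Arr B A) g h)"
proof -
  note U = univ[OF has_type_ctx(2)[OF A], of u]
  let ?I = "Id (Arr (Var 4) (Var 4)) (Comp (Var 4) (Var 1) (Var 2)) (Comp (Var 4) (Var 0) (Var 2))"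
  let ?C = "Pi (Arr (Var 1) (Var 2)) (Pi (Arr (Var 2) (Var 3)) (Arr ?I (Id (Arr (Var 3) (Var 4)) (Var 1) (Var 0))))"
  let ?\<Gamma>2 = "Univ u # Univ u # \<Gamma>"
  let ?\<Gamma>3 = "Arr (Var 1) (Var 0) # ?\<Gamma>2"
  let ?\<Gamma>4 = "Arr (Var 1) (Var 2) # ?\<Gamma>3"
  let ?\<Gamma>5 = "Arr (Var 2) (Var 3) # ?\<Gamma>4"
  note c1 = ctx_ty[OF U]
  have c2: "?\<Gamma>2 ctx"
    by (rule ctx_ty[OF univ[OF c1]])
  have v2: "?\<Gamma>2 \<turnstile> Var 1 \<Colon> Univ u" "?\<Gamma>2 \<turnstile> Var 0 \<Colon> Univ u"
    by (rule var_cast[OF c2]; simp)+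
  note c3 = ctx_ty[OF arr_form[OF v2]]
  have v3: "?\<Gamma>3 \<turnstile> Var 1 \<Colon> Univ u" "?\<Gamma>3 \<turnstile> Var 2 \<Colon> Univ u"
    by (rule var_cast[OF c3]; simp)+
  note c4 = ctx_ty[OF arr_form[OF v3]]
  have v4: "?\<Gamma>4 \<turnstile> Var 2 \<Colon> Univ u" "?\<Gamma>4 \<turnstile> Var 3 \<Colon> Univ u"
    by (rule var_cast[OF c4]; simp)+
  note c5 = ctx_ty[OF arr_form[OF v4]]
  have v5: "?\<Gamma>5 \<turnstile> Var 4 \<Colon> Univ u" "?\<Gamma>5 \<turnstile> Var 3 \<Colon> Univ u" "?\<Gamma>5 \<turnstile> Var 2 \<Colon> Arr (Var 4) (Var 3)"
    "?\<Gamma>5 \<turnstile> Var 1 \<Colon> Arr (Var 3) (Var 4)" "?\<Gamma>5 \<turnstile> Var 0 \<Colon> Arr (Var 3) (Var 4)"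
    by (rule var_cast[OF c5]; simp)+
  have C: "?\<Gamma>3 \<turnstile> ?C \<Colon> Univ u"
    using pi_form[OF arr_form[OF v3] pi_form[OF arr_form[OF v4] arr_form[OF
          id_form[OF arr_form[OF v5(1,1)] comp_ty[OF v5(1,3,4)] comp_ty[OF v5(1,3,5)]]
          id_form[OF arr_form[OF v5(2,1)] v5(4,5)]]]]
    by simp

  let ?\<Delta>1 = "Univ u # \<Gamma>"
  let ?\<Delta>2 = "Arr (Var 0) (Var 0) # ?\<Delta>1"
  let ?\<Delta>3 = "Arr (Var 1) (Var 1) # ?\<Delta>2"
  let ?i = "Lam (Var 2) (Var 0)"
  let ?H = "Id (Arr (Var 2) (Var 2)) (Comp (Var 2) (Var 1) ?i) (Comp (Var 2) (Var 0) ?i)"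
  have d1: "?\<Delta>1 \<turnstile> Var 0 \<Colon> Univ u"
    by (rule var_cast[OF c1]) simp_all
  note F2 = arr_form[OF d1 d1]
  have d2: "?\<Delta>2 \<turnstile> Var 1 \<Colon> Univ u"
    by (rule var_cast[OF ctx_ty[OF F2]]) simp_all
  note F3 = arr_form[OF d2 d2]
  have d3: "?\<Delta>3 \<turnstile> Var 2 \<Colon> Univ u" "?\<Delta>3 \<turnstile> Var 1 \<Colon> Arr (Var 2) (Var 2)"
    "?\<Delta>3 \<turnstile> Var 0 \<Colon> Arr (Var 2) (Var 2)"
    by (rule var_cast[OF ctx_ty[OF F3]]; simp)+
  note F4 = arr_form[OF d3(1,1)]
  have i: "?\<Delta>3 \<turnstile> ?i \<Colon> Arr (Var 2) (Var 2)"
    by (rule arr_intro[OF d3(1) var_cast[OF ctx_ty[OF d3(1)]]]) simp_all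
  note H = id_form[OF F4 comp_ty[OF d3(1) i d3(2)] comp_ty[OF d3(1) i d3(3)]]
  have k: "?\<Delta>3 \<turnstile> Comp (Var 2) k ?i \<doteq> k \<Colon> Arr (Var 2) (Var 2)"
    if k: "?\<Delta>3 \<turnstile> k \<Colon> Arr (Var 2) (Var 2)" for k
  proof (rule comp_eqI[OF d3(1) k])
    have v: "Var 2 # ?\<Delta>3 \<turnstile> Var 0 \<Colon> wk (Var 2)" "Var 2 # ?\<Delta>3 \<turnstile> wk (Var 2) \<Colon> Univ u"
      by (rule var_cast[OF ctx_ty[OF d3(1)]] wk_Univ[OF d3(1,1)]; simp)+
    have "Var 2 # ?\<Delta>3 \<turnstile> App (wk ?i) (Var 0) \<doteq> Var 0 \<Colon> wk (Var 2)"
      using arr_beta[OF v(2) var_cast[OF ctx_ty[OF v(2)], of 0] v(1)] by simp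
    from arr_app_cong[OF eq_refl this]
    show "Var 2 # ?\<Delta>3 \<turnstile> App (wk k) (App (wk ?i) (Var 0)) \<doteq> App (wk k) (Var 0) \<Colon> wk (Var 2)"
      using wk_ty[OF d3(1) k] by simp
  qed
  have v0: "?H # ?\<Delta>3 \<turnstile> Var 0 \<Colon> wk ?H"
    by (rule var_cast[OF ctx_ty[OF H]]) simp_all
  have F5: "?H # ?\<Delta>3 \<turnstile> wk (Arr (Var 2) (Var 2)) \<Colon> Univ u"
    using wk_Univ[OF H F4] by simp
  have "inh (?H # ?\<Delta>3) (wk (Id (Arr (Var 2) (Var 2)) (Var 1) (Var 0)))"
    using Id_conv[OF F5 wk_eqtm[OF H k[OF d3(2)]] wk_eqtm[OF H k[OF d3(3)]]] inhI[OF v0] by simp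
  then have "inh ?\<Delta>1 (Pi (Arr (Var 0) (Var 0)) (Pi (Arr (Var 1) (Var 1)) (Arr ?H (Id (Arr (Var 2) (Var 2)) (Var 1) (Var 0)))))"
    by (intro inh_Lam[OF F2] inh_Lam[OF F3] inh_Arr[OF H])
  then have "inh \<Gamma> (sub (f \<bullet> B \<bullet> A \<bullet> Var) ?C)"
    by (intro equiv_induct[OF S A B f e C]) simp
  then have 1: "inh \<Gamma> (Pi (Arr B A) (Pi (wk (Arr B A)) (Arr (Id (wk (wk (Arr A A)))
      (Comp (wk (wk A)) (Var 1) (wk (wk f))) (Comp (wk (wk A)) (Var 0) (wk (wk f))))
      (Id (wk (wk (Arr B A))) (Var 1) (Var 0)))))"
    by simp
  have "inh \<Gamma> (Arr (Id (Arr A A) (Comp A g f) (Comp A h f)) (Id (Arr B A) g h))"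
    using inh_App[OF inh_App[OF 1 g, simplified] h] by simp
  from inh_mp[OF this gh] show ?thesis .
qed

text \<open>The pointwise paths assemble into one map from \<open>A\<close> to
  \<open>PathSp B\<close>. Composed with the source map it gives \<open>f\<close>, with the target
  map \<open>g\<close>, in both cases judgmentally, so that a path between source and target yields
  one between \<open>f\<close> and \<open>g\<close>.\<close>

lemma funext:
  assumes S: "univalence S" and A: "\<Gamma> \<turnstile> A \<Colon> Univ u" and B: "\<Gamma> \<turnstile> B \<Colon> Univ v"
    and f: "\<Gamma> \<turnstile> f \<Colon> Arr A B" and g: "\<Gamma> \<turnstile> g \<Colon> Arr A B"
    and h: "inh (A # \<Gamma>) (Id (wk B) (App (wk f) (Var 0)) (App (wk g) (Var 0)))"
  shows "inh \<Gamma> (Id (Arr A B) f g)"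
proof -
  note P = PathSp_form[OF B] and m = path_maps[OF B]
  have r: "\<Gamma> \<turnstile> Comp B k (refls B) \<doteq> Lam B (Var 0) \<Colon> Arr B B"
    if "B # \<Gamma> \<turnstile> App (wk k) (App (refls (wk B)) (Var 0)) \<doteq> Var 0 \<Colon> wk B" for k
    unfolding Comp_def Arr_def using lam_cong[OF B eq_refl[OF B] that] by simp
  have vB: "B # \<Gamma> \<turnstile> Var 0 \<Colon> wk B"
    by (rule var_cast[OF ctx_ty[OF B]]) simp_all
  have "\<Gamma> \<turnstile> Comp B (srcs B) (refls B) \<doteq> Lam B (Var 0) \<Colon> Arr B B"
    "\<Gamma> \<turnstile> Comp B (trgs B) (refls B) \<doteq> Lam B (Var 0) \<Colon> Arr B B"
    by (rule r, use refls_App[OF wk_Univ[OF B B] vB] in simp)+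
  from Id_of_eq[OF arr_form[OF B B] comp_ty[OF B m(1,2)] eq_trans[OF this(1) eq_sym[OF this(2)]]]
  have st: "inh \<Gamma> (Id (Arr (PathSp B) B) (srcs B) (trgs B))"
    by (rule equiv_cancel[OF S B P m(1) isEquiv_refls[OF B] m(2,3)])

  obtain h where h: "A # \<Gamma> \<turnstile> h \<Colon> Id (wk B) (App (wk f) (Var 0)) (App (wk g) (Var 0))"
    using h by (rule inhE)
  have B1: "A # \<Gamma> \<turnstile> wk B \<Colon> Univ v" and vA: "A # \<Gamma> \<turnstile> Var 0 \<Colon> wk A"
    by (rule wk_Univ[OF A B], rule var_cast[OF ctx_ty[OF A]]) simp_all
  have f1: "A # \<Gamma> \<turnstile> App (wk f) (Var 0) \<Colon> wk B" and g1: "A # \<Gamma> \<turnstile> App (wk g) (Var 0) \<Colon> wk B"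
    using arr_elim[OF _ vA] wk_ty[OF A f] wk_ty[OF A g] by simp_all
  let ?w = "Pr (Id (wk (wk B)) (wk (App (wk f) (Var 0))) (Var 0)) (App (wk g) (Var 0)) h"
  let ?k = "path (wk B) (App (wk f) (Var 0)) ?w"
  note w = Singl_pair[OF B1 f1 g1 h]
  have k: "A # \<Gamma> \<turnstile> ?k \<Colon> wk (PathSp B)"
    using path_ty[OF B1 f1 w] by simp
  have K: "\<Gamma> \<turnstile> Lam A ?k \<Colon> Arr A (PathSp B)"
    by (rule arr_intro[OF A k])
  have Kk: "A # \<Gamma> \<turnstile> App (wk (Lam A ?k)) (Var 0) \<doteq> ?k \<Colon> PathSp (wk B)"
  proof -
    note A1 = wk_Univ[OF A A]
    have c: "wk A # A # \<Gamma> ctx"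
      by (rule ctx_ty[OF A1])
    \<comment> \<open>Weakening an abstraction moves its body but keeps its own bound variable in
      place; beta requires the typing of the body in that position.\<close>
    have "wk A # A # \<Gamma> \<turnstile> sub (Var 0 \<bullet> shift 2) ?k \<Colon> sub (Var 0 \<bullet> shift 2) (wk (PathSp B))"
      by (rule inst_shift[OF k var_cast[OF c], of _ _ "[_, _]"]) simp_all
    then show ?thesis
      using arr_beta[OF A1 _ vA, of "sub (Var 0 \<bullet> shift 2) ?k" "PathSp (wk B)"] by simp
  qed
  have s: "\<Gamma> \<turnstile> Comp A (srcs B) (Lam A ?k) \<doteq> f \<Colon> Arr A B"
    by (rule comp_eqI[OF A f]) (use path_maps(5)[OF B1 Kk f1 w] in simp)
  have t: "\<Gamma> \<turnstile> Comp A (trgs B) (Lam A ?k) \<doteq> g \<Colon> Arr A B"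
    by (rule comp_eqI[OF A g]) (use eq_trans[OF path_maps(6)[OF B1 Kk f1 w] singl_Fst[OF B1 f1 g1 h]] in simp)
  note F = arr_form[OF P B]
  \<comment> \<open>Precomposition with the assembled map, as an open term in the map to be
    precomposed, to which \<open>inh_ap\<close> can be applied.\<close>
  have "Arr (PathSp B) B # \<Gamma> \<turnstile> Comp (wk A) (Var 0) (wk (Lam A ?k)) \<Colon> Arr (wk A) (wk B)"
    by (rule comp_ty[OF wk_Univ[OF F A] _ var_cast[OF ctx_ty[OF F]], of _ "wk (PathSp B)"])
      (use wk_ty[OF F K] in simp_all)
  then have "Arr (PathSp B) B # \<Gamma> \<turnstile> Comp (wk A) (Var 0) (wk (Lam A ?k)) \<Colon> wk (Arr A B)"
    by simp
  from inh_ap[OF F arr_form[OF A B] this m(2,3) st]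
  have "inh \<Gamma> (Id (Arr A B) (Comp A (srcs B) (Lam A ?k)) (Comp A (trgs B) (Lam A ?k)))"
    by simp
  then show ?thesis
    using Id_conv[OF arr_form[OF A B] s t] by blast
qed

section \<open>Retracts of powers of the universe are injective\<close>

lemma equiv_Id:
  assumes S: "univalence S" and A: "\<Gamma> \<turnstile> A \<Colon> Univ u" and B: "\<Gamma> \<turnstile> B \<Colon> Univ u"
    and f: "\<Gamma> \<turnstile> f \<Colon> Arr A B" and e: "inh \<Gamma> (IsEquiv A B f)"
  shows "inh \<Gamma> (Id (Univ u) A B)"
proof -
  have "inh \<Gamma> (Equiv A B)"
    unfolding Equiv_def by (rule inh_Pr[OF isEquiv_family[OF A B] f]) (use e in simp)
  then show ?thesis
    using univalenceE[OF S A B] by (auto simp: inh_def)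
qed

section \<open>Products with an inhabited proposition and the extension formula\<close>

definition snds :: "('c, 'l) tm \<Rightarrow> ('c, 'l) tm \<Rightarrow> ('c, 'l) tm" where
  "snds W T = Lam (Times W T) (Split (wk (wk T)) (Var 0) (Var 0))"

definition ins :: "('c, 'l) tm \<Rightarrow> ('c, 'l) tm \<Rightarrow> ('c, 'l) tm" where
  "ins T c = Lam T (Pr (wk (wk T)) (wk c) (Var 0))"

lemma sub_times_maps [simp]:
  "sub s (snds W T) = snds (sub s W) (sub s T)"
  "sub s (ins T c) = ins (sub s T) (sub s c)"
  by (simp_all add: snds_def ins_def)

lemma times_pair:
  assumes "\<Gamma> \<turnstile> W \<Colon> Univ u" "\<Gamma> \<turnstile> T \<Colon> Univ v" "\<Gamma> \<turnstile> a \<Colon> W" "\<Gamma> \<turnstile> b \<Colon> T"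
  shows "\<Gamma> \<turnstile> Pr (wk T) a b \<Colon> Times W T"
  unfolding Times_def by (rule sg_intro[OF wk_Univ[OF assms(1,2)] assms(3)]) (use assms(4) in simp)

lemma times_maps:
  assumes W: "\<Gamma> \<turnstile> W \<Colon> Univ u" and T: "\<Gamma> \<turnstile> T \<Colon> Univ v"
  shows "\<Gamma> \<turnstile> snds W T \<Colon> Arr (Times W T) T"
    and "\<Gamma> \<turnstile> q \<doteq> Pr (wk T) w t \<Colon> Times W T \<Longrightarrow> \<Gamma> \<turnstile> w \<Colon> W \<Longrightarrow> \<Gamma> \<turnstile> t \<Colon> T \<Longrightarrow>
      \<Gamma> \<turnstile> App (snds W T) q \<doteq> t \<Colon> T"
    and "\<Gamma> \<turnstile> w \<Colon> W \<Longrightarrow> \<Gamma> \<turnstile> ins T w \<Colon> Arr T (Times W T)"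
    and "\<Gamma> \<turnstile> w \<Colon> W \<Longrightarrow> \<Gamma> \<turnstile> t \<Colon> T \<Longrightarrow> \<Gamma> \<turnstile> App (ins T w) t \<doteq> Pr (wk T) w t \<Colon> Times W T"
proof -
  note P = times_form[OF W T]
  note TP = wk_Univ[OF P T] and WP = wk_Univ[OF P W] and T1 = wk_Univ[OF W T]
  have d: "wk T' # W' # \<Delta> \<turnstile> Var 0 \<Colon> wk (wk T')"
    if "W' # \<Delta> \<turnstile> wk T' \<Colon> Univ v" for \<Delta> W' T'
    by (rule var_cast[OF ctx_ty[OF that]]) simp_all
  have z: "Times W T # \<Gamma> \<turnstile> Var 0 \<Colon> Sg (wk W) (wk (wk T))"
    by (rule var_cast[OF ctx_ty[OF P]]) (simp_all add: Times_def)
  note s = split_nondep(1)[OF TP sg_form[OF WP wk_Univ[OF WP TP]] d[OF wk_Univ[OF WP TP]] z]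
  show "\<Gamma> \<turnstile> snds W T \<Colon> Arr (Times W T) T"
    unfolding snds_def by (rule arr_intro[OF P s])
  show "\<Gamma> \<turnstile> App (snds W T) q \<doteq> t \<Colon> T"
    if q: "\<Gamma> \<turnstile> q \<doteq> Pr (wk T) w t \<Colon> Times W T" and w: "\<Gamma> \<turnstile> w \<Colon> W" and t: "\<Gamma> \<turnstile> t \<Colon> T"
    using eq_trans[OF Lam_App[OF P s q times_pair[OF W T w t]], of t]
      split_nondep(2)[OF T sg_form[OF W T1] d[OF T1] w, of t] t by (simp add: snds_def)
  have i: "T # \<Gamma> \<turnstile> Pr (wk (wk T)) (wk w) (Var 0) \<Colon> wk (Times W T)" if w: "\<Gamma> \<turnstile> w \<Colon> W" for w
    using times_pair[OF wk_Univ[OF T W] wk_Univ[OF T T] wk_ty[OF T w], of "Var 0"] var_cast[OF ctx_ty[OF T], of 0]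
    by simp
  show "\<Gamma> \<turnstile> ins T w \<Colon> Arr T (Times W T)" if "\<Gamma> \<turnstile> w \<Colon> W"
    unfolding ins_def by (rule arr_intro[OF T i[OF that]])
  show "\<Gamma> \<turnstile> App (ins T w) t \<doteq> Pr (wk T) w t \<Colon> Times W T" if "\<Gamma> \<turnstile> w \<Colon> W" "\<Gamma> \<turnstile> t \<Colon> T"
    using arr_beta[OF T i[OF that(1)] that(2)] by (simp add: ins_def)
qed

text \<open>The projection to \<open>T\<close> has the inverse that inserts \<open>c\<close>. The
  round trip on the product replaces the first component by \<open>c\<close>, to which it is equal
  because \<open>W\<close> is a proposition.\<close>

lemma Times_prop_Id:
  assumes S: "univalence S" and W: "\<Gamma> \<turnstile> W \<Colon> Univ u" and T: "\<Gamma> \<turnstile> T \<Colon> Univ u"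
    and hW: "inh \<Gamma> (IsProp W)" and c: "\<Gamma> \<turnstile> c \<Colon> W"
  shows "inh \<Gamma> (Id (Univ u) (Times W T) T)"
proof -
  have P: "\<Gamma> \<turnstile> Times W T \<Colon> Univ u"
    using times_form[OF W T] by simp
  note m = times_maps(1)[OF W T] times_maps(3)[OF W T c]
  have "inh \<Gamma> (IsEquiv (Times W T) T (snds W T))"
  proof (rule inh_isEquiv[OF P T m])
    have T1: "T # \<Gamma> \<turnstile> wk T \<Colon> Univ u" and W1: "T # \<Gamma> \<turnstile> wk W \<Colon> Univ u" and v: "T # \<Gamma> \<turnstile> Var 0 \<Colon> wk T"
      by (rule wk_Univ[OF T T], rule wk_Univ[OF T W], rule var_cast[OF ctx_ty[OF T]]) simp_all
    note c1 = wk_ty[OF T c]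
    note m1 = times_maps[OF W1 T1]
    have "inh (T # \<Gamma>) (Id (wk T) (App (snds (wk W) (wk T)) (App (ins (wk T) (wk c)) (Var 0))) (Var 0))"
      by (rule Id_of_eq[OF T1 arr_elim[OF m1(1) arr_elim[OF m1(3)[OF c1] v]] m1(2)[OF m1(4)[OF c1 v] c1 v]])
    then show "inh \<Gamma> (LeftInv T (ins T c) (snds W T))"
      unfolding LeftInv_def by (intro inh_Lam[OF T]) simp
  next
    note F = wk_Univ[OF W T]
    let ?\<Delta> = "wk T # W # \<Gamma>" and ?W = "sub (shift 2) W" and ?T = "sub (shift 2) T" and ?c = "sub (shift 2) c"
    note C = leftInv_body[OF P m]
    note d = ctx_ty[OF F]
    have W2: "?\<Delta> \<turnstile> ?W \<Colon> Univ u" and T2: "?\<Delta> \<turnstile> ?T \<Colon> Univ u" and c2: "?\<Delta> \<turnstile> ?c \<Colon> ?W"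
      using weaken[OF W d, of "[_, _]" 2] weaken[OF T d, of "[_, _]" 2] weaken[OF c d, of "[_, _]" 2] by simp_all
    have v: "?\<Delta> \<turnstile> Var 1 \<Colon> ?W" "?\<Delta> \<turnstile> Var 0 \<Colon> ?T"
      by (rule var_cast[OF d]; simp)+
    note m2 = times_maps[OF W2 T2]
    let ?p = "Pr (wk ?T) (Var 1) (Var 0)"
    have P2: "?\<Delta> \<turnstile> Times ?W ?T \<Colon> Univ u"
      using times_form[OF W2 T2] by simp
    note p = times_pair[OF W2 T2 v]
    have e: "?\<Delta> \<turnstile> App (ins ?T ?c) (App (snds ?W ?T) ?p) \<doteq> Pr (wk ?T) ?c (Var 0) \<Colon> Times ?W ?T"
      by (rule eq_trans[OF arr_app_cong[OF eq_refl[OF m2(3)[OF c2]] m2(2)[OF eq_refl[OF p] v]] m2(4)[OF c2 v(2)]])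
    have "inh ?\<Delta> (IsProp ?W)"
      using inh_weaken[OF hW d, of "[_, _]" 2] by simp
    note q = isProp_elim[OF this c2 v(1)]
    have t: "?W # ?\<Delta> \<turnstile> Pr (wk (wk ?T)) (Var 0) (Var 1) \<Colon> wk (Times ?W ?T)"
      using times_pair[OF wk_Univ[OF W2 W2] wk_Univ[OF W2 T2], of "Var 0" "Var 1"]
        var_cast[OF ctx_ty[OF W2], of 0] var_cast[OF ctx_ty[OF W2], of 1] by simp
    have "inh ?\<Delta> (Id (Times ?W ?T) (Pr (wk ?T) ?c (Var 0)) ?p)"
      using inh_ap[OF W2 P2 t c2 v(1) q] by simp
    then have "inh ?\<Delta> (Id (Times ?W ?T) (App (ins ?T ?c) (App (snds ?W ?T) ?p)) ?p)"
      using Id_conv[OF P2 e eq_refl[OF p]] by blast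
    then show "inh \<Gamma> (LeftInv (Times W T) (snds W T) (ins T c))"
      unfolding LeftInv_def Times_def by (intro inh_Pi_Sg[OF W F C[unfolded Times_def]]) (simp add: Times_def)
  qed
  then show ?thesis
    by (rule equiv_Id[OF S P T m(1)])
qed

text \<open>The value of the extension at a single point: \<open>W\<close> stands for the fiber and
  \<open>k\<close> for the map from it to \<open>D\<close>. Abstracting from both allows
  \<open>k\<close> to be replaced by an equal map.\<close>

definition Ext :: "('c, 'l) tm \<Rightarrow> ('c, 'l) tm \<Rightarrow> ('c, 'l) tm \<Rightarrow> ('c, 'l) tm \<Rightarrow> ('c, 'l) tm \<Rightarrow> ('c, 'l) tm" where
  "Ext E s r W k = App r (Lam E (Sg (wk W) (App (App (wk (wk s)) (App (wk (wk k)) (Var 0))) (Var 1))))"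

lemma sub_Ext [simp]: "sub t (Ext E s r W k) = Ext (sub t E) (sub t s) (sub t r) (sub t W) (sub t k)"
  by (simp add: Ext_def)

context
  fixes \<Gamma> D E s r u
  assumes S: "univalence S"
    and D: "\<Gamma> \<turnstile> D \<Colon> Univ u" and E: "\<Gamma> \<turnstile> E \<Colon> Univ u"
    and s: "\<Gamma> \<turnstile> s \<Colon> Arr D (Arr E (Univ u))" and r: "\<Gamma> \<turnstile> r \<Colon> Arr (Arr E (Univ u)) D"
begin

lemma Ext_body:
  assumes W: "\<Gamma> \<turnstile> W \<Colon> Univ u" and k: "\<Gamma> \<turnstile> k \<Colon> Arr W D"
  shows "wk W # E # \<Gamma> \<turnstile> App (App (wk (wk s)) (App (wk (wk k)) (Var 0))) (Var 1) \<Colon> Univ u"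
proof -
  note W1 = wk_Univ[OF E W]
  note c = ctx_ty[OF W1]
  have s2: "wk W # E # \<Gamma> \<turnstile> wk (wk s) \<Colon> Arr (wk (wk D)) (Arr (wk (wk E)) (Univ u))"
    and k2: "wk W # E # \<Gamma> \<turnstile> wk (wk k) \<Colon> Arr (wk (wk W)) (wk (wk D))"
    using wk_ty[OF W1 wk_ty[OF E s]] wk_ty[OF W1 wk_ty[OF E k]] by simp_all
  have v: "wk W # E # \<Gamma> \<turnstile> Var 0 \<Colon> wk (wk W)" "wk W # E # \<Gamma> \<turnstile> Var 1 \<Colon> wk (wk E)"
    by (rule var_cast[OF c]; simp)+
  show ?thesis
    by (rule arr_elim[OF arr_elim[OF s2 arr_elim[OF k2 v(1)]] v(2)])
qed

lemma Ext_family: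
  assumes W: "\<Gamma> \<turnstile> W \<Colon> Univ u" and k: "\<Gamma> \<turnstile> k \<Colon> Arr W D"
  shows "E # \<Gamma> \<turnstile> Sg (wk W) (App (App (wk (wk s)) (App (wk (wk k)) (Var 0))) (Var 1)) \<Colon> wk (Univ u)"
  using sg_form[OF wk_Univ[OF E W] Ext_body[OF W k]] by simp

lemma Ext_ty:
  assumes W: "\<Gamma> \<turnstile> W \<Colon> Univ u" and k: "\<Gamma> \<turnstile> k \<Colon> Arr W D"
  shows "\<Gamma> \<turnstile> Ext E s r W k \<Colon> D"
  unfolding Ext_def by (rule arr_elim[OF r arr_intro[OF E Ext_family[OF W k]]])

text \<open>For a constant map the sum is the product of \<open>W\<close> with \<open>s x a\<close>,
  equal to \<open>s x a\<close> because \<open>W\<close> is an inhabited proposition. Hence the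
  family is \<open>s x\<close>, and \<open>r\<close> takes it back to \<open>x\<close>.\<close>

lemma Ext_const:
  assumes H: "inh \<Gamma> (LeftInv D s r)"
    and W: "\<Gamma> \<turnstile> W \<Colon> Univ u" and hW: "inh \<Gamma> (IsProp W)" and c: "\<Gamma> \<turnstile> c \<Colon> W" and x: "\<Gamma> \<turnstile> x \<Colon> D"
  shows "inh \<Gamma> (Id D (Ext E s r W (Lam W (wk x))) x)"
proof -
  note U = univ[OF has_type_ctx(2)[OF D], of u]
  note W1 = wk_Univ[OF E W] and E1 = wk_Univ[OF E E]
  note F = arr_form[OF E U] and sx = arr_elim[OF s x]
  note k = arr_intro[OF W wk_ty[OF W x]]
  let ?\<Gamma> = "E # \<Gamma>"
  let ?T = "App (App (wk s) (wk x)) (Var 0)"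
  have v: "?\<Gamma> \<turnstile> Var 0 \<Colon> wk E"
    by (rule var_cast[OF ctx_ty[OF E]]) simp_all
  have s1: "?\<Gamma> \<turnstile> wk s \<Colon> Arr (wk D) (Arr (wk E) (Univ u))"
    using wk_ty[OF E s] by simp
  note T = arr_elim[OF arr_elim[OF s1 wk_ty[OF E x]] v]

  let ?\<Delta> = "wk W # ?\<Gamma>"
  let ?k = "Lam W (wk x)"
  note d = ctx_ty[OF W1]
  have W2: "?\<Delta> \<turnstile> wk (wk W) \<Colon> Univ u" and x2: "?\<Delta> \<turnstile> wk (wk x) \<Colon> wk (wk D)"
    using wk_Univ[OF W1 W1] wk_ty[OF W1 wk_ty[OF E x]] by simp_all
  have v2: "?\<Delta> \<turnstile> Var 0 \<Colon> wk (wk W)" "?\<Delta> \<turnstile> Var 1 \<Colon> wk (wk E)"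
    by (rule var_cast[OF d]; simp)+
  have s2: "?\<Delta> \<turnstile> wk (wk s) \<Colon> Arr (wk (wk D)) (Arr (wk (wk E)) (Univ u))"
    using wk_ty[OF W1 s1] by simp
  \<comment> \<open>Below the summation variable the constant map computes, so the summand no longer
    mentions that variable and the sum becomes a product.\<close>
  have "?\<Delta> \<turnstile> App (wk (wk ?k)) (Var 0) \<doteq> wk (wk x) \<Colon> wk (wk D)"
    using arr_beta[OF W2 wk_ty[OF W2 x2] v2(1)] by simp
  from arr_app_cong[OF arr_app_cong[OF eq_refl[OF s2] this] eq_refl[OF v2(2)]]
  have "?\<Delta> \<turnstile> App (App (wk (wk s)) (App (wk (wk ?k)) (Var 0))) (Var 1) \<doteq> wk ?T \<Colon> Univ u"
    by simp
  from sg_cong[OF W1 eq_refl[OF W1] this]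
  have b: "?\<Gamma> \<turnstile> Sg (wk W) (App (App (wk (wk s)) (App (wk (wk ?k)) (Var 0))) (Var 1)) \<doteq> Times (wk W) ?T \<Colon> Univ u"
    by (simp add: Times_def)
  let ?L = "Lam E (Sg (wk W) (App (App (wk (wk s)) (App (wk (wk ?k)) (Var 0))) (Var 1)))"
  note L = arr_intro[OF E Ext_family[OF W k]]
  have Lv: "?\<Gamma> \<turnstile> App (wk ?L) (Var 0) \<doteq> Sg (wk W) (App (App (wk (wk s)) (App (wk (wk ?k)) (Var 0))) (Var 1)) \<Colon> Univ u"
  proof -
    have "wk E # ?\<Gamma> \<turnstile> sub (Var 0 \<bullet> shift 2) (Sg (wk W) (App (App (wk (wk s)) (App (wk (wk ?k)) (Var 0))) (Var 1)))
        \<Colon> sub (Var 0 \<bullet> shift 2) (wk (Univ u))"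
      by (rule inst_shift[OF Ext_family[OF W k] var_cast[OF ctx_ty[OF E1]], of _ _ "[_, _]"]) simp_all
    then have l: "wk E # ?\<Gamma> \<turnstile> sub (Var 0 \<bullet> shift 2) (Sg (wk W) (App (App (wk (wk s)) (App (wk (wk ?k)) (Var 0))) (Var 1)))
        \<Colon> wk (Univ u)"
      by simp
    show ?thesis
      using arr_beta[OF E1 l v] by simp
  qed
  have hW1: "inh ?\<Gamma> (IsProp (wk W))"
    using inh_wk[OF E hW] by simp
  have "inh ?\<Gamma> (Id (wk (Univ u)) (App (wk ?L) (Var 0)) (App (wk (App s x)) (Var 0)))"
    using Id_conv[OF univ[OF ctx_ty[OF E]] eq_trans[OF Lv b] eq_refl[OF T]]
      Times_prop_Id[OF S W1 T hW1 wk_ty[OF E c]] by simp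
  from funext[OF S E U L sx this]
  have fe: "inh \<Gamma> (Id (Arr E (Univ u)) ?L (App s x))" .
  have t: "Arr E (Univ u) # \<Gamma> \<turnstile> App (wk r) (Var 0) \<Colon> wk D"
    using arr_elim[of _ "wk r" "wk (Arr E (Univ u))" "wk D" "Var 0"] wk_ty[OF F r] var_cast[OF ctx_ty[OF F], of 0] by simp
  have "inh \<Gamma> (Id D (Ext E s r W ?k) (App r (App s x)))"
    using inh_ap[OF F D t L sx fe] by (simp add: Ext_def)
  then show ?thesis
    by (rule inh_trans[OF D Ext_ty[OF W k] arr_elim[OF r sx] x _ leftInv_App[OF H x]])
qed

end

text \<open>Every map on a proposition equals the constant map with value \<open>App k c\<close>.
  Replacing \<open>k\<close> by it frees the summands from the summation variable, as the reduction
  to a product requires.\<close>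

lemma Ext_prop:
  assumes S: "univalence S"
    and D: "\<Gamma> \<turnstile> D \<Colon> Univ u" and E: "\<Gamma> \<turnstile> E \<Colon> Univ u"
    and s: "\<Gamma> \<turnstile> s \<Colon> Arr D (Arr E (Univ u))" and r: "\<Gamma> \<turnstile> r \<Colon> Arr (Arr E (Univ u)) D"
    and H: "inh \<Gamma> (LeftInv D s r)"
    and W: "\<Gamma> \<turnstile> W \<Colon> Univ u" and hW: "inh \<Gamma> (IsProp W)" and c: "\<Gamma> \<turnstile> c \<Colon> W"
    and k: "\<Gamma> \<turnstile> k \<Colon> Arr W D"
  shows "inh \<Gamma> (Id D (Ext E s r W k) (App k c))"
proof -
  note kc = arr_elim[OF k c]
  note K = arr_intro[OF W wk_ty[OF W kc]] and F = arr_form[OF W D]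
  note W1 = wk_Univ[OF W W] and D1 = wk_Univ[OF W D]
  have v: "W # \<Gamma> \<turnstile> Var 0 \<Colon> wk W"
    by (rule var_cast[OF ctx_ty[OF W]]) simp_all
  have k1: "W # \<Gamma> \<turnstile> wk k \<Colon> Arr (wk W) (wk D)" and hW1: "inh (W # \<Gamma>) (IsProp (wk W))"
    using wk_ty[OF W k] inh_wk[OF W hW] by simp_all
  have k2: "wk W # W # \<Gamma> \<turnstile> App (wk (wk k)) (Var 0) \<Colon> wk (wk D)"
    using arr_elim[OF _ var_cast[OF ctx_ty[OF W1], of 0]] wk_ty[OF W1 k1] by simp
  have "inh (W # \<Gamma>) (Id (wk D) (App (wk k) (Var 0)) (App (wk k) (wk c)))"
    using inh_ap[OF W1 D1 k2 v wk_ty[OF W c] isProp_elim[OF hW1 v wk_ty[OF W c]]] by simp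
  moreover have "W # \<Gamma> \<turnstile> App (wk (Lam W (wk (App k c)))) (Var 0) \<doteq> wk (App k c) \<Colon> wk D"
    using arr_beta[OF W1 wk_ty[OF W1 wk_ty[OF W kc]] v] by simp
  ultimately have "inh (W # \<Gamma>) (Id (wk D) (App (wk k) (Var 0)) (App (wk (Lam W (wk (App k c)))) (Var 0)))"
    using Id_conv[OF D1 eq_refl[OF arr_elim[OF k1 v]]] by fastforce
  note fe = funext[OF S W D k K this]
  have s1: "Arr W D # \<Gamma> \<turnstile> wk s \<Colon> Arr (wk D) (Arr (wk E) (Univ u))"
    and r1: "Arr W D # \<Gamma> \<turnstile> wk r \<Colon> Arr (Arr (wk E) (Univ u)) (wk D)"
    and f1: "Arr W D # \<Gamma> \<turnstile> Var 0 \<Colon> Arr (wk W) (wk D)"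
    using wk_ty[OF F s] wk_ty[OF F r] var_cast[OF ctx_ty[OF F], of 0] by simp_all
  note t = Ext_ty[OF S wk_Univ[OF F D] wk_Univ[OF F E] s1 r1 wk_Univ[OF F W] f1]
  have "inh \<Gamma> (Id D (Ext E s r W k) (Ext E s r W (Lam W (wk (App k c)))))"
    using inh_ap[OF F D t k K fe] by simp
  then show ?thesis
    by (rule inh_trans[OF D Ext_ty[OF S D E s r W k] Ext_ty[OF S D E s r W K] kc _
          Ext_const[OF S D E s r H W hW c kc]])
qed

section \<open>Embeddings and the extension problem\<close>

lemma isEmbedding_form:
  assumes X: "\<Gamma> \<turnstile> X \<Colon> Univ u" and Y: "\<Gamma> \<turnstile> Y \<Colon> Univ v" and f: "\<Gamma> \<turnstile> f \<Colon> Arr X Y"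
  shows "\<Gamma> \<turnstile> IsEmbedding X Y f \<Colon> Univ (sup u v)"
proof -
  have "Y # \<Gamma> \<turnstile> wk f \<Colon> Arr (wk X) (wk Y)"
    using wk_ty[OF Y f] by simp
  from isProp_form[OF fiber_form[OF wk_Univ[OF Y X] wk_Univ[OF Y Y] this var_cast[OF ctx_ty[OF Y]]], of 0]
  have "Y # \<Gamma> \<turnstile> IsProp (Fiber (wk X) (wk Y) (wk f) (Var 0)) \<Colon> Univ (sup u v)"
    by simp
  from pi_form[OF Y this] show ?thesis
    by (simp add: IsEmbedding_def sup_aci)
qed

lemma isEmbedding_elim:
  assumes "inh \<Gamma> (IsEmbedding X Y f)" "\<Gamma> \<turnstile> y \<Colon> Y"
  shows "inh \<Gamma> (IsProp (Fiber X Y f y))"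
  using inh_App[OF assms(1)[unfolded IsEmbedding_def] assms(2)] by simp

lemma embedding_family:
  assumes X: "\<Gamma> \<turnstile> X \<Colon> Univ u" and Y: "\<Gamma> \<turnstile> Y \<Colon> Univ v"
  shows "Arr X Y # \<Gamma> \<turnstile> IsEmbedding (wk X) (wk Y) (Var 0) \<Colon> Univ (sup u v)"
proof -
  note F = arr_form[OF X Y]
  show ?thesis
    by (rule isEmbedding_form[OF wk_Univ[OF F X] wk_Univ[OF F Y] var_cast[OF ctx_ty[OF F]]]) simp_all
qed

lemma embedding_form:
  assumes "\<Gamma> \<turnstile> X \<Colon> Univ u" and "\<Gamma> \<turnstile> Y \<Colon> Univ v"
  shows "\<Gamma> \<turnstile> Embedding X Y \<Colon> Univ (sup u v)"
  unfolding Embedding_def using sg_form[OF arr_form[OF assms] embedding_family[OF assms]] by simp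

text \<open>The innermost sum of \<open>AInjective\<close>, with an arbitrary map \<open>j\<close>
  in place of the first projection of an embedding. Its parameters can be instantiated without
  touching de Bruijn indices.\<close>

definition Extension ::
    "('c, 'l) tm \<Rightarrow> ('c, 'l) tm \<Rightarrow> ('c, 'l) tm \<Rightarrow> ('c, 'l) tm \<Rightarrow> ('c, 'l) tm \<Rightarrow> ('c, 'l) tm" where
  "Extension D X Y j f = Sg (Arr Y D)
     (Pi (wk X) (Id (wk (wk D)) (App (Var 1) (App (wk (wk j)) (Var 0))) (App (wk (wk f)) (Var 0))))"

lemma extension_family:
  assumes D: "\<Gamma> \<turnstile> D \<Colon> Univ w" and X: "\<Gamma> \<turnstile> X \<Colon> Univ u" and Y: "\<Gamma> \<turnstile> Y \<Colon> Univ v"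
    and j: "\<Gamma> \<turnstile> j \<Colon> Arr X Y" and f: "\<Gamma> \<turnstile> f \<Colon> Arr X D"
  shows "Arr Y D # \<Gamma> \<turnstile> Pi (wk X) (Id (wk (wk D)) (App (Var 1) (App (wk (wk j)) (Var 0))) (App (wk (wk f)) (Var 0)))
    \<Colon> Univ (sup u w)"
proof -
  note F = arr_form[OF Y D]
  note X1 = wk_Univ[OF F X]
  let ?\<Delta> = "wk X # Arr Y D # \<Gamma>"
  have D2: "?\<Delta> \<turnstile> wk (wk D) \<Colon> Univ w"
    by (rule wk_Univ[OF X1 wk_Univ[OF F D]])
  have t: "?\<Delta> \<turnstile> wk (wk j) \<Colon> Arr (wk (wk X)) (wk (wk Y))" "?\<Delta> \<turnstile> wk (wk f) \<Colon> Arr (wk (wk X)) (wk (wk D))"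
    using wk_ty[OF X1 wk_ty[OF F j]] wk_ty[OF X1 wk_ty[OF F f]] by simp_all
  have v: "?\<Delta> \<turnstile> Var 0 \<Colon> wk (wk X)" "?\<Delta> \<turnstile> Var 1 \<Colon> Arr (wk (wk Y)) (wk (wk D))"
    by (rule var_cast[OF ctx_ty[OF X1]]; simp)+
  show ?thesis
    by (rule pi_form[OF X1 id_form[OF D2 arr_elim[OF v(2) arr_elim[OF t(1) v(1)]] arr_elim[OF t(2) v(1)]]])
qed

lemma AInjective_Extension:
  "AInjective u v D = Pi (Univ u) (Pi (Univ v) (Pi (Embedding (Var 1) (Var 0)) (Pi (Arr (Var 2) (sub (shift 3) D))
    (Extension (sub (shift 4) D) (Var 3) (Var 2) (Fst (Arr (Var 3) (Var 2)) (Var 1)) (Var 0)))))"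
  by (simp add: AInjective_def Extension_def funpow_Suc_right numeral_eq_Suc)

lemma sub_Extension [simp]:
  "sub s (Extension D X Y j f) = Extension (sub s D) (sub s X) (sub s Y) (sub s j) (sub s f)"
  by (simp add: Extension_def)

lemma embedding_Fst:
  assumes X: "\<Gamma> \<turnstile> X \<Colon> Univ u" and Y: "\<Gamma> \<turnstile> Y \<Colon> Univ v" and e: "\<Gamma> \<turnstile> e \<Colon> Embedding X Y"
  shows "\<Gamma> \<turnstile> Fst (Arr X Y) e \<Colon> Arr X Y" and "inh \<Gamma> (IsEmbedding X Y (Fst (Arr X Y) e))"
  using Fst(1)[OF arr_form[OF X Y] embedding_family[OF X Y] e[unfolded Embedding_def]]
    inh_Snd[OF arr_form[OF X Y] embedding_family[OF X Y] e[unfolded Embedding_def]] by simp_all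

text \<open>Under the first four binders of \<open>AInjective\<close> the variables 3, 2, 1 and 0
  are \<open>X\<close>, \<open>Y\<close>, the embedding and \<open>f\<close>. Both the formation of
  the type and its introduction from a retract start from these typings.\<close>

lemma AInjective_ctx:
  fixes u v :: "'l::ulevel"
  assumes D: "\<Gamma> \<turnstile> D \<Colon> Univ w"
  defines "\<Gamma>1 \<equiv> Univ u # \<Gamma>" and "\<Gamma>2 \<equiv> Univ v # Univ u # \<Gamma>"
    and "\<Gamma>3 \<equiv> Embedding (Var 1) (Var 0) # Univ v # Univ u # \<Gamma>"
    and "\<Gamma>4 \<equiv> Arr (Var 2) (sub (shift 3) D) # Embedding (Var 1) (Var 0) # Univ v # Univ u # \<Gamma>"
  shows "\<Gamma> \<turnstile> Univ u \<Colon> Univ (usuc u)" and "\<Gamma>1 \<turnstile> Univ v \<Colon> Univ (usuc v)"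
    and "\<Gamma>2 \<turnstile> Embedding (Var 1) (Var 0) \<Colon> Univ (sup u v)"
    and "\<Gamma>3 \<turnstile> Arr (Var 2) (sub (shift 3) D) \<Colon> Univ (sup u w)"
    and "\<Gamma>4 ctx"
    and "\<Gamma>4 \<turnstile> sub (shift 4) D \<Colon> Univ w"
    and "\<Gamma>4 \<turnstile> Var 3 \<Colon> Univ u" and "\<Gamma>4 \<turnstile> Var 2 \<Colon> Univ v"
    and "\<Gamma>4 \<turnstile> Fst (Arr (Var 3) (Var 2)) (Var 1) \<Colon> Arr (Var 3) (Var 2)"
    and "inh \<Gamma>4 (IsEmbedding (Var 3) (Var 2) (Fst (Arr (Var 3) (Var 2)) (Var 1)))"
    and "\<Gamma>4 \<turnstile> Var 0 \<Colon> Arr (Var 3) (sub (shift 4) D)"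
proof -
  show U: "\<Gamma> \<turnstile> Univ u \<Colon> Univ (usuc u)"
    by (rule univ[OF has_type_ctx(2)[OF D]])
  show V: "\<Gamma>1 \<turnstile> Univ v \<Colon> Univ (usuc v)"
    unfolding \<Gamma>1_def by (rule univ[OF ctx_ty[OF U]])
  have c2: "\<Gamma>2 ctx"
    unfolding \<Gamma>2_def by (rule ctx_ty[OF V[unfolded \<Gamma>1_def]])
  have v2: "\<Gamma>2 \<turnstile> Var 1 \<Colon> Univ u" "\<Gamma>2 \<turnstile> Var 0 \<Colon> Univ v"
    by (rule var_cast[OF c2]; simp add: \<Gamma>2_def)+
  show M: "\<Gamma>2 \<turnstile> Embedding (Var 1) (Var 0) \<Colon> Univ (sup u v)"
    by (rule embedding_form[OF v2])
  have c3: "\<Gamma>3 ctx"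
    unfolding \<Gamma>3_def by (rule ctx_ty[OF M[unfolded \<Gamma>2_def]])
  have v3: "\<Gamma>3 \<turnstile> Var 2 \<Colon> Univ u"
    by (rule var_cast[OF c3]; simp add: \<Gamma>3_def)
  have D3: "\<Gamma>3 \<turnstile> sub (shift 3) D \<Colon> Univ w"
    using weaken[OF D c3, of "[_, _, _]" 3] by (simp add: \<Gamma>3_def)
  show A: "\<Gamma>3 \<turnstile> Arr (Var 2) (sub (shift 3) D) \<Colon> Univ (sup u w)"
    by (rule arr_form[OF v3 D3])
  show c4: "\<Gamma>4 ctx"
    unfolding \<Gamma>4_def by (rule ctx_ty[OF A[unfolded \<Gamma>3_def]])
  show "\<Gamma>4 \<turnstile> sub (shift 4) D \<Colon> Univ w"
    using weaken[OF D c4, of "[_, _, _, _]" 4] by (simp add: \<Gamma>4_def)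
  show X: "\<Gamma>4 \<turnstile> Var 3 \<Colon> Univ u" and Y: "\<Gamma>4 \<turnstile> Var 2 \<Colon> Univ v"
    and "\<Gamma>4 \<turnstile> Var 0 \<Colon> Arr (Var 3) (sub (shift 4) D)"
    by (rule var_cast[OF c4]; simp add: \<Gamma>4_def)+
  have e: "\<Gamma>4 \<turnstile> Var 1 \<Colon> Embedding (Var 3) (Var 2)"
    by (rule var_cast[OF c4]; simp add: \<Gamma>4_def)
  show "\<Gamma>4 \<turnstile> Fst (Arr (Var 3) (Var 2)) (Var 1) \<Colon> Arr (Var 3) (Var 2)"
    and "inh \<Gamma>4 (IsEmbedding (Var 3) (Var 2) (Fst (Arr (Var 3) (Var 2)) (Var 1)))"
    by (rule embedding_Fst[OF X Y e])+
qed

text \<open>The level is existential, as it merely has to exist for the arrow types of the logical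
  equivalence to be formed.\<close>

lemma AInjective_form:
  assumes D: "\<Gamma> \<turnstile> D \<Colon> Univ w"
  shows "\<exists>l. \<Gamma> \<turnstile> AInjective u v D \<Colon> Univ l"
proof -
  note c = AInjective_ctx[OF D]
  show ?thesis
    unfolding AInjective_Extension Extension_def
    by (rule exI, rule pi_form[OF c(1) pi_form[OF c(2) pi_form[OF c(3) pi_form[OF c(4)
      sg_form[OF arr_form[OF c(8,6)] extension_family[OF c(6,7,8,9,11)]]]]]])
qed

lemma AInjective_elim:
  assumes I: "\<Gamma> \<turnstile> I \<Colon> AInjective u v D"
    and X: "\<Gamma> \<turnstile> X \<Colon> Univ u" and Y: "\<Gamma> \<turnstile> Y \<Colon> Univ v" and e: "\<Gamma> \<turnstile> e \<Colon> Embedding X Y"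
    and f: "\<Gamma> \<turnstile> f \<Colon> Arr X D"
  shows "\<Gamma> \<turnstile> App (App (App (App I X) Y) e) f \<Colon> Extension D X Y (Fst (Arr X Y) e) f"
proof -
  have i: "\<Gamma> \<turnstile> App (App I X) Y \<Colon> Pi (Embedding X Y) (Pi (Arr (wk X) (wk D))
      (Extension (wk (wk D)) (wk (wk X)) (wk (wk Y)) (Fst (Arr (wk (wk X)) (wk (wk Y))) (Var 1)) (Var 0)))"
    using pi_elim[OF pi_elim[OF I[unfolded AInjective_Extension] X, simplified] Y] by simp
  show ?thesis
    using pi_elim[OF pi_elim[OF i e, simplified] f] by simp
qed

definition FibMap ::
    "('c, 'l) tm \<Rightarrow> ('c, 'l) tm \<Rightarrow> ('c, 'l) tm \<Rightarrow> ('c, 'l) tm \<Rightarrow> ('c, 'l) tm \<Rightarrow> ('c, 'l) tm" where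
  "FibMap X Y j f y = Lam (Fiber X Y j y) (App (wk f) (Fst (wk X) (Var 0)))"

lemma sub_FibMap [simp]:
  "sub s (FibMap X Y j f y) = FibMap (sub s X) (sub s Y) (sub s j) (sub s f) (sub s y)"
  by (simp add: FibMap_def)

lemma fibMap:
  assumes X: "\<Gamma> \<turnstile> X \<Colon> Univ u" and Y: "\<Gamma> \<turnstile> Y \<Colon> Univ v" and j: "\<Gamma> \<turnstile> j \<Colon> Arr X Y"
    and f: "\<Gamma> \<turnstile> f \<Colon> Arr X D" and y: "\<Gamma> \<turnstile> y \<Colon> Y"
  shows "\<Gamma> \<turnstile> FibMap X Y j f y \<Colon> Arr (Fiber X Y j y) D"
    and "\<Gamma> \<turnstile> x \<Colon> X \<Longrightarrow> \<Gamma> \<turnstile> p \<Colon> Id Y (App j x) y \<Longrightarrow>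
      \<Gamma> \<turnstile> Pr (Id (wk Y) (App (wk j) (Var 0)) (wk y)) x p \<Colon> Fiber X Y j y"
    and "\<Gamma> \<turnstile> x \<Colon> X \<Longrightarrow> \<Gamma> \<turnstile> p \<Colon> Id Y (App j x) y \<Longrightarrow>
      \<Gamma> \<turnstile> App (FibMap X Y j f y) (Pr (Id (wk Y) (App (wk j) (Var 0)) (wk y)) x p) \<doteq> App f x \<Colon> D"
proof -
  note F = fiber_form[OF X Y j y] and fam = fiber_family[OF X Y j y]
  let ?\<Delta> = "Fiber X Y j y # \<Gamma>"
  have t: "?\<Delta> \<turnstile> wk j \<Colon> Arr (wk X) (wk Y)" "?\<Delta> \<turnstile> wk f \<Colon> Arr (wk X) (wk D)"
    using wk_ty[OF F j] wk_ty[OF F f] by simp_all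
  note X1 = wk_Univ[OF F X] and fam1 = fiber_family[OF wk_Univ[OF F X] wk_Univ[OF F Y] t(1) wk_ty[OF F y]]
  have v: "?\<Delta> \<turnstile> Var 0 \<Colon> Sg (wk X) (Id (wk (wk Y)) (App (wk (wk j)) (Var 0)) (wk (wk y)))"
    by (rule var_cast[OF ctx_ty[OF F]]) (simp_all add: Fiber_def)
  have b: "?\<Delta> \<turnstile> App (wk f) (Fst (wk X) (Var 0)) \<Colon> wk D"
    by (rule arr_elim[OF t(2) Fst(1)[OF X1 fam1 v]])
  show "\<Gamma> \<turnstile> FibMap X Y j f y \<Colon> Arr (Fiber X Y j y) D"
    unfolding FibMap_def by (rule arr_intro[OF F b])
  assume x: "\<Gamma> \<turnstile> x \<Colon> X" and p: "\<Gamma> \<turnstile> p \<Colon> Id Y (App j x) y"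
  have p': "\<Gamma> \<turnstile> p \<Colon> sub (x \<bullet> Var) (Id (wk Y) (App (wk j) (Var 0)) (wk y))"
    using p by simp
  show P: "\<Gamma> \<turnstile> Pr (Id (wk Y) (App (wk j) (Var 0)) (wk y)) x p \<Colon> Fiber X Y j y"
    unfolding Fiber_def by (rule sg_intro[OF fam x p'])
  show "\<Gamma> \<turnstile> App (FibMap X Y j f y) (Pr (Id (wk Y) (App (wk j) (Var 0)) (wk y)) x p) \<doteq> App f x \<Colon> D"
    using eq_trans[OF arr_beta[OF F b P, simplified] arr_app_cong[OF eq_refl[OF f] Fst(2)[OF X fam x p'], simplified]]
    by (simp add: FibMap_def)
qed

lemma extension_of_retract:
  assumes S: "univalence S"
    and D: "\<Gamma> \<turnstile> D \<Colon> Univ u" and E: "\<Gamma> \<turnstile> E \<Colon> Univ u"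
    and s: "\<Gamma> \<turnstile> s \<Colon> Arr D (Arr E (Univ u))" and r: "\<Gamma> \<turnstile> r \<Colon> Arr (Arr E (Univ u)) D"
    and H: "inh \<Gamma> (LeftInv D s r)"
    and X: "\<Gamma> \<turnstile> X \<Colon> Univ u" and Y: "\<Gamma> \<turnstile> Y \<Colon> Univ u"
    and j: "\<Gamma> \<turnstile> j \<Colon> Arr X Y" and hj: "inh \<Gamma> (IsEmbedding X Y j)" and f: "\<Gamma> \<turnstile> f \<Colon> Arr X D"
  shows "inh \<Gamma> (Extension D X Y j f)"
proof -
  let ?g = "Lam Y (Ext (wk E) (wk s) (wk r) (Fiber (wk X) (wk Y) (wk j) (Var 0))
    (FibMap (wk X) (wk Y) (wk j) (wk f) (Var 0)))"
  \<comment> \<open>All data are weakened by one variable, which is a point of \<open>Y\<close> when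
    the extension is defined and a point of \<open>X\<close> when it is compared with
    \<open>f\<close>.\<close>
  have w: "A # \<Gamma> \<turnstile> wk D \<Colon> Univ u" "A # \<Gamma> \<turnstile> wk E \<Colon> Univ u"
    "A # \<Gamma> \<turnstile> wk s \<Colon> Arr (wk D) (Arr (wk E) (Univ u))" "A # \<Gamma> \<turnstile> wk r \<Colon> Arr (Arr (wk E) (Univ u)) (wk D)"
    "inh (A # \<Gamma>) (LeftInv (wk D) (wk s) (wk r))"
    "A # \<Gamma> \<turnstile> wk X \<Colon> Univ u" "A # \<Gamma> \<turnstile> wk Y \<Colon> Univ u" "A # \<Gamma> \<turnstile> wk j \<Colon> Arr (wk X) (wk Y)"
    "inh (A # \<Gamma>) (IsEmbedding (wk X) (wk Y) (wk j))" "A # \<Gamma> \<turnstile> wk f \<Colon> Arr (wk X) (wk D)"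
    if "\<Gamma> \<turnstile> A \<Colon> Univ u" for A
    using wk_ty[OF that D] wk_ty[OF that E] wk_ty[OF that s] wk_ty[OF that r] inh_wk[OF that H]
      wk_ty[OF that X] wk_ty[OF that Y] wk_ty[OF that j] inh_wk[OF that hj] wk_ty[OF that f] by simp_all
  have vY: "Y # \<Gamma> \<turnstile> Var 0 \<Colon> wk Y"
    by (rule var_cast[OF ctx_ty[OF Y]]) simp_all
  note W = fiber_form[OF w(6,7,8)[OF Y] vY, simplified sup_idem]
  note k = fibMap(1)[OF w(6,7,8,10)[OF Y] vY]
  have b: "Y # \<Gamma> \<turnstile> Ext (wk E) (wk s) (wk r) (Fiber (wk X) (wk Y) (wk j) (Var 0))
      (FibMap (wk X) (wk Y) (wk j) (wk f) (Var 0)) \<Colon> wk D"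
    by (rule Ext_ty[OF S w(1,2,3,4)[OF Y] W k])
  note g = arr_intro[OF Y b]

  have vX: "X # \<Gamma> \<turnstile> Var 0 \<Colon> wk X"
    by (rule var_cast[OF ctx_ty[OF X]]) simp_all
  let ?y = "App (wk j) (Var 0)"
  have y: "X # \<Gamma> \<turnstile> ?y \<Colon> wk Y"
    by (rule arr_elim[OF w(8)[OF X] vX])
  note y' = id_intro[OF y]
  note fm = fibMap[OF w(6,7,8,10)[OF X] y]
  \<comment> \<open>The canonical point of the fiber over \<open>j x\<close>. There
    \<open>FibMap\<close> computes to \<open>f x\<close>, so that the path delivered by
    \<open>Ext_prop\<close> ends at the right place.\<close>
  let ?c = "Pr (Id (wk (wk Y)) (App (wk (wk j)) (Var 0)) (wk ?y)) (Var 0) (Refl ?y)"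
  note Wy = fiber_form[OF w(6,7,8)[OF X] y, simplified sup_idem]
  have e: "inh (X # \<Gamma>) (Id (wk D) (Ext (wk E) (wk s) (wk r) (Fiber (wk X) (wk Y) (wk j) ?y)
      (FibMap (wk X) (wk Y) (wk j) (wk f) ?y)) (App (FibMap (wk X) (wk Y) (wk j) (wk f) ?y) ?c))"
    by (rule Ext_prop[OF S w(1,2,3,4,5)[OF X] Wy isEmbedding_elim[OF w(9)[OF X] y] fm(2)[OF vX y'] fm(1)])
  note Y1 = wk_Univ[OF X Y]
  have "wk Y # X # \<Gamma> \<turnstile> sub (Var 0 \<bullet> shift 2) (Ext (wk E) (wk s) (wk r) (Fiber (wk X) (wk Y) (wk j) (Var 0))
      (FibMap (wk X) (wk Y) (wk j) (wk f) (Var 0))) \<Colon> sub (Var 0 \<bullet> shift 2) (wk D)"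
    by (rule inst_shift[OF b var_cast[OF ctx_ty[OF Y1]], of _ _ "[_, _]"]) simp_all
  then have "X # \<Gamma> \<turnstile> App (wk ?g) ?y \<doteq> Ext (wk E) (wk s) (wk r) (Fiber (wk X) (wk Y) (wk j) ?y)
      (FibMap (wk X) (wk Y) (wk j) (wk f) ?y) \<Colon> wk D"
    using arr_beta[OF Y1 _ y, of "sub (Var 0 \<bullet> shift 2) (Ext (wk E) (wk s) (wk r) (Fiber (wk X) (wk Y) (wk j) (Var 0))
      (FibMap (wk X) (wk Y) (wk j) (wk f) (Var 0)))" "wk D"] by simp
  from Id_conv[OF w(1)[OF X] this eq_sym[OF fm(3)[OF vX y']]] e
  have "inh (X # \<Gamma>) (Id (wk D) (App (wk ?g) ?y) (App (wk f) (Var 0)))"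
    by blast
  then have "inh \<Gamma> (Pi X (Id (wk D) (App (wk ?g) ?y) (App (wk f) (Var 0))))"
    by (rule inh_Lam[OF X])
  then show ?thesis
    unfolding Extension_def by (intro inh_Pr[OF extension_family[OF D X Y j f] g]) simp
qed

lemma retract_AInjective:
  assumes S: "univalence S"
    and D: "\<Gamma> \<turnstile> D \<Colon> Univ u" and E: "\<Gamma> \<turnstile> E \<Colon> Univ u"
    and s: "\<Gamma> \<turnstile> s \<Colon> Arr D (Arr E (Univ u))" and r: "\<Gamma> \<turnstile> r \<Colon> Arr (Arr E (Univ u)) D"
    and H: "inh \<Gamma> (LeftInv D s r)"
  shows "inh \<Gamma> (AInjective u u D)"
proof -
  note c = AInjective_ctx[OF D] and c5 = AInjective_ctx(5)[OF D, of u u]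
  let ?\<Gamma>4 = "Arr (Var 2) (sub (shift 3) D) # Embedding (Var 1) (Var 0) # Univ u # Univ u # \<Gamma>"
  have "?\<Gamma>4 \<turnstile> sub (shift 4) E \<Colon> Univ u"
    "?\<Gamma>4 \<turnstile> sub (shift 4) s \<Colon> Arr (sub (shift 4) D) (Arr (sub (shift 4) E) (Univ u))"
    "?\<Gamma>4 \<turnstile> sub (shift 4) r \<Colon> Arr (Arr (sub (shift 4) E) (Univ u)) (sub (shift 4) D)"
    "inh ?\<Gamma>4 (LeftInv (sub (shift 4) D) (sub (shift 4) s) (sub (shift 4) r))"
    using weaken[OF E c5, of "[_, _, _, _]" 4] weaken[OF s c5, of "[_, _, _, _]" 4]
      weaken[OF r c5, of "[_, _, _, _]" 4] inh_weaken[OF H c5, of "[_, _, _, _]" 4] by simp_all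
  from extension_of_retract[OF S c(6) this c(7-11)]
  show ?thesis
    unfolding AInjective_Extension by (intro inh_Lam[OF c(1)] inh_Lam[OF c(2)] inh_Lam[OF c(3)] inh_Lam[OF c(4)])
qed

section \<open>Retracts of powers as types\<close>

lemma retract_family:
  assumes A: "\<Gamma> \<turnstile> A \<Colon> Univ u" and B: "\<Gamma> \<turnstile> B \<Colon> Univ v"
  shows "wk (Arr B A) # Arr A B # \<Gamma> \<turnstile> LeftInv (wk (wk A)) (Var 1) (Var 0) \<Colon> Univ u"
    and "Arr A B # \<Gamma> \<turnstile> Sg (wk (Arr B A)) (LeftInv (wk (wk A)) (Var 1) (Var 0)) \<Colon> Univ (sup u v)"
proof -
  note F = arr_form[OF A B] and G = arr_form[OF B A]
  note G1 = wk_Univ[OF F G]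
  have A2: "wk (Arr B A) # Arr A B # \<Gamma> \<turnstile> wk (wk A) \<Colon> Univ u"
    by (rule wk_Univ[OF G1 wk_Univ[OF F A]])
  have v: "wk (Arr B A) # Arr A B # \<Gamma> \<turnstile> Var 1 \<Colon> Arr (wk (wk A)) (wk (wk B))"
    "wk (Arr B A) # Arr A B # \<Gamma> \<turnstile> Var 0 \<Colon> Arr (wk (wk B)) (wk (wk A))"
    by (rule var_cast[OF ctx_ty[OF G1]]; simp)+
  show L: "wk (Arr B A) # Arr A B # \<Gamma> \<turnstile> LeftInv (wk (wk A)) (Var 1) (Var 0) \<Colon> Univ u"
    by (rule leftInv_form[OF A2 v])
  show "Arr A B # \<Gamma> \<turnstile> Sg (wk (Arr B A)) (LeftInv (wk (wk A)) (Var 1) (Var 0)) \<Colon> Univ (sup u v)"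
    using sg_form[OF G1 L] by (simp add: sup_aci)
qed

lemma retract_form:
  assumes "\<Gamma> \<turnstile> A \<Colon> Univ u" "\<Gamma> \<turnstile> B \<Colon> Univ v"
  shows "\<Gamma> \<turnstile> RetractOf A B \<Colon> Univ (sup u v)"
  unfolding RetractOf_def using sg_form[OF arr_form[OF assms] retract_family(2)[OF assms]] by simp

lemma retractE:
  assumes A: "\<Gamma> \<turnstile> A \<Colon> Univ u" and B: "\<Gamma> \<turnstile> B \<Colon> Univ v" and z: "inh \<Gamma> (RetractOf A B)"
  obtains s r where "\<Gamma> \<turnstile> s \<Colon> Arr A B" "\<Gamma> \<turnstile> r \<Colon> Arr B A" "inh \<Gamma> (LeftInv A s r)"
proof -
  note F = arr_form[OF A B] and fam = retract_family(2)[OF A B]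
  obtain z where z: "\<Gamma> \<turnstile> z \<Colon> Sg (Arr A B) (Sg (wk (Arr B A)) (LeftInv (wk (wk A)) (Var 1) (Var 0)))"
    using z unfolding RetractOf_def by (rule inhE)
  let ?s = "Fst (Arr A B) z"
  note s = Fst(1)[OF F fam z]
  have "inh \<Gamma> (Sg (Arr B A) (LeftInv (wk A) (wk ?s) (Var 0)))"
    using inh_Snd[OF F fam z] by simp
  then obtain y where y: "\<Gamma> \<turnstile> y \<Colon> Sg (Arr B A) (LeftInv (wk A) (wk ?s) (Var 0))"
    by (rule inhE)
  note sec = sections_form(2)[OF A B s]
  have "inh \<Gamma> (LeftInv A ?s (Fst (Arr B A) y))"
    using inh_Snd[OF arr_form[OF B A] sec y] by simp
  with s Fst(1)[OF arr_form[OF B A] sec y] show thesis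
    by (rule that)
qed

lemma inh_RetractOf:
  assumes A: "\<Gamma> \<turnstile> A \<Colon> Univ u" and B: "\<Gamma> \<turnstile> B \<Colon> Univ v"
    and s: "\<Gamma> \<turnstile> s \<Colon> Arr A B" and r: "\<Gamma> \<turnstile> r \<Colon> Arr B A" and h: "inh \<Gamma> (LeftInv A s r)"
  shows "inh \<Gamma> (RetractOf A B)"
proof -
  have "inh \<Gamma> (Sg (Arr B A) (LeftInv (wk A) (wk s) (Var 0)))"
    by (rule inh_Pr[OF sections_form(2)[OF A B s] r]) (use h in simp)
  then show ?thesis
    unfolding RetractOf_def by (intro inh_Pr[OF retract_family(2)[OF A B] s]) simp
qed

lemma power_family:
  assumes D: "\<Gamma> \<turnstile> D \<Colon> Univ u"
  shows "Univ u # \<Gamma> \<turnstile> RetractOf (wk D) (Arr (Var 0) (Univ u)) \<Colon> Univ (usuc u)"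
proof -
  note U = univ[OF has_type_ctx(2)[OF D], of u]
  have v: "Univ u # \<Gamma> \<turnstile> Var 0 \<Colon> Univ u"
    by (rule var_cast[OF ctx_ty[OF U]]) simp_all
  show ?thesis
    using retract_form[OF wk_Univ[OF U D] arr_form[OF v univ[OF ctx_ty[OF U], of u]]] by simp
qed

lemma RetractOfPower_form:
  assumes D: "\<Gamma> \<turnstile> D \<Colon> Univ u"
  shows "\<Gamma> \<turnstile> RetractOfPower u D \<Colon> Univ (usuc u)"
  unfolding RetractOfPower_def using sg_form[OF univ[OF has_type_ctx(2)[OF D]] power_family[OF D]] by simp

lemma AInjective_if_RetractOfPower:
  assumes S: "univalence S" and D: "\<Gamma> \<turnstile> D \<Colon> Univ u" and z: "inh \<Gamma> (RetractOfPower u D)"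
  shows "inh \<Gamma> (AInjective u u D)"
proof -
  note U = univ[OF has_type_ctx(2)[OF D], of u] and fam = power_family[OF D]
  obtain z where z: "\<Gamma> \<turnstile> z \<Colon> Sg (Univ u) (RetractOf (wk D) (Arr (Var 0) (Univ u)))"
    using z unfolding RetractOfPower_def by (rule inhE)
  note E = Fst(1)[OF U fam z]
  have "inh \<Gamma> (RetractOf D (Arr (Fst (Univ u) z) (Univ u)))"
    using inh_Snd[OF U fam z] by simp
  then show ?thesis
    by (rule retractE[OF D arr_form[OF E U]]) (rule retract_AInjective[OF S D E])
qed

section \<open>Injective types are retracts of powers of the universe\<close>

text \<open>Flabbiness: a partial element of \<open>D\<close>, defined on a proposition
  \<open>P\<close>, extends to a total one. The map from \<open>P\<close> to the unit type is an
  embedding as a map between propositions, and the total element is the value at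
  \<open>Star u\<close> of the extension along it.\<close>

lemma AInjective_flabby:
  assumes D: "\<Gamma> \<turnstile> D \<Colon> Univ u" and I: "\<Gamma> \<turnstile> I \<Colon> AInjective u u D"
    and P: "\<Gamma> \<turnstile> P \<Colon> Univ u" and hP: "inh \<Gamma> (IsProp P)" and f: "\<Gamma> \<turnstile> f \<Colon> Arr P D"
  obtains d where "\<Gamma> \<turnstile> d \<Colon> D" "inh \<Gamma> (Pi P (Id (wk D) (wk d) (App (wk f) (Var 0))))"
proof -
  note c = has_type_ctx(2)[OF D]
  note O = one_form[OF c, of u]
  let ?O = "One u" and ?j = "Lam P (Star u)"
  have st: "P' # \<Delta> \<turnstile> Star u \<Colon> wk (One u)" if "\<Delta> \<turnstile> P' \<Colon> Univ u" for \<Delta> P'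
    using one_intro[OF ctx_ty[OF that]] by simp
  note j = arr_intro[OF P st[OF P]]
  have "inh (?O # \<Gamma>) (IsProp (Fiber (wk P) ?O (wk ?j) (Var 0)))"
    using isProp_Fiber[OF wk_Univ[OF O P] one_form[OF ctx_ty[OF O]] _ var_cast[OF ctx_ty[OF O]] _ isProp_One[OF ctx_ty[OF O]]]
      wk_ty[OF O j] inh_wk[OF O hP] by simp
  then have "inh \<Gamma> (IsEmbedding P ?O ?j)"
    unfolding IsEmbedding_def by (intro inh_Lam[OF O]) simp
  then obtain m where m: "\<Gamma> \<turnstile> m \<Colon> IsEmbedding P ?O ?j"
    by (rule inhE)
  then have m': "\<Gamma> \<turnstile> m \<Colon> sub (?j \<bullet> Var) (IsEmbedding (wk P) (wk ?O) (Var 0))"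
    by simp
  let ?e = "Pr (IsEmbedding (wk P) (wk ?O) (Var 0)) ?j m" and ?F = "Arr P ?O"
  note F = arr_form[OF P O] and emb = embedding_family[OF P O]
  have e: "\<Gamma> \<turnstile> ?e \<Colon> Embedding P ?O"
    unfolding Embedding_def by (rule sg_intro[OF emb j m'])
  let ?G = "App (App (App (App I P) ?O) ?e) f"
  let ?d = "App (Fst (Arr ?O D) ?G) (Star u)"
  have fam: "Arr ?O D # \<Gamma> \<turnstile> Pi (wk P) (Id (wk (wk D)) (App (Var 1) (App (wk (wk (Fst ?F ?e))) (Var 0)))
      (App (wk (wk f)) (Var 0))) \<Colon> Univ (sup u u)"
    by (rule extension_family[OF D P O embedding_Fst(1)[OF P O e] f])
  note G = AInjective_elim[OF I P O e f, unfolded Extension_def]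
  note OD = arr_form[OF O D]
  note g = Fst(1)[OF OD fam G]
  note d = arr_elim[OF g one_intro[OF c]]
  have 1: "inh \<Gamma> (Pi P (Id (wk D) (App (wk (Fst (Arr ?O D) ?G)) (App (wk (Fst ?F ?e)) (Var 0))) (App (wk f) (Var 0))))"
    using inh_Snd[OF OD fam G] by simp
  have v: "P # \<Gamma> \<turnstile> Var 0 \<Colon> wk P"
    by (rule var_cast[OF ctx_ty[OF P]]) simp_all
  \<comment> \<open>The embedding handed to \<open>I\<close> is a pair whose first projection
    computes to the constant map, so that the extension property speaks about the single value
    \<open>?d\<close>.\<close>
  have e1: "P # \<Gamma> \<turnstile> wk (Fst ?F ?e) \<doteq> wk ?j \<Colon> Arr (wk P) ?O"
    using wk_eqtm[OF P Fst(2)[OF F emb j m']] by simp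
  have "P # \<Gamma> \<turnstile> App (wk ?j) (Var 0) \<doteq> Star u \<Colon> ?O"
    using arr_beta[OF wk_Univ[OF P P] st[OF wk_Univ[OF P P]] v] by simp
  from eq_trans[OF arr_app_cong[OF e1 eq_refl[OF v]] this]
  have 2: "P # \<Gamma> \<turnstile> App (wk (Fst ?F ?e)) (Var 0) \<doteq> Star u \<Colon> ?O" .
  have g1: "P # \<Gamma> \<turnstile> wk (Fst (Arr ?O D) ?G) \<Colon> Arr ?O (wk D)" and f1: "P # \<Gamma> \<turnstile> wk f \<Colon> Arr (wk P) (wk D)"
    using wk_ty[OF P g] wk_ty[OF P f] by simp_all
  have "inh \<Gamma> (Pi P (Id (wk D) (wk ?d) (App (wk f) (Var 0))))"
    using inh_conv[OF 1 pi_cong[OF P eq_refl[OF P] id_cong[OF eq_refl[OF wk_Univ[OF P D]]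
        arr_app_cong[OF eq_refl[OF g1] 2] eq_refl[OF arr_elim[OF f1 v]]]]] by simp
  with d show thesis
    by (rule that)
qed

section \<open>Contractibility as a proposition\<close>

lemma isProp_Arr:
  assumes S: "univalence S" and A: "\<Gamma> \<turnstile> A \<Colon> Univ u" and B: "\<Gamma> \<turnstile> B \<Colon> Univ v" and h: "inh \<Gamma> (IsProp B)"
  shows "inh \<Gamma> (IsProp (Arr A B))"
proof (rule isProp_intro)
  show F: "\<Gamma> \<turnstile> Arr A B \<Colon> Univ (sup u v)"
    by (rule arr_form[OF A B])
  let ?\<Delta> = "wk (Arr A B) # Arr A B # \<Gamma>" and ?A = "sub (shift 2) A" and ?B = "sub (shift 2) B"
  note c = ctx_ty[OF wk_Univ[OF F F]]
  have A2: "?\<Delta> \<turnstile> ?A \<Colon> Univ u" and B2: "?\<Delta> \<turnstile> ?B \<Colon> Univ v"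
    using weaken[OF A c, of "[_, _]" 2] weaken[OF B c, of "[_, _]" 2] by simp_all
  have v: "?\<Delta> \<turnstile> Var 1 \<Colon> Arr ?A ?B" "?\<Delta> \<turnstile> Var 0 \<Colon> Arr ?A ?B"
    by (rule var_cast[OF c]; simp)+
  note d = ctx_ty[OF A2]
  have w: "?A # ?\<Delta> \<turnstile> wk (Var 1) \<Colon> Arr (wk ?A) (wk ?B)" "?A # ?\<Delta> \<turnstile> wk (Var 0) \<Colon> Arr (wk ?A) (wk ?B)"
    using wk_ty[OF A2 v(1)] wk_ty[OF A2 v(2)] by simp_all
  have x: "?A # ?\<Delta> \<turnstile> Var 0 \<Colon> wk ?A"
    by (rule var_cast[OF d]) simp_all
  have "inh (?A # ?\<Delta>) (IsProp (wk ?B))"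
    using inh_weaken[OF h d, of "[_, _, _]" 3] by simp
  from funext[OF S A2 B2 v isProp_elim[OF this arr_elim[OF w(1) x] arr_elim[OF w(2) x]]]
  show "inh ?\<Delta> (Id (wk (wk (Arr A B))) (Var 1) (Var 0))"
    by simp
qed

text \<open>Of two elements to be compared, the first one already witnesses that the type is
  inhabited.\<close>

lemma isProp_if_inh:
  assumes P: "\<Gamma> \<turnstile> P \<Colon> Univ u" and h: "inh (P # \<Gamma>) (IsProp (wk P))"
  shows "inh \<Gamma> (IsProp P)"
proof (rule isProp_intro[OF P])
  note P1 = wk_Univ[OF P P]
  have "inh (wk P # P # \<Gamma>) (IsProp (wk (wk P)))"
    using inh_wk[OF P1 h] by simp
  then show "inh (wk P # P # \<Gamma>) (Id (wk (wk P)) (Var 1) (Var 0))"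
    by (rule isProp_elim) (rule var_cast[OF ctx_ty[OF P1]]; simp)+
qed

lemma isProp_if_contr:
  assumes X: "\<Gamma> \<turnstile> X \<Colon> Univ u" and c: "\<Gamma> \<turnstile> c \<Colon> X" and h: "inh \<Gamma> (Pi X (Id (wk X) (wk c) (Var 0)))"
  shows "inh \<Gamma> (IsProp X)"
proof (rule isProp_intro[OF X])
  let ?\<Delta> = "wk X # X # \<Gamma>" and ?X = "wk (wk X)" and ?c = "wk (wk c)"
  note X1 = wk_Univ[OF X X]
  have X2: "?\<Delta> \<turnstile> ?X \<Colon> Univ u" and c2: "?\<Delta> \<turnstile> ?c \<Colon> ?X"
    by (rule wk_Univ[OF X1 X1], rule wk_ty[OF X1 wk_ty[OF X c]])
  have h2: "inh ?\<Delta> (Pi ?X (Id (wk ?X) (wk ?c) (Var 0)))"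
    using inh_wk[OF X1 inh_wk[OF X h]] by simp
  have v: "?\<Delta> \<turnstile> Var 1 \<Colon> ?X" "?\<Delta> \<turnstile> Var 0 \<Colon> ?X"
    by (rule var_cast[OF ctx_ty[OF X1]]; simp)+
  have "inh ?\<Delta> (Id ?X ?c (Var 1))" "inh ?\<Delta> (Id ?X ?c (Var 0))"
    using inh_App[OF h2 v(1)] inh_App[OF h2 v(2)] by simp_all
  then show "inh ?\<Delta> (Id ?X (Var 1) (Var 0))"
    by (blast intro: inh_trans[OF X2 v(1) c2 v(2)] inh_sym[OF X2 c2 v(1)])
qed

definition Const_map :: "('c, 'l) tm \<Rightarrow> ('c, 'l) tm" where
  "Const_map X = Lam X (Lam (wk X) (Var 1))"

text \<open>
  Contractibility of \<open>X\<close>, as \<open>\<Sigma>(c : X), (\<lambda>_. c) = id\<close>: unlike \<open>\<Sigma>(c : X), \<Pi>(x : X), c = x\<close>, this is a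
  fiber of a map into the non-dependent function type \<open>X \<rightarrow> X\<close>, so that non-dependent function
  extensionality suffices to prove it a proposition.
\<close>
definition Ctr :: "('c, 'l) tm \<Rightarrow> ('c, 'l) tm" where
  "Ctr X = Fiber X (Arr X X) (Const_map X) (Lam X (Var 0))"

lemma sub_Ctr [simp]:
  "sub s (Const_map X) = Const_map (sub s X)"
  "sub s (Ctr X) = Ctr (sub s X)"
  by (simp_all add: Const_map_def Ctr_def)

lemma const_map:
  assumes X: "\<Gamma> \<turnstile> X \<Colon> Univ u"
  shows "\<Gamma> \<turnstile> Const_map X \<Colon> Arr X (Arr X X)"
    and "\<Gamma> \<turnstile> Lam X (Var 0) \<Colon> Arr X X"
    and "\<Gamma> \<turnstile> a \<Colon> X \<Longrightarrow> \<Gamma> \<turnstile> b \<Colon> X \<Longrightarrow> \<Gamma> \<turnstile> App (App (Const_map X) a) b \<doteq> a \<Colon> X"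
    and "\<Gamma> \<turnstile> b \<Colon> X \<Longrightarrow> \<Gamma> \<turnstile> App (Lam X (Var 0)) b \<doteq> b \<Colon> X"
proof -
  note X1 = wk_Univ[OF X X]
  have v: "wk X # X # \<Gamma> \<turnstile> Var 1 \<Colon> wk (wk X)"
    by (rule var_cast[OF ctx_ty[OF X1]]) simp_all
  have k: "X # \<Gamma> \<turnstile> Lam (wk X) (Var 1) \<Colon> wk (Arr X X)"
    using arr_intro[OF X1 v] by simp
  show "\<Gamma> \<turnstile> Const_map X \<Colon> Arr X (Arr X X)"
    unfolding Const_map_def by (rule arr_intro[OF X k])
  have v0: "X # \<Gamma> \<turnstile> Var 0 \<Colon> wk X"
    by (rule var_cast[OF ctx_ty[OF X]]) simp_all
  show "\<Gamma> \<turnstile> Lam X (Var 0) \<Colon> Arr X X"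
    by (rule arr_intro[OF X v0])
  show "\<Gamma> \<turnstile> App (Lam X (Var 0)) b \<doteq> b \<Colon> X" if "\<Gamma> \<turnstile> b \<Colon> X"
    using arr_beta[OF X v0 that] by simp
  assume a: "\<Gamma> \<turnstile> a \<Colon> X" and b: "\<Gamma> \<turnstile> b \<Colon> X"
  have "\<Gamma> \<turnstile> App (Const_map X) a \<doteq> Lam X (wk a) \<Colon> Arr X X"
    using arr_beta[OF X k a] by (simp add: Const_map_def)
  from arr_app_cong[OF this eq_refl[OF b]] arr_beta[OF X wk_ty[OF X a] b]
  show "\<Gamma> \<turnstile> App (App (Const_map X) a) b \<doteq> a \<Colon> X"
    by (auto intro: eq_trans)
qed

lemma ctr_form: "\<Gamma> \<turnstile> X \<Colon> Univ u \<Longrightarrow> \<Gamma> \<turnstile> Ctr X \<Colon> Univ u"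
  using fiber_form[OF _ arr_form const_map(1,2)] unfolding Ctr_def by fastforce

text \<open>Evaluation at the variable turns the path of functions into a path between values, both
  of which compute.\<close>

lemma ctr_contr:
  assumes X: "\<Gamma> \<turnstile> X \<Colon> Univ u" and c: "\<Gamma> \<turnstile> c \<Colon> X"
    and h: "inh \<Gamma> (Id (Arr X X) (App (Const_map X) c) (Lam X (Var 0)))"
  shows "inh \<Gamma> (Pi X (Id (wk X) (wk c) (Var 0)))"
proof (rule inh_Lam[OF X])
  note X1 = wk_Univ[OF X X] and c1 = wk_ty[OF X c]
  have v: "X # \<Gamma> \<turnstile> Var 0 \<Colon> wk X"
    by (rule var_cast[OF ctx_ty[OF X]]) simp_all
  note k = const_map[OF X1]
  note F = arr_form[OF X1 X1]
  have t: "Arr (wk X) (wk X) # X # \<Gamma> \<turnstile> App (Var 0) (Var 1) \<Colon> wk (wk X)"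
    using arr_elim[OF var_cast[OF ctx_ty[OF F]] var_cast[OF ctx_ty[OF F]], of 0 "wk (wk X)" "wk (wk X)" 1] by simp
  have h1: "inh (X # \<Gamma>) (Id (Arr (wk X) (wk X)) (App (Const_map (wk X)) (wk c)) (Lam (wk X) (Var 0)))"
    using inh_wk[OF X h] by simp
  have "inh (X # \<Gamma>) (Id (wk X) (App (App (Const_map (wk X)) (wk c)) (Var 0)) (App (Lam (wk X) (Var 0)) (Var 0)))"
    using inh_ap[OF F X1 t arr_elim[OF k(1) c1] k(2) h1] by simp
  then show "inh (X # \<Gamma>) (Id (wk X) (wk c) (Var 0))"
    using Id_conv[OF X1 k(3)[OF c1 v] k(4)[OF v]] by blast
qed

text \<open>A contraction may be assumed. Then \<open>X\<close> is a proposition, hence so is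
  \<open>X \<rightarrow> X\<close>, and \<open>Ctr X\<close> is a fiber of a map between
  propositions.\<close>

lemma isProp_Ctr:
  assumes S: "univalence S" and X: "\<Gamma> \<turnstile> X \<Colon> Univ u"
  shows "inh \<Gamma> (IsProp (Ctr X))"
proof -
  \<comment> \<open>General in the context, because it is applied below the variable for the assumed
    contraction.\<close>
  have *: "inh \<Delta> (IsProp (Ctr Y))" if Y: "\<Delta> \<turnstile> Y \<Colon> Univ u" and q: "\<Delta> \<turnstile> q \<Colon> Ctr Y" for \<Delta> Y q
  proof -
    note F = arr_form[OF Y Y] and k = const_map[OF Y]
    note fam = fiber_family[OF Y F k(1,2)] and q = q[unfolded Ctr_def Fiber_def]
    have "inh \<Delta> (Id (Arr Y Y) (App (Const_map Y) (Fst Y q)) (Lam Y (Var 0)))"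
      using inh_Snd[OF Y fam q] by simp
    note h = isProp_if_contr[OF Y Fst(1)[OF Y fam q] ctr_contr[OF Y Fst(1)[OF Y fam q] this]]
    show ?thesis
      unfolding Ctr_def by (rule isProp_Fiber[OF Y F k(1,2) h isProp_Arr[OF S Y Y h]])
  qed
  note C = ctr_form[OF X]
  show ?thesis
    by (rule isProp_if_inh[OF C]) (use *[OF wk_Univ[OF C X] var_cast[OF ctx_ty[OF C], of 0]] in simp)
qed

text \<open>Function extensionality turns the pointwise contraction into a path of functions. The
  judgmental equation keeps track of the chosen center, on which the retraction law depends.\<close>

lemma ctr_intro:
  assumes S: "univalence S" and X: "\<Gamma> \<turnstile> X \<Colon> Univ u" and c: "\<Gamma> \<turnstile> c \<Colon> X"
    and h: "inh \<Gamma> (Pi X (Id (wk X) (wk c) (Var 0)))"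
  obtains p where "\<Gamma> \<turnstile> p \<Colon> Ctr X" "\<Gamma> \<turnstile> Fst X p \<doteq> c \<Colon> X"
proof -
  note F = arr_form[OF X X] and k = const_map[OF X]
  note X1 = wk_Univ[OF X X] and c1 = wk_ty[OF X c]
  have v: "X # \<Gamma> \<turnstile> Var 0 \<Colon> wk X"
    by (rule var_cast[OF ctx_ty[OF X]]) simp_all
  note k1 = const_map[OF X1]
  have "inh (X # \<Gamma>) (Id (wk X) (wk c) (Var 0))"
    using inh_App[OF inh_wk[OF X h, simplified] v[simplified]] by simp
  then have "inh (X # \<Gamma>) (Id (wk X) (App (App (Const_map (wk X)) (wk c)) (Var 0)) (App (Lam (wk X) (Var 0)) (Var 0)))"
    using Id_conv[OF X1 k1(3)[OF c1 v] k1(4)[OF v]] by blast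
  then have "inh \<Gamma> (Id (Arr X X) (App (Const_map X) c) (Lam X (Var 0)))"
    by (intro funext[OF S X X arr_elim[OF k(1) c] k(2)]) simp
  then obtain q where "\<Gamma> \<turnstile> q \<Colon> Id (Arr X X) (App (Const_map X) c) (Lam X (Var 0))"
    by (rule inhE)
  then have q: "\<Gamma> \<turnstile> q \<Colon> sub (c \<bullet> Var) (Id (wk (Arr X X)) (App (wk (Const_map X)) (Var 0)) (wk (Lam X (Var 0))))"
    by simp
  note fam = fiber_family[OF X F k(1,2)]
  show thesis
    by (rule that[unfolded Ctr_def Fiber_def, OF sg_intro[OF fam c q] Fst(2)[OF X fam c q]])
qed

section \<open>Families with contractible total space\<close>

definition Tot :: "('c, 'l) tm \<Rightarrow> ('c, 'l) tm \<Rightarrow> ('c, 'l) tm" where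
  "Tot D A = Sg D (App (wk A) (Var 0))"

lemma sub_Tot [simp]: "sub s (Tot D A) = Tot (sub s D) (sub s A)"
  by (simp add: Tot_def)

lemma tot_family:
  assumes D: "\<Gamma> \<turnstile> D \<Colon> Univ u" and A: "\<Gamma> \<turnstile> A \<Colon> Arr D (Univ u)"
  shows "D # \<Gamma> \<turnstile> App (wk A) (Var 0) \<Colon> Univ u"
  using arr_elim[OF _ var_cast[OF ctx_ty[OF D], of 0]] wk_ty[OF D A] by simp

lemma tot_form:
  assumes "\<Gamma> \<turnstile> D \<Colon> Univ u" "\<Gamma> \<turnstile> A \<Colon> Arr D (Univ u)"
  shows "\<Gamma> \<turnstile> Tot D A \<Colon> Univ u"
  using sg_form[OF assms(1) tot_family[OF assms]] by (simp add: Tot_def)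

text \<open>This is the partial element to be extended: where the family \<open>A\<close> has
  contractible total space, its value is the point of \<open>D\<close> underneath the
  center.\<close>

lemma ctr_point:
  assumes D: "\<Gamma> \<turnstile> D \<Colon> Univ u" and A: "\<Gamma> \<turnstile> A \<Colon> Arr D (Univ u)"
  defines "f \<equiv> Lam (Ctr (Tot D A)) (Fst (wk D) (Fst (wk (Tot D A)) (Var 0)))"
  shows "\<Gamma> \<turnstile> f \<Colon> Arr (Ctr (Tot D A)) D"
    and "\<Gamma> \<turnstile> p \<Colon> Ctr (Tot D A) \<Longrightarrow> \<Gamma> \<turnstile> App f p \<doteq> Fst D (Fst (Tot D A) p) \<Colon> D"
proof -
  note T = tot_form[OF D A]
  note C = ctr_form[OF T]
  have A1: "Ctr (Tot D A) # \<Gamma> \<turnstile> wk A \<Colon> Arr (wk D) (Univ u)"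
    using wk_ty[OF C A] by simp
  note D1 = wk_Univ[OF C D]
  have T1: "Ctr (Tot D A) # \<Gamma> \<turnstile> wk (Tot D A) \<Colon> Univ u"
    by (rule wk_Univ[OF C T])
  note fam = fiber_family[OF T1 arr_form[OF T1 T1] const_map(1,2)[OF T1]]
  have "Ctr (Tot D A) # \<Gamma> \<turnstile> Var 0 \<Colon> Ctr (wk (Tot D A))"
    by (rule var_cast[OF ctx_ty[OF C]]) simp_all
  from Fst(1)[OF T1 fam this[unfolded Ctr_def[of "wk (Tot D A)"] Fiber_def[of "wk (Tot D A)"]]]
  have "Ctr (Tot D A) # \<Gamma> \<turnstile> Fst (wk (Tot D A)) (Var 0) \<Colon> Sg (wk D) (App (wk (wk A)) (Var 0))"
    by (simp add: Tot_def[of "sub (shift (Suc 0)) D"])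
  note b = Fst(1)[OF D1 tot_family[OF D1 A1] this]
  show "\<Gamma> \<turnstile> f \<Colon> Arr (Ctr (Tot D A)) D"
    unfolding f_def by (rule arr_intro[OF C b])
  show "\<Gamma> \<turnstile> App f p \<doteq> Fst D (Fst (Tot D A) p) \<Colon> D" if "\<Gamma> \<turnstile> p \<Colon> Ctr (Tot D A)"
    using arr_beta[OF C b that] by (simp add: f_def)
qed

text \<open>\<open>Tot D A\<close> and \<open>Singl D x\<close> are convertible but different terms,
  since \<open>A\<close> is an abstraction still to be applied. The contraction of the singleton is
  carried along this conversion, which keeps \<open>x\<close> underneath the center.\<close>

lemma singleton_Ctr:
  assumes S: "univalence S" and D: "\<Gamma> \<turnstile> D \<Colon> Univ u" and x: "\<Gamma> \<turnstile> x \<Colon> D"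
  defines "A \<equiv> Lam D (Id (wk D) (wk x) (Var 0))"
  obtains p where "\<Gamma> \<turnstile> p \<Colon> Ctr (Tot D A)" "\<Gamma> \<turnstile> Fst D (Fst (Tot D A) p) \<doteq> x \<Colon> D"
proof -
  note F = singl_family[OF D x]
  have F': "D # \<Gamma> \<turnstile> Id (wk D) (wk x) (Var 0) \<Colon> wk (Univ u)"
    using F by simp
  have A: "\<Gamma> \<turnstile> A \<Colon> Arr D (Univ u)"
    unfolding A_def by (rule arr_intro[OF D F'])
  note fam = tot_family[OF D A] and T = tot_form[OF D A]
  have v: "D # \<Gamma> \<turnstile> Var 0 \<Colon> wk D"
    by (rule var_cast[OF ctx_ty[OF D]]) simp_all
  have "D # \<Gamma> \<turnstile> App (wk A) (Var 0) \<doteq> Id (wk D) (wk x) (Var 0) \<Colon> Univ u"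
    using arr_beta[OF wk_Univ[OF D D] _ v, of "Id (wk (wk D)) (wk (wk x)) (Var 0)" "Univ u"]
      singl_family[OF wk_Univ[OF D D] wk_ty[OF D x]] by (simp add: A_def)
  note e = eq_sym[OF this]
  from sg_cong[OF D eq_refl[OF D] e]
  have ST: "\<Gamma> \<turnstile> Singl D x \<doteq> Tot D A \<Colon> Univ u"
    by (simp add: Singl_def Tot_def)
  let ?c = "Pr (App (wk A) (Var 0)) x (Refl x)"
  have r: "\<Gamma> \<turnstile> Refl x \<Colon> sub (x \<bullet> Var) (Id (wk D) (wk x) (Var 0))"
    using id_intro[OF x] by simp
  \<comment> \<open>Reflexivity is typed by \<open>x = x\<close> and has to be retyped in the fiber
    of \<open>A\<close> over \<open>x\<close>, to which that type reduces.\<close>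
  have "\<Gamma> \<turnstile> sub (x \<bullet> Var) (Id (wk D) (wk x) (Var 0)) \<doteq> sub (x \<bullet> Var) (App (wk A) (Var 0)) \<Colon> Univ u"
    using substitute(2)[OF _ has_type_ctx(2)[OF x] e, of "x \<bullet> Var"]
      wf_sub_scons[OF _ wf_sub_Var[OF has_type_ctx(2)[OF x]], of x D] x by simp
  note r' = conv[OF r this]
  have c: "\<Gamma> \<turnstile> ?c \<Colon> Tot D A"
    unfolding Tot_def by (rule sg_intro[OF fam x r'])
  have s: "\<Gamma> \<turnstile> singl D x \<doteq> ?c \<Colon> Singl D x"
    unfolding singl_def Singl_def by (rule pr_cong[OF F e eq_refl[OF x] eq_refl[OF r]])
  note SD = Singl_form[OF D x]
  have ST1: "Singl D x # \<Gamma> \<turnstile> wk (Singl D x) \<doteq> wk (Tot D A) \<Colon> Univ u"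
    using wk_eqtm[OF SD ST] by simp
  have "Singl D x # \<Gamma> \<turnstile> Var 0 \<Colon> wk (Singl D x)"
    by (rule var_cast[OF ctx_ty[OF SD]]) simp_all
  from pi_cong[OF SD ST id_cong[OF ST1 wk_eqtm[OF SD s] eq_refl[OF this]]]
  have "\<Gamma> \<turnstile> Pi (Singl D x) (Id (wk (Singl D x)) (wk (singl D x)) (Var 0)) \<doteq>
      Pi (Tot D A) (Id (wk (Tot D A)) (wk ?c) (Var 0)) \<Colon> Univ u"
    by simp
  from inh_conv[OF Singl_contr[OF D x] this]
  have h: "inh \<Gamma> (Pi (Tot D A) (Id (wk (Tot D A)) (wk ?c) (Var 0)))" .
  obtain p where p: "\<Gamma> \<turnstile> p \<Colon> Ctr (Tot D A)" "\<Gamma> \<turnstile> Fst (Tot D A) p \<doteq> ?c \<Colon> Tot D A"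
    by (rule ctr_intro[OF S T c h])
  have pT: "\<Gamma> \<turnstile> Fst (Tot D A) p \<doteq> ?c \<Colon> Sg D (App (wk A) (Var 0))"
    using p(2) by (simp only: Tot_def)
  have "\<Gamma> \<turnstile> Fst D (Fst (Tot D A) p) \<doteq> x \<Colon> D"
    by (rule eq_trans[OF Fst_cong[OF D fam pT] Fst(2)[OF D fam x r']])
  with p(1) show thesis
    by (rule that)
qed

lemma RetractOfPower_if_AInjective:
  assumes S: "univalence S" and D: "\<Gamma> \<turnstile> D \<Colon> Univ u" and I: "inh \<Gamma> (AInjective u u D)"
  shows "inh \<Gamma> (RetractOfPower u D)"
proof -
  obtain I where I: "\<Gamma> \<turnstile> I \<Colon> AInjective u u D"
    using I by (rule inhE)
  let ?F = "Arr D (Univ u)"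
  note U = univ[OF has_type_ctx(2)[OF D], of u]
  note F = arr_form[OF D U]
  let ?T = "Tot (wk D) (Var 0)"
  let ?f = "Lam (Ctr ?T) (Fst (wk (wk D)) (Fst (wk ?T) (Var 0)))"
  note D1 = wk_Univ[OF F D]
  have I1: "?F # \<Gamma> \<turnstile> wk I \<Colon> AInjective u u (wk D)"
    using wk_ty[OF F I] by simp
  have v: "?F # \<Gamma> \<turnstile> Var 0 \<Colon> Arr (wk D) (Univ u)"
    by (rule var_cast[OF ctx_ty[OF F]]) simp_all
  note T = tot_form[OF D1 v]
  \<comment> \<open>\<open>d\<close> is an open term in a variable family on \<open>D\<close>;
    abstraction over this variable gives the retraction.\<close>
  obtain d where d: "?F # \<Gamma> \<turnstile> d \<Colon> wk D"
    and k: "inh (?F # \<Gamma>) (Pi (Ctr ?T) (Id (wk (wk D)) (wk d) (App (wk ?f) (Var 0))))"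
    by (rule AInjective_flabby[OF D1 I1 ctr_form[OF T] isProp_Ctr[OF S T] ctr_point(1)[OF D1 v]])
  let ?r = "Lam ?F d"
  note r = arr_intro[OF F d]

  let ?\<Delta> = "D # \<Gamma>" and ?A = "Lam (wk D) (Id (wk (wk D)) (wk (Var 0)) (Var 0))"
  let ?s = "Lam D ?A" and ?T' = "Tot (wk D) ?A" and ?d = "sub (?A \<bullet> shift 1) d"
  let ?f' = "Lam (Ctr ?T') (Fst (wk (wk D)) (Fst (wk ?T') (Var 0)))"
  note D2 = wk_Univ[OF D D]
  have x: "?\<Delta> \<turnstile> Var 0 \<Colon> wk D"
    by (rule var_cast[OF ctx_ty[OF D]]) simp_all
  have body: "wk D # ?\<Delta> \<turnstile> Id (wk (wk D)) (wk (Var 0)) (Var 0) \<Colon> wk (Univ u)"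
    using singl_family[OF D2 x] by simp
  note A = arr_intro[OF D2 body]
  have A': "?\<Delta> \<turnstile> ?A \<Colon> wk ?F"
    using A by simp
  note s = arr_intro[OF D A']
  obtain p where p: "?\<Delta> \<turnstile> p \<Colon> Ctr ?T'" "?\<Delta> \<turnstile> Fst (wk D) (Fst ?T' p) \<doteq> Var 0 \<Colon> wk D"
    by (rule singleton_Ctr[OF S D2 x])
  have "wf_sub S (?F # \<Gamma>) ?\<Delta> (?A \<bullet> shift 1)"
    by (rule wf_sub_scons[OF _ wf_sub_shift[OF ctx_ty[OF D], of "[_]"]]) (use A' in simp_all)
  \<comment> \<open>The extension law of \<open>d\<close> is instantiated at the family of paths
    starting at the variable, so that it can be applied to the contraction \<open>p\<close> of its
    total space.\<close>
  from inh_substitute[OF this ctx_ty[OF D] k]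
  have "inh ?\<Delta> (Pi (Ctr ?T') (Id (wk (wk D)) (wk ?d) (App (wk ?f') (Var 0))))"
    by simp
  from inh_App[OF this p(1)]
  have dp: "inh ?\<Delta> (Id (wk D) ?d (App ?f' p))"
    by simp
  \<comment> \<open>The center lies over the variable by computation, which identifies the value of
    the retraction.\<close>
  have f': "?\<Delta> \<turnstile> App ?f' p \<doteq> Var 0 \<Colon> wk D"
    by (rule eq_trans[OF ctr_point(2)[OF D2 A p(1)] p(2)])

  have "wk D # ?\<Delta> \<turnstile> sub (Var 0 \<bullet> shift 2) ?A \<Colon> sub (Var 0 \<bullet> shift 2) (wk ?F)"
    by (rule inst_shift[OF A' var_cast[OF ctx_ty[OF D2]], of _ _ "[_, _]"]) simp_all
  then have sx: "?\<Delta> \<turnstile> App (wk ?s) (Var 0) \<doteq> ?A \<Colon> wk ?F"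
    using arr_beta[OF D2 _ x, of "sub (Var 0 \<bullet> shift 2) ?A" "wk ?F"] by simp
  note F1 = wk_Univ[OF D F]
  have "wk ?F # ?\<Delta> \<turnstile> sub (Var 0 \<bullet> shift 2) d \<Colon> sub (Var 0 \<bullet> shift 2) (wk D)"
    by (rule inst_shift[OF d var_cast[OF ctx_ty[OF F1]], of _ _ "[_, _]"]) simp_all
  then have "?\<Delta> \<turnstile> App (wk ?r) (App (wk ?s) (Var 0)) \<doteq> ?d \<Colon> wk D"
    using Lam_App[OF F1 _ sx A', of "sub (Var 0 \<bullet> shift 2) d" "wk D"] by simp
  from Id_conv[OF D2 this eq_sym[OF f']] dp
  have "inh ?\<Delta> (Id (wk D) (App (wk ?r) (App (wk ?s) (Var 0))) (Var 0))"
    by blast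
  then have "inh \<Gamma> (LeftInv D ?s ?r)"
    unfolding LeftInv_def by (rule inh_Lam[OF D])
  from inh_RetractOf[OF D F s r this] show ?thesis
    unfolding RetractOfPower_def by (intro inh_Pr[OF power_family[OF D] D]) simp
qed

end

section \<open>The logical equivalence inside the type theory\<close>

theorem theorem30:
  fixes S :: "('c, 'l::ulevel) sig" and u :: 'l
  assumes "univalence S"
    and "prop_truncations S"
    and "prop_resizing S"
  shows "\<exists>t. S \<triangleright> [] \<turnstile> t \<Colon>
    Pi (Univ u) (LogEquiv (AInjective u u (Var 0)) (RetractOfPower u (Var 0)))"
proof -
  note U = univ[OF ctx_nil, of S u]
  have D: "S \<triangleright> [Univ u] \<turnstile> Var 0 \<Colon> Univ u"
    by (rule var_cast[OF ctx_ty[OF U]]) simp_all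
  obtain l where I: "S \<triangleright> [Univ u] \<turnstile> AInjective u u (Var 0) \<Colon> Univ l"
    using AInjective_form[OF D] by blast
  note R = RetractOfPower_form[OF D]
  \<comment> \<open>The hypothesis enters the context as a variable, where the implication between
    inhabited types applies; abstraction then turns it into an internal function.\<close>
  have "inh S (AInjective u u (Var 0) # [Univ u]) (RetractOfPower u (wk (Var 0)))"
    by (rule RetractOfPower_if_AInjective[OF assms(1) wk_Univ[OF I D] inhI])
      (rule var_cast[OF ctx_ty[OF I], of 0]; simp)
  then have 1: "inh S [Univ u] (Arr (AInjective u u (Var 0)) (RetractOfPower u (Var 0)))"
    by (intro inh_Arr[OF I]) simp
  have "inh S (RetractOfPower u (Var 0) # [Univ u]) (AInjective u u (wk (Var 0)))"
    by (rule AInjective_if_RetractOfPower[OF assms(1) wk_Univ[OF R D] inhI])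
      (rule var_cast[OF ctx_ty[OF R], of 0]; simp)
  then have 2: "inh S [Univ u] (Arr (RetractOfPower u (Var 0)) (AInjective u u (Var 0)))"
    by (intro inh_Arr[OF R]) simp
  from inh_Lam[OF U inh_Times[OF arr_form[OF I R] arr_form[OF R I] 1 2]] show ?thesis
    by (simp add: LogEquiv_def inh_def)
qed

end
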